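(* Let $c\in\mathbb{N}$ be a fixed integer. Consider the SGSP restricted to instances in which $G$ is a tree, the maximum frequency is at most $c$, every reward subgraph is a single node, every penalty subgraph is connected, and the weight function is polynomially bounded. Then this restricted SGSP is solvable in polynomial time.
   Context: SGSP: given a graph $G$, sets $\mathcal{R},\mathcal{P}$ of subgraphs of $G$ (reward and penalty subgraphs) and weights $w:\mathcal{R}\cup\mathcal{P}\to\mathbb{R}_+$, find $S\subseteq V(G)$ maximizing $\sum_{R\in\mathcal{R}: V(R)\cap S\neq\emptyset}w(R)-\sum_{P\in\mathcal{P}: V(P)\subseteq S}w(P)$. The frequency of a node $v$ is the number of penalty subgraphs containing $v$, and the maximum frequency is the maximum over all nodes. A weight function is polynomially bounded if its values are nonnegative integers bounded by a polynomial in the size of the instance. *)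

theory Defs
  imports
    "HOL-Library.Log_Nat"
    "HOL-Computational_Algebra.Polynomial"
    "Graph_Theory.Digraph_Component"
begin

section \<open>Polynomial time: the random access machine of Cook and Reckhow\<close>

text \<open>
  The arithmetic of the machine is addition and (truncated) subtraction only. Without
  multiplication, unit-cost time is polynomially related to Turing machine time, when the
  length of the input is measured in bits.
\<close>

datatype instr =
    LoadConst nat nat   \<comment> \<open>\<open>M[i] := k\<close>\<close>
  | Move nat nat        \<comment> \<open>\<open>M[i] := M[j]\<close>\<close>
  | Add nat nat nat     \<comment> \<open>\<open>M[i] := M[j] + M[k]\<close>\<close>
  | Sub nat nat nat     \<comment> \<open>\<open>M[i] := max 0 (M[j] - M[k])\<close>\<close>
  | Load nat nat        \<comment> \<open>\<open>M[i] := M[M[j]]\<close>\<close>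
  | Store nat nat       \<comment> \<open>\<open>M[M[i]] := M[j]\<close>\<close>
  | Jump nat            \<comment> \<open>\<open>goto l\<close>\<close>
  | JumpZero nat nat    \<comment> \<open>\<open>if M[i] = 0 then goto l\<close>\<close>
  | Read nat            \<comment> \<open>\<open>M[i] :=\<close> next input number, 0 if the input is exhausted\<close>
  | Print nat           \<comment> \<open>append \<open>M[i]\<close> to the output\<close>

text \<open>Program counter, memory, remaining input, output so far.\<close>

type_synonym config = "nat \<times> (nat \<Rightarrow> nat) \<times> nat list \<times> nat list"

fun exec :: "instr \<Rightarrow> config \<Rightarrow> config" where
  "exec (LoadConst i k) (pc, M, xs, ys) = (Suc pc, M(i := k), xs, ys)"
| "exec (Move i j) (pc, M, xs, ys) = (Suc pc, M(i := M j), xs, ys)"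
| "exec (Add i j k) (pc, M, xs, ys) = (Suc pc, M(i := M j + M k), xs, ys)"
| "exec (Sub i j k) (pc, M, xs, ys) = (Suc pc, M(i := M j - M k), xs, ys)"
| "exec (Load i j) (pc, M, xs, ys) = (Suc pc, M(i := M (M j)), xs, ys)"
| "exec (Store i j) (pc, M, xs, ys) = (Suc pc, M(M i := M j), xs, ys)"
| "exec (Jump l) (pc, M, xs, ys) = (l, M, xs, ys)"
| "exec (JumpZero i l) (pc, M, xs, ys) = (if M i = 0 then l else Suc pc, M, xs, ys)"
| "exec (Read i) (pc, M, xs, ys) =
     (Suc pc, M(i := (case xs of [] \<Rightarrow> 0 | x # _ \<Rightarrow> x)), tl xs, ys)"
| "exec (Print i) (pc, M, xs, ys) = (Suc pc, M, xs, ys @ [M i])"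

text \<open>A configuration whose program counter lies outside the program is halted.\<close>

definition ram_step :: "instr list \<Rightarrow> config \<Rightarrow> config" where
  "ram_step prog cf = (if fst cf < length prog then exec (prog ! fst cf) cf else cf)"

definition ram_outputs_within :: "instr list \<Rightarrow> nat list \<Rightarrow> nat \<Rightarrow> nat list \<Rightarrow> bool" where
  "ram_outputs_within prog xs t ys \<longleftrightarrow>
     (\<exists>t' \<le> t. \<exists>pc M xs'. (ram_step prog ^^ t') (0, \<lambda>_. 0, xs, []) = (pc, M, xs', ys)
        \<and> length prog \<le> pc)"

text \<open>Binary length, where every number is followed by a separator.\<close>

definition bit_size :: "nat list \<Rightarrow> nat" where
  "bit_size xs = (\<Sum>x\<leftarrow>xs. Suc (floorlog 2 x))"

text \<open>
  A search problem is given by the relation between its instances and their codes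
  (an instance may have several codes, all of which have to be solved)
  and the relation between its instances and the codes of their solutions.
\<close>

definition poly_time_solvable ::
    "('i \<Rightarrow> nat list \<Rightarrow> bool) \<Rightarrow> ('i \<Rightarrow> nat list \<Rightarrow> bool) \<Rightarrow> bool" where
  "poly_time_solvable inst_code sol_code \<longleftrightarrow>
     (\<exists>(prog :: instr list) (p :: nat poly). \<forall>I xs. inst_code I xs \<longrightarrow>
        (\<exists>ys. ram_outputs_within prog xs (poly p (bit_size xs)) ys \<and> sol_code I ys))"


section \<open>Subgraph selection with rewards and penalties\<close>

text \<open>
  Finite simple undirected graphs are the symmetric digraphs of \<^locale>\<open>pair_graph\<close>. The library's
  \<^const>\<open>tree\<close> is not usable for them: it counts the walk along an edge and back as a cycle.
  \<^const>\<open>Digraph_Component.connected\<close> requires a nonempty vertex set.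
\<close>

definition undirected_tree :: "'v pair_pre_digraph \<Rightarrow> bool" where
  "undirected_tree G \<longleftrightarrow> pair_graph G \<and> Digraph_Component.connected (with_proj G)
     \<and> \<not> (\<exists>p. pre_digraph.cycle (with_proj G) p \<and> 3 \<le> length p)"

record 'v sgsp =
  host :: "'v pair_pre_digraph"
  rewards :: "'v pair_pre_digraph set"
  penalties :: "'v pair_pre_digraph set"
  weight :: "'v pair_pre_digraph \<Rightarrow> real"

definition sgsp_instance :: "'v sgsp \<Rightarrow> bool" where
  "sgsp_instance I \<longleftrightarrow> pair_graph (host I)
     \<and> (\<forall>H \<in> rewards I \<union> penalties I.
          pair_graph H \<and> subgraph (with_proj H) (with_proj (host I)) \<and> 0 \<le> weight I H)"

definition sgsp_value :: "'v sgsp \<Rightarrow> 'v set \<Rightarrow> real" where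
  "sgsp_value I S =
     (\<Sum>R \<in> {R \<in> rewards I. pverts R \<inter> S \<noteq> {}}. weight I R)
     - (\<Sum>P \<in> {P \<in> penalties I. pverts P \<subseteq> S}. weight I P)"

definition sgsp_optimal :: "'v sgsp \<Rightarrow> 'v set \<Rightarrow> bool" where
  "sgsp_optimal I S \<longleftrightarrow> S \<subseteq> pverts (host I)
     \<and> (\<forall>T. T \<subseteq> pverts (host I) \<longrightarrow> sgsp_value I T \<le> sgsp_value I S)"

definition frequency :: "'v sgsp \<Rightarrow> 'v \<Rightarrow> nat" where
  "frequency I v = card {P \<in> penalties I. v \<in> pverts P}"

definition max_frequency :: "'v sgsp \<Rightarrow> nat" where
  "max_frequency I = Max (frequency I ` pverts (host I))"

text \<open>All weights are nonnegative integers bounded by \<open>q n\<close>, for an instance of size \<open>n\<close>.\<close>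

definition weights_bounded :: "nat poly \<Rightarrow> nat \<Rightarrow> 'v sgsp \<Rightarrow> bool" where
  "weights_bounded q n I \<longleftrightarrow>
     (\<forall>H \<in> rewards I \<union> penalties I. \<exists>k::nat. weight I H = real k \<and> k \<le> poly q n)"


section \<open>Codes\<close>

text \<open>Vertices in any order; every undirected edge once, in either orientation.\<close>

definition graph_code :: "nat pair_pre_digraph \<Rightarrow> nat list \<Rightarrow> bool" where
  "graph_code G xs \<longleftrightarrow> (\<exists>vs es.
     distinct vs \<and> set vs = pverts G \<and>
     distinct es \<and> set es \<union> (set es)\<inverse> = parcs G \<and> (\<forall>(u, v) \<in> set es. (v, u) \<notin> set es) \<and>
     xs = length vs # vs @ length es # concat (map (\<lambda>(u, v). [u, v]) es))"

definition weighted_graph_code ::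
    "(nat pair_pre_digraph \<Rightarrow> real) \<Rightarrow> nat pair_pre_digraph \<Rightarrow> nat list \<Rightarrow> bool" where
  "weighted_graph_code w H xs \<longleftrightarrow> (\<exists>k ys. w H = real k \<and> graph_code H ys \<and> xs = k # ys)"

definition family_code ::
    "(nat pair_pre_digraph \<Rightarrow> real) \<Rightarrow> nat pair_pre_digraph set \<Rightarrow> nat list \<Rightarrow> bool" where
  "family_code w F xs \<longleftrightarrow> (\<exists>Hs cs. distinct Hs \<and> set Hs = F \<and>
     list_all2 (weighted_graph_code w) Hs cs \<and> xs = length Hs # concat cs)"

definition sgsp_code :: "nat sgsp \<Rightarrow> nat list \<Rightarrow> bool" where
  "sgsp_code I xs \<longleftrightarrow> (\<exists>g r p. graph_code (host I) g \<and>
     family_code (weight I) (rewards I) r \<and> family_code (weight I) (penalties I) p \<and>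
     xs = g @ r @ p)"

definition sgsp_solution_code :: "nat sgsp \<Rightarrow> nat list \<Rightarrow> bool" where
  "sgsp_solution_code I ys \<longleftrightarrow> distinct ys \<and> sgsp_optimal I (set ys)"

end

theory Submission
  imports Defs "HOL-Library.Countable"
begin

text \<open>
  Maximising the value is minimising the total weight of missed rewards and fully selected
  penalties. Root the tree, and call a penalty alive at \<open>v\<close> for a selection if the selection contains
  all vertices of the penalty in the subtree below \<open>v\<close>. At most \<open>2 ^ c\<close> sets of penalties can be alive
  at \<open>v\<close>, so for each of them a table stores the least cost of a selection below \<open>v\<close>; tables are merged
  into the parent from the leaves upwards. A connected penalty that contains \<open>v\<close> but not its parent
  lies below \<open>v\<close>, so its weight is charged when \<open>v\<close> is merged.

  Costs are stored as \<open>2 ^ n * cost + mask\<close>, where bit \<open>i\<close> of the mask tells whether vertex \<open>i\<close> is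
  selected. These numbers are additive like the costs themselves, and an optimal selection can be
  read off the minimum. Stripping the cost by repeated subtraction takes as many steps as the cost
  is large: here polynomially bounded weights are needed.

  The algorithm is a program in a small language whose only loops have iteration counts fixed on
  entry, so that its semantics is a total function and its running time is polynomial in any common
  bound of these counts.
\<close>

section \<open>A loop language and its compilation\<close>

text \<open>The machine adds and subtracts natural numbers, and this shapes the encoding. Minimising
  a cost avoids negative values, and unit-cost addition handles \<open>n\<close>-bit masks in one
  step, so no back pointers are kept. The empty selection completes no penalty, hence the optimum
  costs at most the total reward, and that many subtractions of \<open>2 ^ n\<close> uncover the
  mask. Table entries minimise over selections whose alive set is contained in \<open>A\<close>, not
  equal to it. Each entry is then attained, by the empty selection at worst, and no infinite value
  arises. The obstacle in merging \<open>v\<close> into \<open>u\<close> is to decide from the slots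
  alone which penalties go on, end or die. Connectivity resolves it: a penalty that meets both sides
  contains both \<open>u\<close> and \<open>v\<close>, so it has a slot at each; a penalty with a
  slot at \<open>v\<close> only is finished. Those containing \<open>u\<close> stay unpaid, so none
  is charged twice. The root is merged into a vertex without slots, which makes the answer an
  ordinary table entry. As \<open>c\<close> is fixed, slots and bit sets are unrolled into the
  program text.\<close>

datatype ('v, 'a) expr =
    Lit nat
  | Var 'v
  | Arr 'a "('v, 'a) expr"
  | Plus "('v, 'a) expr" "('v, 'a) expr"
  | Minus "('v, 'a) expr" "('v, 'a) expr"
  | Cond "('v, 'a) expr" "('v, 'a) expr" "('v, 'a) expr"

datatype ('v, 'a) com =
    Skip
  | Assign 'v "('v, 'a) expr"
  | Put 'a "('v, 'a) expr" "('v, 'a) expr"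
  | Scan 'v
  | Emit "('v, 'a) expr"
  | Seq "('v, 'a) com" "('v, 'a) com"  (infixr ";;" 60)
  | Loop "('v, 'a) expr" "('v, 'a) com"

record ('v, 'a) state =
  vars :: "'v \<Rightarrow> nat"
  arrs :: "'a \<Rightarrow> nat \<Rightarrow> nat"
  inp :: "nat list"
  outp :: "nat list"

fun val :: "('v, 'a) expr \<Rightarrow> ('v, 'a) state \<Rightarrow> nat" where
  "val (Lit k) s = k"
| "val (Var x) s = vars s x"
| "val (Arr a e) s = arrs s a (val e s)"
| "val (Plus e f) s = val e s + val f s"
| "val (Minus e f) s = val e s - val f s"
| "val (Cond e f g) s = (if val e s \<noteq> 0 then val f s else val g s)"

primrec run :: "('v, 'a) com \<Rightarrow> ('v, 'a) state \<Rightarrow> ('v, 'a) state" where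
  "run Skip = (\<lambda>s. s)"
| "run (Assign x e) = (\<lambda>s. s\<lparr>vars := (vars s)(x := val e s)\<rparr>)"
| "run (Put a i e) = (\<lambda>s. s\<lparr>arrs := (arrs s)(a := (arrs s a)(val i s := val e s))\<rparr>)"
| "run (Scan x) = (\<lambda>s. s\<lparr>vars := (vars s)(x := (case inp s of [] \<Rightarrow> 0 | y # _ \<Rightarrow> y)),
     inp := tl (inp s)\<rparr>)"
| "run (Emit e) = (\<lambda>s. s\<lparr>outp := outp s @ [val e s]\<rparr>)"
| "run (c ;; d) = (\<lambda>s. run d (run c s))"
| "run (Loop e c) = (\<lambda>s. (run c ^^ val e s) s)"

text \<open>Only iteration counts are restricted. The numbers in the cells may grow exponentially,
  which unit-cost addition permits and the masks require.\<close>

primrec safe :: "nat \<Rightarrow> ('v, 'a) com \<Rightarrow> ('v, 'a) state \<Rightarrow> bool" where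
  "safe B Skip = (\<lambda>s. True)"
| "safe B (Assign x e) = (\<lambda>s. True)"
| "safe B (Put a i e) = (\<lambda>s. True)"
| "safe B (Scan x) = (\<lambda>s. True)"
| "safe B (Emit e) = (\<lambda>s. True)"
| "safe B (c ;; d) = (\<lambda>s. safe B c s \<and> safe B d (run c s))"
| "safe B (Loop e c) = (\<lambda>s. val e s \<le> B \<and> (\<forall>k < val e s. safe B c ((run c ^^ k) s)))"


text \<open>
  Cell \<open>i\<close> of region \<open>k < K\<close> lives at address \<open>K * i + k\<close>. Region 0 holds the temporaries of
  expression evaluation, region 1 the loop counters (indexed by nesting depth), region 2 the
  scalar variables, and the remaining regions the arrays. The address \<open>K * i\<close> is computed by
  \<open>K\<close> additions.
\<close>

definition array_address :: "nat \<Rightarrow> nat \<Rightarrow> nat \<Rightarrow> 'a::countable \<Rightarrow> instr list" where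
  "array_address K t d a =
     LoadConst (K * t) (3 + to_nat a) # replicate K (Add (K * t) (K * t) (K * d))"

text \<open>Serves both as the length of the code and as a bound on its running time: expression
  code jumps forward only, so no instruction is executed twice.\<close>

primrec expr_size :: "nat \<Rightarrow> ('v, 'a) expr \<Rightarrow> nat" where
  "expr_size K (Lit k) = 1"
| "expr_size K (Var x) = 1"
| "expr_size K (Arr a e) = expr_size K e + K + 2"
| "expr_size K (Plus e f) = expr_size K e + expr_size K f + 1"
| "expr_size K (Minus e f) = expr_size K e + expr_size K f + 1"
| "expr_size K (Cond e f g) = expr_size K e + expr_size K f + expr_size K g + 2"

text \<open>\<open>d\<close> is the height of the evaluation stack: the result ends in cell
  \<open>d\<close> of region 0, and cells below \<open>d\<close> are left alone. \<open>l\<close> is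
  the position of the code, needed because jump targets are absolute.\<close>

primrec expr_code :: "nat \<Rightarrow> nat \<Rightarrow> nat \<Rightarrow> ('v::countable, 'a::countable) expr \<Rightarrow> instr list" where
  "expr_code K d l (Lit k) = [LoadConst (K * d) k]"
| "expr_code K d l (Var x) = [Move (K * d) (K * to_nat x + 2)]"
| "expr_code K d l (Arr a e) =
     expr_code K d l e @ array_address K (Suc d) d a @ [Load (K * d) (K * Suc d)]"
| "expr_code K d l (Plus e f) =
     expr_code K d l e @ expr_code K (Suc d) (l + expr_size K e) f
     @ [Add (K * d) (K * d) (K * Suc d)]"
| "expr_code K d l (Minus e f) =
     expr_code K d l e @ expr_code K (Suc d) (l + expr_size K e) f
     @ [Sub (K * d) (K * d) (K * Suc d)]"
| "expr_code K d l (Cond e f g) =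
     (let m = l + expr_size K e + 1; n = m + expr_size K f + 1 in
      expr_code K d l e @ [JumpZero (K * d) n]
      @ expr_code K d m f @ [Jump (n + expr_size K g)] @ expr_code K d n g)"

primrec com_size :: "nat \<Rightarrow> ('v, 'a) com \<Rightarrow> nat" where
  "com_size K Skip = 0"
| "com_size K (Assign x e) = expr_size K e + 1"
| "com_size K (Put a i e) = expr_size K i + expr_size K e + K + 2"
| "com_size K (Scan x) = 1"
| "com_size K (Emit e) = expr_size K e + 1"
| "com_size K (c ;; d) = com_size K c + com_size K d"
| "com_size K (Loop e c) = expr_size K e + com_size K c + 5"

text \<open>Here \<open>d\<close> is the nesting depth of loops. Expressions start at stack height
  0, since no temporary survives a command. A loop copies its count into a counter of its own, which
  the body cannot reach; the constant 1 is loaded before each decrement because \<open>Sub\<close>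
  takes cells only.\<close>

primrec com_code :: "nat \<Rightarrow> nat \<Rightarrow> nat \<Rightarrow> ('v::countable, 'a::countable) com \<Rightarrow> instr list" where
  "com_code K d l Skip = []"
| "com_code K d l (Assign x e) = expr_code K 0 l e @ [Move (K * to_nat x + 2) (K * 0)]"
| "com_code K d l (Put a i e) =
     expr_code K 0 l i @ expr_code K 1 (l + expr_size K i) e
     @ array_address K 2 0 a @ [Store (K * 2) (K * 1)]"
| "com_code K d l (Scan x) = [Read (K * to_nat x + 2)]"
| "com_code K d l (Emit e) = expr_code K 0 l e @ [Print (K * 0)]"
| "com_code K d l (c1 ;; c2) = com_code K d l c1 @ com_code K d (l + com_size K c1) c2"
| "com_code K d l (Loop e c) =
     (let m = l + expr_size K e + 1 in
      expr_code K 0 l e @ [Move (K * d + 1) (K * 0)]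
      @ [JumpZero (K * d + 1) (m + 4 + com_size K c), LoadConst (K * 0) 1,
         Sub (K * d + 1) (K * d + 1) (K * 0)]
      @ com_code K (Suc d) (m + 3) c @ [Jump m])"

lemma length_array_address [simp]: "length (array_address K t d a) = K + 1"
  by (simp add: array_address_def)

lemma length_expr_code [simp]: "length (expr_code K d l e) = expr_size K e"
  by (induction e arbitrary: d l) (simp_all add: Let_def)

lemma length_com_code [simp]: "length (com_code K d l c) = com_size K c"
  by (induction c arbitrary: d l) (simp_all add: Let_def)


section \<open>Executing code placed inside a program\<close>

definition code_at :: "instr list \<Rightarrow> nat \<Rightarrow> instr list \<Rightarrow> bool" where
  "code_at prog l is \<longleftrightarrow> (\<exists>pre post. prog = pre @ is @ post \<and> length pre = l)"

lemma code_at_append [simp]: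
  "code_at prog l (is @ js) \<longleftrightarrow> code_at prog l is \<and> code_at prog (l + length is) js"
proof
  assume "code_at prog l (is @ js)"
  then obtain pre post where "prog = pre @ is @ js @ post" "length pre = l"
    by (auto simp: code_at_def)
  then show "code_at prog l is \<and> code_at prog (l + length is) js"
    unfolding code_at_def by (metis append.assoc length_append)
next
  assume "code_at prog l is \<and> code_at prog (l + length is) js"
  then obtain pre post pre' post' where *: "prog = pre @ is @ post" "length pre = l"
    "prog = pre' @ js @ post'" "length pre' = l + length is"
    unfolding code_at_def by metis
  then have "pre' = pre @ is"
    by (metis append.assoc append_eq_append_conv length_append)
  with * show "code_at prog l (is @ js)" by (auto simp: code_at_def)
qed

text \<open>The guard exempts singletons, which the rule would otherwise rewrite to themselves
  forever.\<close>

lemma code_at_Cons [simp]: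
  "NO_MATCH [] js \<Longrightarrow> code_at prog l (i # js) \<longleftrightarrow> code_at prog l [i] \<and> code_at prog (Suc l) js"
  using code_at_append[of prog l "[i]" js] by simp

lemma ram_step_code_at:
  "code_at prog (fst cf) [i] \<Longrightarrow> ram_step prog cf = exec i cf"
  by (auto simp: code_at_def ram_step_def nth_append)

text \<open>A bound instead of an exact number of steps lets the two branches of a conditional share
  one estimate.\<close>

definition reaches :: "instr list \<Rightarrow> nat \<Rightarrow> config \<Rightarrow> config \<Rightarrow> bool" where
  "reaches prog t cf cf' \<longleftrightarrow> (\<exists>t' \<le> t. (ram_step prog ^^ t') cf = cf')"

lemma reaches_refl: "reaches prog t cf cf"
  by (auto simp: reaches_def intro: exI[of _ 0])

lemma reaches_step:
  "code_at prog (fst cf) [i] \<Longrightarrow> reaches prog t (exec i cf) cf' \<Longrightarrow> reaches prog (Suc t) cf cf'"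
  unfolding reaches_def
  by (metis Suc_le_mono funpow_Suc_right comp_apply ram_step_code_at)

lemma reaches_single:
  assumes "code_at prog l [i]" "exec i (l, M, xs, ys) = cf"
  shows "reaches prog (Suc 0) (l, M, xs, ys) cf"
  using assms reaches_step[of prog "(l, M, xs, ys)" i 0 cf] by (simp add: reaches_refl)

lemma reaches_trans:
  assumes "reaches prog t cf cf'" "reaches prog u cf' cf''" "t + u \<le> n"
  shows "reaches prog n cf cf''"
proof -
  obtain t' u' where "t' \<le> t" "(ram_step prog ^^ t') cf = cf'"
    "u' \<le> u" "(ram_step prog ^^ u') cf' = cf''"
    using assms by (auto simp: reaches_def)
  then have "(ram_step prog ^^ (u' + t')) cf = cf''" "u' + t' \<le> n"
    using assms(3) by (auto simp: funpow_add)
  then show ?thesis by (auto simp: reaches_def)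
qed

text \<open>The type of array names is infinite while a program has finitely many regions, hence the
  guard on arrays; the scalar variables share a single region. Regions 0 and 1 are unconstrained, so
  temporaries and counters may change freely.\<close>

definition represents ::
    "nat \<Rightarrow> (nat \<Rightarrow> nat) \<Rightarrow> ('v::countable, 'a::countable) state \<Rightarrow> bool" where
  "represents K M s \<longleftrightarrow> (\<forall>x. M (K * to_nat x + 2) = vars s x)
     \<and> (\<forall>a i. 3 + to_nat a < K \<longrightarrow> M (K * i + (3 + to_nat a)) = arrs s a i)"

lemma address_inject:
  assumes "(k::nat) < K" "k' < K"
  shows "K * i + k = K * i' + k' \<longleftrightarrow> i = i' \<and> k = k'"
proof
  assume *: "K * i + k = K * i' + k'"
  have "(K * i + k) div K = i" "(K * i' + k') div K = i'" using assms by auto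
  with * show "i = i' \<and> k = k'" by auto
qed auto

lemma reaches_array_address:
  assumes "code_at prog l (array_address K t d a)" "d \<noteq> t" "0 < K"
  shows "reaches prog (K + 1) (l, M, xs, ys)
    (l + K + 1, M(K * t := K * M (K * d) + (3 + to_nat a)), xs, ys)"
proof -
  have ne: "K * d \<noteq> K * t" using assms by simp
  have adds: "reaches prog n (l', M', xs, ys)
      (l' + n, M'(K * t := M' (K * t) + n * M' (K * d)), xs, ys)"
    if "code_at prog l' (replicate n (Add (K * t) (K * t) (K * d)))" for n l' M'
    using that
  proof (induction n arbitrary: l' M')
    case 0
    then show ?case by (simp add: reaches_refl)
  next
    case (Suc n)
    then have c: "code_at prog l' [Add (K * t) (K * t) (K * d)]"
      "code_at prog (Suc l') (replicate n (Add (K * t) (K * t) (K * d)))"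
      using code_at_append[of prog l' "[Add (K * t) (K * t) (K * d)]"] by auto
    let ?M = "M'(K * t := M' (K * t) + M' (K * d))"
    have "?M(K * t := ?M (K * t) + n * ?M (K * d)) = M'(K * t := M' (K * t) + Suc n * M' (K * d))"
      using ne by (simp add: fun_eq_iff)
    with Suc.IH[OF c(2), of ?M]
    have "reaches prog n (Suc l', ?M, xs, ys)
      (l' + Suc n, M'(K * t := M' (K * t) + Suc n * M' (K * d)), xs, ys)"
      by (simp only: add_Suc add_Suc_right)
    with c(1) show ?case
      by (intro reaches_step[where i = "Add (K * t) (K * t) (K * d)"])
         (simp_all del: fun_upd_apply)
  qed
  have c: "code_at prog l [LoadConst (K * t) (3 + to_nat a)]"
    "code_at prog (Suc l) (replicate K (Add (K * t) (K * t) (K * d)))"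
    using assms(1) code_at_append[of prog l "[LoadConst (K * t) (3 + to_nat a)]"]
    by (auto simp: array_address_def)
  let ?M = "M(K * t := 3 + to_nat a)"
  have "?M(K * t := ?M (K * t) + K * ?M (K * d)) = M(K * t := K * M (K * d) + (3 + to_nat a))"
    using ne by (simp add: fun_eq_iff)
  with adds[OF c(2), of ?M]
  have "reaches prog K (Suc l, ?M, xs, ys)
      (l + K + 1, M(K * t := K * M (K * d) + (3 + to_nat a)), xs, ys)"
    by (simp only: add_Suc add_Suc_right Suc_eq_plus1 add.commute add.left_commute)
  with c(1) have "reaches prog (Suc K) (l, M, xs, ys)
      (l + K + 1, M(K * t := K * M (K * d) + (3 + to_nat a)), xs, ys)"
    by (intro reaches_step[where i = "LoadConst (K * t) (3 + to_nat a)"])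
       (simp_all del: fun_upd_apply)
  then show ?thesis by simp
qed

lemma represents_cong:
  assumes "represents K M s" "2 < K" "\<And>z. M' z \<noteq> M z \<Longrightarrow> z mod K < 2"
  shows "represents K M' s"
proof -
  have "M' (K * i + k) = M (K * i + k)" if "2 \<le> k" "k < K" for i k
    using assms(3)[of "K * i + k"] that by auto
  from this[of 2] this[of "3 + _"] show ?thesis
    using assms(1,2) by (auto simp: represents_def simp del: add_2_eq_Suc' add_2_eq_Suc)
qed

text \<open>The last conjunct carries the induction: the second operand is evaluated one level
  higher, so the value of the first one survives.\<close>

lemma expr_code_correct:
  assumes "code_at prog l (expr_code K d l e)" "represents K M s" "3 < K"
    "\<And>a. a \<in> set2_expr e \<Longrightarrow> 3 + to_nat a < K"
  shows "\<exists>M'. reaches prog (expr_size K e) (l, M, xs, ys) (l + expr_size K e, M', xs, ys)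
    \<and> M' (K * d) = val e s \<and> (\<forall>z. M' z \<noteq> M z \<longrightarrow> (\<exists>j \<ge> d. z = K * j))"
  using assms(1,2,4)
proof (induction e arbitrary: d l M)
  case (Lit k)
  then show ?case
    by (intro exI[of _ "M(K * d := k)"]) (auto simp: fun_eq_iff intro!: reaches_single)
next
  case (Var x)
  then show ?case
    by (intro exI[of _ "M(K * d := vars s x)"])
       (auto simp: fun_eq_iff represents_def intro!: reaches_single)
next
  case (Arr a e)
  from Arr.IH[of l d M] Arr.prems obtain M' where M':
    "reaches prog (expr_size K e) (l, M, xs, ys) (l + expr_size K e, M', xs, ys)"
    "M' (K * d) = val e s" "\<forall>z. M' z \<noteq> M z \<longrightarrow> (\<exists>j \<ge> d. z = K * j)"
    by auto
  have rep: "represents K M' s"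
    by (rule represents_cong[OF Arr.prems(2)]) (use M'(3) assms(3) in auto)
  let ?ad = "K * val e s + (3 + to_nat a)"
  let ?M1 = "M'(K * Suc d := ?ad)"
  have r1: "reaches prog (K + 1) (l + expr_size K e, M', xs, ys)
      (l + expr_size K e + K + 1, ?M1, xs, ys)"
    using reaches_array_address[of prog "l + expr_size K e" K "Suc d" d a M' xs ys]
      Arr.prems(1) assms(3) M'(2) by (simp add: array_address_def)
  have "to_nat a + 3 < K" using Arr.prems(3)[of a] by simp
  \<comment> \<open>Array cells have residue at least 3 modulo \<open>K\<close>, temporaries have
    residue 0; storing the address does not destroy the cell to be read.\<close>
  then have "?M1 ?ad = arrs s a (val e s)"
    using rep address_inject[of "3 + to_nat a" K 0 "val e s" "Suc d"]
    by (auto simp: represents_def add.commute)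
  then have r2: "reaches prog 1 (l + expr_size K e + K + 1, ?M1, xs, ys)
      (l + expr_size K (Arr a e), ?M1(K * d := arrs s a (val e s)), xs, ys)"
    using Arr.prems(1) unfolding One_nat_def
    by (intro reaches_single[where i = "Load (K * d) (K * Suc d)"])
       (auto simp: algebra_simps)
  show ?case
  proof (intro exI[of _ "?M1(K * d := arrs s a (val e s))"] conjI allI impI)
    show "reaches prog (expr_size K (Arr a e)) (l, M, xs, ys)
      (l + expr_size K (Arr a e), ?M1(K * d := arrs s a (val e s)), xs, ys)"
      using reaches_trans[OF M'(1) reaches_trans[OF r1 r2 order_refl]] by simp
    show "\<exists>j\<ge>d. z = K * j" if "(?M1(K * d := arrs s a (val e s))) z \<noteq> M z" for z
    proof (cases "M' z = M z")
      case True
      with that have "z = K * d \<or> z = K * Suc d" by (auto split: if_splits)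
      then show ?thesis using le_SucI[of d d] by blast
    qed (use M'(3) in blast)
  qed auto
next
  case (Plus e f)
  from Plus.IH(1)[of l d M] Plus.prems obtain M' where M':
    "reaches prog (expr_size K e) (l, M, xs, ys) (l + expr_size K e, M', xs, ys)"
    "M' (K * d) = val e s" "\<forall>z. M' z \<noteq> M z \<longrightarrow> (\<exists>j \<ge> d. z = K * j)"
    by auto
  have rep: "represents K M' s"
    by (rule represents_cong[OF Plus.prems(2)]) (use M'(3) assms(3) in auto)
  from Plus.IH(2)[of "l + expr_size K e" "Suc d" M'] Plus.prems rep obtain M'' where M'':
    "reaches prog (expr_size K f) (l + expr_size K e, M', xs, ys)
       (l + expr_size K e + expr_size K f, M'', xs, ys)"
    "M'' (K * Suc d) = val f s" "\<forall>z. M'' z \<noteq> M' z \<longrightarrow> (\<exists>j \<ge> Suc d. z = K * j)"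
    by auto
  have keep: "M'' (K * d) = val e s" using M''(3)[rule_format, of "K * d"] M'(2) assms(3) by force
  have r: "reaches prog 1 (l + expr_size K e + expr_size K f, M'', xs, ys)
      (l + expr_size K (Plus e f), M''(K * d := val (Plus e f) s), xs, ys)"
    using Plus.prems(1) keep M''(2) unfolding One_nat_def
    by (intro reaches_single[where i = "Add (K * d) (K * d) (K * Suc d)"])
       (auto simp: algebra_simps)
  show ?case
  proof (intro exI[of _ "M''(K * d := val (Plus e f) s)"] conjI allI impI)
    show "reaches prog (expr_size K (Plus e f)) (l, M, xs, ys)
      (l + expr_size K (Plus e f), M''(K * d := val (Plus e f) s), xs, ys)"
      using reaches_trans[OF M'(1) reaches_trans[OF M''(1) r order_refl]] by simp
    show "\<exists>j\<ge>d. z = K * j" if "(M''(K * d := val (Plus e f) s)) z \<noteq> M z" for z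
    proof (cases "z = K * d")
      case False
      with that have "M' z \<noteq> M z \<or> M'' z \<noteq> M' z" by auto
      then show ?thesis using M'(3) M''(3) Suc_leD by blast
    qed auto
  qed auto
next
  case (Minus e f)
  from Minus.IH(1)[of l d M] Minus.prems obtain M' where M':
    "reaches prog (expr_size K e) (l, M, xs, ys) (l + expr_size K e, M', xs, ys)"
    "M' (K * d) = val e s" "\<forall>z. M' z \<noteq> M z \<longrightarrow> (\<exists>j \<ge> d. z = K * j)"
    by auto
  have rep: "represents K M' s"
    by (rule represents_cong[OF Minus.prems(2)]) (use M'(3) assms(3) in auto)
  from Minus.IH(2)[of "l + expr_size K e" "Suc d" M'] Minus.prems rep obtain M'' where M'':
    "reaches prog (expr_size K f) (l + expr_size K e, M', xs, ys)
       (l + expr_size K e + expr_size K f, M'', xs, ys)"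
    "M'' (K * Suc d) = val f s" "\<forall>z. M'' z \<noteq> M' z \<longrightarrow> (\<exists>j \<ge> Suc d. z = K * j)"
    by auto
  have keep: "M'' (K * d) = val e s" using M''(3)[rule_format, of "K * d"] M'(2) assms(3) by force
  have r: "reaches prog 1 (l + expr_size K e + expr_size K f, M'', xs, ys)
      (l + expr_size K (Minus e f), M''(K * d := val (Minus e f) s), xs, ys)"
    using Minus.prems(1) keep M''(2) unfolding One_nat_def
    by (intro reaches_single[where i = "Sub (K * d) (K * d) (K * Suc d)"])
       (auto simp: algebra_simps)
  show ?case
  proof (intro exI[of _ "M''(K * d := val (Minus e f) s)"] conjI allI impI)
    show "reaches prog (expr_size K (Minus e f)) (l, M, xs, ys)
      (l + expr_size K (Minus e f), M''(K * d := val (Minus e f) s), xs, ys)"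
      using reaches_trans[OF M'(1) reaches_trans[OF M''(1) r order_refl]] by simp
    show "\<exists>j\<ge>d. z = K * j" if "(M''(K * d := val (Minus e f) s)) z \<noteq> M z" for z
    proof (cases "z = K * d")
      case False
      with that have "M' z \<noteq> M z \<or> M'' z \<noteq> M' z" by auto
      then show ?thesis using M'(3) M''(3) Suc_leD by blast
    qed auto
  qed auto
next
  case (Cond e f g)
  let ?m = "l + expr_size K e + 1" and ?n = "l + expr_size K e + 1 + expr_size K f + 1"
  have code: "code_at prog l (expr_code K d l e)"
    "code_at prog (l + expr_size K e) [JumpZero (K * d) ?n]"
    "code_at prog ?m (expr_code K d ?m f)"
    "code_at prog (?m + expr_size K f) [Jump (?n + expr_size K g)]"
    "code_at prog ?n (expr_code K d ?n g)"
    using Cond.prems(1) by (auto simp: Let_def algebra_simps)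
  from Cond.IH(1)[of l d M] code Cond.prems obtain M' where M':
    "reaches prog (expr_size K e) (l, M, xs, ys) (l + expr_size K e, M', xs, ys)"
    "M' (K * d) = val e s" "\<forall>z. M' z \<noteq> M z \<longrightarrow> (\<exists>j \<ge> d. z = K * j)"
    by auto
  have rep: "represents K M' s"
    by (rule represents_cong[OF Cond.prems(2)]) (use M'(3) assms(3) in auto)
  show ?case
  proof (cases "val e s = 0")
    case True
    from Cond.IH(3)[of ?n d M'] code Cond.prems rep obtain M'' where M'':
      "reaches prog (expr_size K g) (?n, M', xs, ys) (?n + expr_size K g, M'', xs, ys)"
      "M'' (K * d) = val g s" "\<forall>z. M'' z \<noteq> M' z \<longrightarrow> (\<exists>j \<ge> d. z = K * j)"
      by auto
    have r: "reaches prog 1 (l + expr_size K e, M', xs, ys) (?n, M', xs, ys)"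
      using code(2) M'(2) True unfolding One_nat_def
      by (intro reaches_single[where i = "JumpZero (K * d) ?n"]) auto
    show ?thesis
    proof (intro exI[of _ M''] conjI allI impI)
      show "reaches prog (expr_size K (Cond e f g)) (l, M, xs, ys)
        (l + expr_size K (Cond e f g), M'', xs, ys)"
        using reaches_trans[OF M'(1) reaches_trans[OF r M''(1) order_refl],
            of "expr_size K (Cond e f g)"] by (simp add: algebra_simps)
      show "\<exists>j\<ge>d. z = K * j" if "M'' z \<noteq> M z" for z
        using that M'(3) M''(3) by metis
    qed (use True M'' in auto)
  next
    case False
    from Cond.IH(2)[of ?m d M'] code Cond.prems rep obtain M'' where M'':
      "reaches prog (expr_size K f) (?m, M', xs, ys) (?m + expr_size K f, M'', xs, ys)"
      "M'' (K * d) = val f s" "\<forall>z. M'' z \<noteq> M' z \<longrightarrow> (\<exists>j \<ge> d. z = K * j)"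
      by auto
    have r: "reaches prog 1 (l + expr_size K e, M', xs, ys) (?m, M', xs, ys)"
      using code(2) M'(2) False unfolding One_nat_def
      by (intro reaches_single[where i = "JumpZero (K * d) ?n"]) auto
    have r': "reaches prog 1 (?m + expr_size K f, M'', xs, ys) (?n + expr_size K g, M'', xs, ys)"
      using code(4) unfolding One_nat_def
      by (intro reaches_single[where i = "Jump (?n + expr_size K g)"]) auto
    show ?thesis
    proof (intro exI[of _ M''] conjI allI impI)
      show "reaches prog (expr_size K (Cond e f g)) (l, M, xs, ys)
        (l + expr_size K (Cond e f g), M'', xs, ys)"
        using reaches_trans[OF M'(1) reaches_trans[OF r reaches_trans[OF M''(1) r' order_refl]
              order_refl], of "expr_size K (Cond e f g)"] by (simp add: algebra_simps)
      show "\<exists>j\<ge>d. z = K * j" if "M'' z \<noteq> M z" for z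
        using that M'(3) M''(3) by metis
    qed (use False M'' in auto)
  qed
qed


section \<open>Running time and correctness of compiled commands\<close>

primrec com_time :: "nat \<Rightarrow> nat \<Rightarrow> ('v, 'a) com \<Rightarrow> nat" where
  "com_time K B Skip = 0"
| "com_time K B (Assign x e) = expr_size K e + 1"
| "com_time K B (Put a i e) = expr_size K i + expr_size K e + K + 2"
| "com_time K B (Scan x) = 1"
| "com_time K B (Emit e) = expr_size K e + 1"
| "com_time K B (c ;; d) = com_time K B c + com_time K B d"
| "com_time K B (Loop e c) = expr_size K e + 2 + B * (com_time K B c + 4)"

text \<open>Each loop multiplies by the monomial \<open>[:0, 1:]\<close>, so the degree is at most
  the nesting depth of the program.\<close>

lemma com_time_poly: "\<exists>p :: nat poly. \<forall>B. poly p B = com_time K B c"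
proof (induction c)
  case (Seq c d)
  then obtain p q :: "nat poly" where "\<forall>B. poly p B = com_time K B c" "\<forall>B. poly q B = com_time K B d"
    by auto
  then show ?case by (intro exI[of _ "p + q"]) simp
next
  case (Loop e c)
  then obtain p :: "nat poly" where "\<forall>B. poly p B = com_time K B c" by auto
  then show ?case
    by (intro exI[of _ "[:expr_size K e + 2:] + [:0, 1:] * (p + [:4:])"]) (simp add: algebra_simps)
next
  case Skip
  then show ?case by (intro exI[of _ 0]) simp
next
  case (Assign x e)
  then show ?case by (intro exI[of _ "[:expr_size K e + 1:]"]) simp
next
  case (Put a i e)
  then show ?case by (intro exI[of _ "[:expr_size K i + expr_size K e + K + 2:]"]) simp
next
  case (Scan x)
  then show ?case by (intro exI[of _ 1]) simp
next
  case (Emit e)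
  then show ?case by (intro exI[of _ "[:expr_size K e + 1:]"]) simp
qed

lemma represents_assign:
  fixes s :: "('v::countable, 'a::countable) state"
  assumes "represents K M s" "2 < K"
  shows "represents K (M(K * to_nat x + 2 := v)) (s\<lparr>vars := (vars s)(x := v)\<rparr>)"
proof -
  have "K * to_nat y + 2 = K * to_nat x + 2 \<longleftrightarrow> y = x" for y
    using address_inject[of 2 K 2 "to_nat y" "to_nat x"] assms(2) by simp
  moreover have "K * i + (3 + to_nat a) \<noteq> K * to_nat x + 2" if "3 + to_nat a < K" for i and a :: 'a
    using address_inject[of "3 + to_nat a" K 2 i "to_nat x"] that by simp
  ultimately show ?thesis using assms(1)
    by (simp add: represents_def del: add_2_eq_Suc' add_2_eq_Suc)
qed

lemma represents_put:
  fixes s :: "('v::countable, 'a::countable) state"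
  assumes "represents K M s" "3 + to_nat a < K"
  shows "represents K (M(K * i + (3 + to_nat a) := v))
    (s\<lparr>arrs := (arrs s)(a := (arrs s a)(i := v))\<rparr>)"
proof -
  have "K * to_nat x + 2 \<noteq> K * i + (3 + to_nat a)" for x :: 'v
    using address_inject[of 2 K "3 + to_nat a" "to_nat x" i] assms(2) by simp
  moreover have "K * j + (3 + to_nat b) = K * i + (3 + to_nat a) \<longleftrightarrow> j = i \<and> b = a"
    if "3 + to_nat b < K" for j and b :: 'a
    using address_inject[of "3 + to_nat b" K "3 + to_nat a" j i] that assms(2) by simp
  ultimately show ?thesis using assms(1)
    by (simp add: represents_def del: add_2_eq_Suc' add_2_eq_Suc)
qed

lemma represents_io [simp]:
  "represents K M (s\<lparr>inp := xs\<rparr>) = represents K M s"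
  "represents K M (s\<lparr>outp := xs\<rparr>) = represents K M s"
  by (simp_all add: represents_def)

text \<open>Preserving the counters below depth \<open>d\<close> is what lets a loop continue after
  its body: the body is compiled at depth \<open>d + 1\<close>, so it keeps the counter of the loop
  itself and of all loops around it.\<close>

lemma com_code_correct:
  fixes s :: "('v::countable, 'a::countable) state"
  assumes "code_at prog l (com_code K d l c)" "represents K M s" "3 < K"
    "\<And>a. a \<in> set2_com c \<Longrightarrow> 3 + to_nat a < K" "safe B c s"
  shows "\<exists>M'. reaches prog (com_time K B c) (l, M, inp s, outp s)
      (l + com_size K c, M', inp (run c s), outp (run c s))
    \<and> represents K M' (run c s) \<and> (\<forall>j < d. M' (K * j + 1) = M (K * j + 1))"
  using assms(1,2,4,5)
proof (induction c arbitrary: d l M s)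
  case Skip
  then show ?case by (auto intro: reaches_refl)
next
  case (Assign x e)
  obtain M' where M':
    "reaches prog (expr_size K e) (l, M, inp s, outp s) (l + expr_size K e, M', inp s, outp s)"
    "M' (K * 0) = val e s" "\<forall>z. M' z \<noteq> M z \<longrightarrow> (\<exists>j \<ge> 0. z = K * j)"
    using expr_code_correct[of prog l K 0 e M s "inp s" "outp s"] Assign.prems assms(3) by auto
  have rep: "represents K M' s"
    by (rule represents_cong[OF Assign.prems(2)]) (use M'(3) assms(3) in auto)
  let ?M = "M'(K * to_nat x + 2 := val e s)"
  have r: "reaches prog 1 (l + expr_size K e, M', inp s, outp s)
      (l + com_size K (Assign x e), ?M, inp s, outp s)"
    using Assign.prems(1) M'(2) unfolding One_nat_def
    by (intro reaches_single[where i = "Move (K * to_nat x + 2) (K * 0)"]) auto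
  have "M' (K * j + 1) = M (K * j + 1)" for j
    using M'(3) address_inject[of 1 K 0 j] assms(3) by fastforce
  moreover have "K * j + 1 \<noteq> K * to_nat x + 2" for j
    using address_inject[of 1 K 2 j "to_nat x"] assms(3) by simp
  ultimately have "\<forall>j < d. ?M (K * j + 1) = M (K * j + 1)" by (metis fun_upd_other)
  then show ?case
    using reaches_trans[OF M'(1) r, of "com_time K B (Assign x e)"]
      represents_assign[OF rep, of x "val e s"] assms(3)
    by (intro exI[of _ ?M] conjI) (simp_all del: fun_upd_apply)
next
  case (Put a i e)
  obtain M1 where M1:
    "reaches prog (expr_size K i) (l, M, inp s, outp s) (l + expr_size K i, M1, inp s, outp s)"
    "M1 (K * 0) = val i s" "\<forall>z. M1 z \<noteq> M z \<longrightarrow> (\<exists>j \<ge> 0. z = K * j)"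
    using expr_code_correct[of prog l K 0 i M s "inp s" "outp s"] Put.prems assms(3) by auto
  have rep1: "represents K M1 s"
    by (rule represents_cong[OF Put.prems(2)]) (use M1(3) assms(3) in auto)
  obtain M2 where M2:
    "reaches prog (expr_size K e) (l + expr_size K i, M1, inp s, outp s)
       (l + expr_size K i + expr_size K e, M2, inp s, outp s)"
    "M2 (K * 1) = val e s" "\<forall>z. M2 z \<noteq> M1 z \<longrightarrow> (\<exists>j \<ge> 1. z = K * j)"
    using expr_code_correct[of prog "l + expr_size K i" K 1 e M1 s "inp s" "outp s"]
      Put.prems rep1 assms(3) by auto
  have rep2: "represents K M2 s"
    by (rule represents_cong[OF rep1]) (use M2(3) assms(3) in auto)
  have M20: "M2 (K * 0) = val i s"
    using M2(3)[rule_format, of "K * 0"] M1(2) assms(3) by force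
  let ?ad = "K * val i s + (3 + to_nat a)"
  let ?M3 = "M2(K * 2 := ?ad)" and ?M4 = "M2(K * 2 := ?ad, ?ad := val e s)"
  have r3: "reaches prog (K + 1) (l + expr_size K i + expr_size K e, M2, inp s, outp s)
     (l + expr_size K i + expr_size K e + K + 1, ?M3, inp s, outp s)"
    using reaches_array_address[of prog "l + expr_size K i + expr_size K e" K 2 0 a M2 "inp s" "outp s"]
      Put.prems(1) assms(3) M20 by (simp add: array_address_def)
  have r4: "reaches prog 1 (l + expr_size K i + expr_size K e + K + 1, ?M3, inp s, outp s)
     (l + com_size K (Put a i e), ?M4, inp s, outp s)"
    using Put.prems(1) M2(2) assms(3) unfolding One_nat_def
    by (intro reaches_single[where i = "Store (K * 2) (K * 1)"]) (auto simp: algebra_simps)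
  have rep3: "represents K ?M3 s"
    by (rule represents_cong[OF rep2]) (use assms(3) in \<open>auto split: if_splits\<close>)
  have a: "3 + to_nat a < K" using Put.prems(3) by simp
  have "?M4 (K * j + 1) = M (K * j + 1)" for j
  proof -
    have "M1 (K * j + 1) = M (K * j + 1)"
      using M1(3) address_inject[of 1 K 0 j] assms(3) by fastforce
    moreover have "M2 (K * j + 1) = M1 (K * j + 1)"
      using M2(3) address_inject[of 1 K 0 j] assms(3) by fastforce
    moreover have "K * j + 1 \<noteq> K * 2" "K * j + 1 \<noteq> ?ad"
      using address_inject[of 1 K 0 j 2] address_inject[of 1 K "3 + to_nat a" j "val i s"] a by auto
    ultimately show ?thesis by simp
  qed
  then show ?case
    using reaches_trans[OF M1(1) reaches_trans[OF M2(1) reaches_trans[OF r3 r4 order_refl] order_refl],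
        of "com_time K B (Put a i e)"] represents_put[OF rep3 a, of "val i s" "val e s"]
    by (intro exI[of _ ?M4] conjI) (simp_all del: fun_upd_apply)
next
  case (Scan x)
  let ?v = "case inp s of [] \<Rightarrow> 0 | y # _ \<Rightarrow> y"
  let ?M = "M(K * to_nat x + 2 := ?v)"
  have "K * j + 1 \<noteq> K * to_nat x + 2" for j
    using address_inject[of 1 K 2 j "to_nat x"] assms(3) by simp
  then have "\<forall>j < d. ?M (K * j + 1) = M (K * j + 1)" by (metis fun_upd_other)
  moreover have "reaches prog 1 (l, M, inp s, outp s) (l + 1, ?M, tl (inp s), outp s)"
    using Scan.prems(1) unfolding One_nat_def
    by (intro reaches_single[where i = "Read (K * to_nat x + 2)"]) auto
  ultimately show ?case
    using represents_assign[OF Scan.prems(2), of x ?v] assms(3)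
    by (intro exI[of _ ?M] conjI) (simp_all add: represents_def del: fun_upd_apply)
next
  case (Emit e)
  obtain M' where M':
    "reaches prog (expr_size K e) (l, M, inp s, outp s) (l + expr_size K e, M', inp s, outp s)"
    "M' (K * 0) = val e s" "\<forall>z. M' z \<noteq> M z \<longrightarrow> (\<exists>j \<ge> 0. z = K * j)"
    using expr_code_correct[of prog l K 0 e M s "inp s" "outp s"] Emit.prems assms(3) by auto
  have rep: "represents K M' s"
    by (rule represents_cong[OF Emit.prems(2)]) (use M'(3) assms(3) in auto)
  have r: "reaches prog 1 (l + expr_size K e, M', inp s, outp s)
      (l + com_size K (Emit e), M', inp s, outp s @ [val e s])"
    using Emit.prems(1) M'(2) unfolding One_nat_def
    by (intro reaches_single[where i = "Print (K * 0)"]) auto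
  have "M' (K * j + 1) = M (K * j + 1)" for j
    using M'(3) address_inject[of 1 K 0 j] assms(3) by fastforce
  then show ?case
    using reaches_trans[OF M'(1) r, of "com_time K B (Emit e)"] rep
    by (intro exI[of _ M'] conjI) simp_all
next
  case (Seq c1 c2)
  from Seq.IH(1)[of l d M s] Seq.prems obtain M1 where M1:
    "reaches prog (com_time K B c1) (l, M, inp s, outp s)
      (l + com_size K c1, M1, inp (run c1 s), outp (run c1 s))"
    "represents K M1 (run c1 s)" "\<forall>j < d. M1 (K * j + 1) = M (K * j + 1)"
    by auto
  from Seq.IH(2)[of "l + com_size K c1" d M1 "run c1 s"] Seq.prems M1(2) obtain M2 where M2:
    "reaches prog (com_time K B c2) (l + com_size K c1, M1, inp (run c1 s), outp (run c1 s))
      (l + com_size K c1 + com_size K c2, M2, inp (run c2 (run c1 s)), outp (run c2 (run c1 s)))"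
    "represents K M2 (run c2 (run c1 s))" "\<forall>j < d. M2 (K * j + 1) = M1 (K * j + 1)"
    by auto
  show ?case
    using reaches_trans[OF M1(1) M2(1) order_refl] M1(3) M2(2,3)
    by (intro exI[of _ M2] conjI) (simp_all add: algebra_simps)
next
  case (Loop e c)
  let ?m = "l + expr_size K e + 1" and ?ctr = "K * d + 1"
  let ?end = "?m + 4 + com_size K c"
  have code: "code_at prog l (expr_code K 0 l e)"
    "code_at prog (l + expr_size K e) [Move ?ctr (K * 0)]"
    "code_at prog ?m [JumpZero ?ctr ?end]"
    "code_at prog (?m + 1) [LoadConst (K * 0) 1]"
    "code_at prog (?m + 2) [Sub ?ctr ?ctr (K * 0)]"
    "code_at prog (?m + 3) (com_code K (Suc d) (?m + 3) c)"
    "code_at prog (?m + 3 + com_size K c) [Jump ?m]"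
    using Loop.prems(1) by (simp_all add: Let_def eval_nat_numeral algebra_simps)
  have ctr: "?ctr \<noteq> K * 0" using assms(3) by simp
  \<comment> \<open>The claim starts at the test of the counter, not at the evaluation of
    \<open>e\<close>, so that after one pass the remaining iterations are an instance of the same
    claim. Four instructions per pass are the test, the load, the decrement and the jump; the final
    1 is the failing test.\<close>
  have iter: "\<exists>M'. reaches prog (n * (com_time K B c + 4) + 1) (?m, M, inp s, outp s)
      (?end, M', inp ((run c ^^ n) s), outp ((run c ^^ n) s))
    \<and> represents K M' ((run c ^^ n) s) \<and> (\<forall>j < d. M' (K * j + 1) = M (K * j + 1))"
    if "M ?ctr = n" "represents K M s" "\<forall>k < n. safe B c ((run c ^^ k) s)" for n M s
    using that
  proof (induction n arbitrary: M s)
    case 0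
    have "reaches prog (Suc 0) (?m, M, inp s, outp s) (?end, M, inp s, outp s)"
      using code(3) 0 by (intro reaches_single[where i = "JumpZero ?ctr ?end"]) auto
    with 0 show ?case by auto
  next
    case (Suc n)
    let ?M1 = "M(K * 0 := 1, ?ctr := n)"
    have r1: "reaches prog (Suc 0) (?m, M, inp s, outp s) (?m + 1, M, inp s, outp s)"
      using code(3) Suc.prems(1) by (intro reaches_single[where i = "JumpZero ?ctr ?end"]) auto
    have r2: "reaches prog (Suc 0) (?m + 1, M, inp s, outp s)
      (?m + 2, M(K * 0 := 1), inp s, outp s)"
      using code(4) by (intro reaches_single[where i = "LoadConst (K * 0) 1"]) auto
    have r3: "reaches prog (Suc 0) (?m + 2, M(K * 0 := 1), inp s, outp s)
      (?m + 3, ?M1, inp s, outp s)"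
      using code(5) Suc.prems(1) ctr
      by (intro reaches_single[where i = "Sub ?ctr ?ctr (K * 0)"]) (auto simp: fun_eq_iff)
    have rep1: "represents K ?M1 s"
      by (rule represents_cong[OF Suc.prems(2)])
         (use assms(3) in \<open>auto simp: Suc_times_mod_eq split: if_splits\<close>)
    have safe: "safe B c s" using Suc.prems(3)[rule_format, of 0] by simp
    obtain M2 where M2:
      "reaches prog (com_time K B c) (?m + 3, ?M1, inp s, outp s)
        (?m + 3 + com_size K c, M2, inp (run c s), outp (run c s))"
      "represents K M2 (run c s)" "\<forall>j < Suc d. M2 (K * j + 1) = ?M1 (K * j + 1)"
      using Loop.IH[OF code(6) rep1 _ safe] Loop.prems(3) by (meson com.set_intros)
    have r5: "reaches prog (Suc 0) (?m + 3 + com_size K c, M2, inp (run c s), outp (run c s))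
      (?m, M2, inp (run c s), outp (run c s))"
      using code(7) by (intro reaches_single[where i = "Jump ?m"]) auto
    have "\<forall>k < n. safe B c ((run c ^^ k) (run c s))"
      using Suc.prems(3) by (auto simp: funpow_swap1 simp flip: funpow.simps(2)[unfolded comp_def])
    moreover have "M2 ?ctr = n" using M2(3) by simp
    ultimately obtain M3 where M3:
      "reaches prog (n * (com_time K B c + 4) + 1) (?m, M2, inp (run c s), outp (run c s))
        (?end, M3, inp ((run c ^^ n) (run c s)), outp ((run c ^^ n) (run c s)))"
      "represents K M3 ((run c ^^ n) (run c s))" "\<forall>j < d. M3 (K * j + 1) = M2 (K * j + 1)"
      using Suc.IH[of M2 "run c s"] M2(2) by blast
    have "M2 (K * j + 1) = M (K * j + 1)" if "j < d" for j
    proof -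
      have "K * j + 1 \<noteq> K * 0" "K * j + 1 \<noteq> ?ctr" using that assms(3) by simp_all
      then show ?thesis using M2(3) that by simp
    qed
    then have "\<forall>j < d. M3 (K * j + 1) = M (K * j + 1)" using M3(3) by simp
    moreover have "reaches prog (Suc n * (com_time K B c + 4) + 1) (?m, M, inp s, outp s)
        (?end, M3, inp ((run c ^^ n) (run c s)), outp ((run c ^^ n) (run c s)))"
      by (rule reaches_trans[OF r1 reaches_trans[OF r2 reaches_trans[OF r3 reaches_trans[OF M2(1)
              reaches_trans[OF r5 M3(1) order_refl] order_refl] order_refl] order_refl]]) simp
    ultimately show ?case using M3(2) by (auto simp: funpow_swap1)
  qed
  obtain M1 where M1:
    "reaches prog (expr_size K e) (l, M, inp s, outp s) (l + expr_size K e, M1, inp s, outp s)"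
    "M1 (K * 0) = val e s" "\<forall>z. M1 z \<noteq> M z \<longrightarrow> (\<exists>j \<ge> 0. z = K * j)"
    using expr_code_correct[of prog l K 0 e M s "inp s" "outp s"] code(1) Loop.prems assms(3) by auto
  have rep: "represents K M1 s"
    by (rule represents_cong[OF Loop.prems(2)]) (use M1(3) assms(3) in auto)
  let ?M2 = "M1(?ctr := val e s)"
  have r: "reaches prog (Suc 0) (l + expr_size K e, M1, inp s, outp s) (?m, ?M2, inp s, outp s)"
    using code(2) M1(2) by (intro reaches_single[where i = "Move ?ctr (K * 0)"]) auto
  have rep2: "represents K ?M2 s"
    by (rule represents_cong[OF rep])
       (use assms(3) in \<open>auto simp: Suc_times_mod_eq split: if_splits\<close>)
  have M2: "?M2 (K * j + 1) = M (K * j + 1)" if "j < d" for j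
  proof -
    have "M1 (K * j + 1) = M (K * j + 1)"
      using M1(3) address_inject[of 1 K 0 j] assms(3) by fastforce
    moreover have "K * j + 1 \<noteq> ?ctr" using that assms(3) by simp
    ultimately show ?thesis by simp
  qed
  obtain M3 where M3:
    "reaches prog (val e s * (com_time K B c + 4) + 1) (?m, ?M2, inp s, outp s)
      (?end, M3, inp (run (Loop e c) s), outp (run (Loop e c) s))"
    "represents K M3 (run (Loop e c) s)" "\<forall>j < d. M3 (K * j + 1) = ?M2 (K * j + 1)"
    using iter[of ?M2 "val e s" s] rep2 Loop.prems(4) by auto
  have "val e s * (com_time K B c + 4) \<le> B * (com_time K B c + 4)"
    using Loop.prems(4) by (intro mult_right_mono) auto
  then have "expr_size K e + (Suc 0 + (val e s * (com_time K B c + 4) + 1)) \<le> com_time K B (Loop e c)"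
    by simp
  then have "reaches prog (com_time K B (Loop e c)) (l, M, inp s, outp s)
      (?end, M3, inp (run (Loop e c) s), outp (run (Loop e c) s))"
    by (rule reaches_trans[OF M1(1) reaches_trans[OF r M3(1) order_refl]])
  moreover have "?end = l + com_size K (Loop e c)" by simp
  ultimately show ?case using M3(2,3) M2 by (intro exI[of _ M3] conjI) (simp_all add: add_ac)
qed

lemma finite_set2_expr: "finite (set2_expr e)"
  by (induction e) auto

lemma finite_set2_com: "finite (set2_com c)"
  by (induction c) (auto simp: finite_set2_expr)

definition start :: "nat list \<Rightarrow> ('v, 'a) state" where
  "start xs = \<lparr>vars = \<lambda>_. 0, arrs = \<lambda>_ _. 0, inp = xs, outp = []\<rparr>"

text \<open>The number \<open>K\<close> of regions depends on the program alone, so one machine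
  program serves all inputs. Its time is a polynomial in the loop bound, which is itself a
  polynomial in the input size; their composition is the required bound.\<close>

theorem poly_time_solvable_com:
  fixes c :: "('v::countable, 'a::countable) com" and b :: "nat poly"
  assumes "\<And>I xs. inst I xs \<Longrightarrow>
    safe (poly b (bit_size xs)) c (start xs) \<and> sol I (outp (run c (start xs)))"
  shows "poly_time_solvable inst sol"
proof -
  obtain K where K: "\<forall>a \<in> set2_com c. 3 + to_nat a < K" "3 < K"
  proof -
    have "finite ((\<lambda>a. 3 + to_nat a) ` set2_com c)" by (simp add: finite_set2_com)
    then obtain m where "\<forall>n \<in> (\<lambda>a. 3 + to_nat a) ` set2_com c. n < m"
      by (auto simp: finite_nat_set_iff_bounded)
    then show thesis by (intro that[of "max m 4"]) auto
  qed
  obtain p :: "nat poly" where p: "\<And>B. poly p B = com_time K B c"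
    using com_time_poly by blast
  let ?prog = "com_code K 0 0 c"
  have "\<exists>ys. ram_outputs_within ?prog xs (poly (pcompose p b) (bit_size xs)) ys \<and> sol I ys"
    if I: "inst I xs" for I xs
  proof -
    have "code_at ?prog 0 ?prog" by (auto simp: code_at_def)
    moreover have "represents K (\<lambda>_. 0) (start xs :: ('v, 'a) state)"
      by (simp add: represents_def start_def)
    ultimately obtain M where
      "reaches ?prog (com_time K (poly b (bit_size xs)) c) (0, \<lambda>_. 0, xs, [])
        (com_size K c, M, inp (run c (start xs)), outp (run c (start xs)))"
      using com_code_correct[of ?prog 0 K 0 c "\<lambda>_. 0" "start xs" "poly b (bit_size xs)"]
        K assms[OF I] by (auto simp: start_def)
    then have "ram_outputs_within ?prog xs (poly (pcompose p b) (bit_size xs))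
        (outp (run c (start xs)))"
      by (auto simp: ram_outputs_within_def reaches_def p poly_pcompose)
    with assms[OF I] show ?thesis by blast
  qed
  then show ?thesis unfolding poly_time_solvable_def by blast
qed


section \<open>Rooted trees\<close>

lemma pair_graph_symD: "pair_graph G \<Longrightarrow> (a, b) \<in> parcs G \<Longrightarrow> (b, a) \<in> parcs G"
  using pair_sym_digraph.pair_sym_arcs[of G]
  by (auto simp: pair_graph_def pair_pseudo_graph_def symmetric_def sym_def)

lemma pair_graph_vertsD:
  "pair_graph G \<Longrightarrow> (a, b) \<in> parcs G \<Longrightarrow> a \<in> pverts G \<and> b \<in> pverts G \<and> a \<noteq> b"
  using pair_wf_digraph.in_arcsD1[of G a b] pair_wf_digraph.in_arcsD2[of G a b]
    pair_loopfree_digraph.pair_no_loops[of G "(a, b)"]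
  by (auto simp: pair_graph_def pair_digraph_def pair_fin_digraph_def)

lemma pair_graph_finite: "pair_graph G \<Longrightarrow> finite (pverts G) \<and> finite (parcs G)"
  using pair_fin_digraph.pair_finite_verts[of G] pair_fin_digraph.pair_finite_arcs[of G]
  by (auto simp: pair_graph_def pair_digraph_def)

text \<open>Symmetrising a symmetric graph adds no arcs, so a walk that starts in \<open>X\<close>
  stays in \<open>X\<close>. Applied to penalties, this form of connectivity becomes the assumption
  \<open>P_conn\<close> of the dynamic program.\<close>

lemma connected_closed:
  assumes G: "pair_graph G" and conn: "Digraph_Component.connected (with_proj G)"
    and X: "pverts G \<inter> X \<noteq> {}"
    and closed: "\<And>a b. (a, b) \<in> parcs G \<Longrightarrow> a \<in> X \<Longrightarrow> b \<in> X"
  shows "pverts G \<subseteq> X"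
proof
  fix y assume y: "y \<in> pverts G"
  obtain x where x: "x \<in> pverts G" "x \<in> X" using X by blast
  then have "(x, y) \<in> rtrancl_on (pverts G) (parcs (mk_symmetric (with_proj G)))"
    using conn y
    by (auto simp: Digraph_Component.connected_def strongly_connected_def reachable_def)
  then show "y \<in> X"
  proof (induction rule: rtrancl_on_induct)
    case (step y z)
    then have "(y, z) \<in> parcs G"
      using pair_graph_symD[OF G] by (auto simp: parcs_mk_symmetric)
    then show ?case using closed step by blast
  qed (use x in simp)
qed

text \<open>Supplies the number of passes of the search for an order: a shortest walk uses no more
  steps than there are arcs.\<close>

lemma connected_relpow:
  assumes G: "pair_graph G" and conn: "Digraph_Component.connected (with_proj G)"
    and x: "x \<in> pverts G" and y: "y \<in> pverts G" and N: "card (parcs G) \<le> N"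
  shows "\<exists>k \<le> N. (x, y) \<in> parcs G ^^ k"
proof -
  have "pverts G \<subseteq> {z. (x, z) \<in> (parcs G)\<^sup>*}"
    by (rule connected_closed[OF G conn]) (use x in auto)
  then have "(x, y) \<in> (parcs G)\<^sup>*" using y by auto
  then show ?thesis
    using rtrancl_finite_eq_relpow[of "parcs G"] pair_graph_finite[OF G] N
    by (auto intro: order_trans)
qed

text \<open>Cycles are lists of arcs, paths are built here as lists of vertices; zipping a vertex
  list with its tail converts the one into the other.\<close>

lemma walk_of_vertices:
  assumes "successively (\<lambda>a b. (a, b) \<in> parcs G) (x # xs)" "set (x # xs) \<subseteq> pverts G"
  shows "pre_digraph.awalk (with_proj G) x (zip (x # xs) xs) (last (x # xs))
    \<and> pre_digraph.awalk_verts (with_proj G) x (zip (x # xs) xs) = x # xs"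
  using assms
proof (induction xs arbitrary: x)
  case Nil
  then show ?case
    by (simp add: pre_digraph.awalk_def cas_with_proj_eq awalk_verts_with_proj_eq)
next
  case (Cons y ys)
  then show ?case
    by (auto simp: pre_digraph.awalk_def cas_with_proj_eq awalk_verts_with_proj_eq)
qed

definition path_in :: "'v pair_pre_digraph \<Rightarrow> 'v set \<Rightarrow> 'v \<Rightarrow> 'v \<Rightarrow> 'v list \<Rightarrow> bool" where
  "path_in G X x y xs \<longleftrightarrow> xs \<noteq> [] \<and> hd xs = x \<and> last xs = y \<and> distinct xs \<and> set xs \<subseteq> X
    \<and> successively (\<lambda>a b. (a, b) \<in> parcs G) xs"

text \<open>The last vertex of an initial segment hangs on an earlier one, so it can be put at an
  end of a path that stops at its parent. Staying within the segment makes the path avoid all later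
  vertices.\<close>

lemma path_in_growing:
  fixes ord par :: "nat \<Rightarrow> 'v"
  assumes G: "pair_graph G" and inj: "inj_on ord {..<n}"
    and par: "\<And>i. 0 < i \<Longrightarrow> i < n \<Longrightarrow> (par i, ord i) \<in> parcs G \<and> par i \<in> ord ` {..<i}"
    and k: "k \<le> n" and x: "x \<in> ord ` {..<k}" and y: "y \<in> ord ` {..<k}"
  shows "\<exists>xs. path_in G (ord ` {..<k}) x y xs"
  using k x y
proof (induction k arbitrary: x y)
  case 0
  then show ?case by simp
next
  case (Suc k)
  let ?w = "ord k"
  have w: "?w \<notin> ord ` {..<k}" using inj Suc.prems(1) by (fastforce simp: inj_on_def)
  have l: "ord ` {..<Suc k} = insert ?w (ord ` {..<k})" by (auto simp: lessThan_Suc)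
  have IH: "\<exists>xs. path_in G (ord ` {..<k}) x y xs" if "x \<in> ord ` {..<k}" "y \<in> ord ` {..<k}" for x y
    using Suc.IH that Suc.prems(1) by simp
  have pk: "(par k, ?w) \<in> parcs G \<and> par k \<in> ord ` {..<k}" if "ord ` {..<k} \<noteq> {}"
    using par[of k] Suc.prems(1) that by (cases k) auto
  consider "x \<in> ord ` {..<k}" "y \<in> ord ` {..<k}" | "x = ?w" "y = ?w"
    | "x \<in> ord ` {..<k}" "y = ?w" | "x = ?w" "y \<in> ord ` {..<k}"
    using Suc.prems l by blast
  then show ?case
  proof cases
    case 1
    then show ?thesis using IH[OF 1] unfolding l path_in_def by blast
  next
    case 2
    then show ?thesis unfolding l by (intro exI[of _ "[?w]"]) (simp add: path_in_def)
  next
    case 3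
    then have p: "(par k, ?w) \<in> parcs G" "par k \<in> ord ` {..<k}" using pk by auto
    obtain xs where "path_in G (ord ` {..<k}) x (par k) xs" using IH[OF 3(1) p(2)] by blast
    then have "path_in G (ord ` {..<Suc k}) x y (xs @ [?w])"
      using p w 3 unfolding l by (auto simp: path_in_def successively_append_iff)
    then show ?thesis by blast
  next
    case 4
    then have p: "(?w, par k) \<in> parcs G" "par k \<in> ord ` {..<k}" using pk pair_graph_symD[OF G] by auto
    obtain xs where "path_in G (ord ` {..<k}) (par k) y xs" using IH[OF p(2) 4(2)] by blast
    then have "path_in G (ord ` {..<Suc k}) x y (?w # xs)"
      using p w 4 unfolding l by (auto simp: path_in_def successively_Cons)
    then show ?thesis by blast
  qed
qed

text \<open>
  An arc joining \<open>ord j\<close> to an earlier vertex other than its parent would close a cycle with a path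
  through the vertices before \<open>ord j\<close>.
\<close>

lemma tree_arc_parental:
  fixes ord par :: "nat \<Rightarrow> 'v"
  assumes tree: "undirected_tree G" and inj: "inj_on ord {..<n}" and V: "ord ` {..<n} = pverts G"
    and par: "\<And>i. 0 < i \<Longrightarrow> i < n \<Longrightarrow> (par i, ord i) \<in> parcs G \<and> par i \<in> ord ` {..<i}"
    and arc: "(a, b) \<in> parcs G"
  shows "\<exists>i. 0 < i \<and> i < n \<and> (b = ord i \<and> a = par i \<or> a = ord i \<and> b = par i)"
proof -
  have G: "pair_graph G" and acyclic: "\<not> (\<exists>p. pre_digraph.cycle (with_proj G) p \<and> 3 \<le> length p)"
    using tree by (auto simp: undirected_tree_def)
  have later: "ord i = par j" if ij: "i < j" "j < n" and e: "(ord i, ord j) \<in> parcs G" for i j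
  proof (rule ccontr)
    assume ne: "ord i \<noteq> par j"
    have p: "(par j, ord j) \<in> parcs G" "par j \<in> ord ` {..<j}" using par[of j] ij by (cases j; simp)+
    obtain xs where xs: "path_in G (ord ` {..<j}) (ord i) (par j) xs"
      using path_in_growing[OF G inj par, of j "ord i" "par j"] ij p(2) by auto
    then obtain ys where ys: "xs = ord i # ys" unfolding path_in_def by (cases xs) auto
    have "ys \<noteq> []" using xs ys ne by (auto simp: path_in_def)
    have notin: "ord j \<notin> ord ` {..<j}" using inj ij by (fastforce simp: inj_on_def)
    \<comment> \<open>\<open>ys\<close> is the path without its first vertex and ends in
      \<open>par j\<close>; going on to \<open>ord j\<close> and back to \<open>ord i\<close> closes
      the walk. As \<open>ys\<close> is nonempty, there are at least three arcs.\<close>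
    let ?zs = "ys @ [ord j, ord i]"
    have "successively (\<lambda>a b. (a, b) \<in> parcs G) (ord i # ?zs)"
      using xs ys p(1) pair_graph_symD[OF G e] \<open>ys \<noteq> []\<close>
      by (auto simp: path_in_def successively_append_iff successively_Cons)
    moreover have "set (ord i # ?zs) \<subseteq> pverts G"
    proof -
      have "ord ` {..<j} \<subseteq> pverts G" unfolding V[symmetric] using ij by auto
      then show ?thesis using xs ys ij V[symmetric] by (auto simp: path_in_def)
    qed
    moreover have "distinct ?zs" using xs ys notin ij by (auto simp: path_in_def)
    ultimately have "pre_digraph.cycle (with_proj G) (zip (ord i # ?zs) ?zs)"
      using walk_of_vertices[of G "ord i" ?zs]
      unfolding pre_digraph.cycle_def by (intro exI[of _ "ord i"]) auto
    moreover have "3 \<le> length (zip (ord i # ?zs) ?zs)" using \<open>ys \<noteq> []\<close> by (cases ys) auto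
    ultimately show False using acyclic by blast
  qed
  obtain i j where ij: "a = ord i" "b = ord j" "i < n" "j < n"
  proof -
    have "a \<in> ord ` {..<n}" "b \<in> ord ` {..<n}" using pair_graph_vertsD[OF G arc] V by simp_all
    then show thesis using that by blast
  qed
  then consider "i < j" | "j < i" using pair_graph_vertsD[OF G arc] by fastforce
  then show ?thesis
  proof cases
    case 1
    then show ?thesis using later[of i j] arc ij by (intro exI[of _ j]) auto
  next
    case 2
    then show ?thesis using later[of j i] pair_graph_symD[OF G arc] ij by (intro exI[of _ i]) auto
  qed
qed


section \<open>Dynamic programming on a rooted tree\<close>

text \<open>
  Vertices are positive; vertex 0 is an artificial parent of the root. \<open>ord\<close> lists the vertices
  parents first. Slot \<open>j < c\<close> of vertex \<open>v\<close> holds the index \<open>pen j v\<close> of a penalty containing \<open>v\<close>,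
  or 0 if the slot is unused.
\<close>

locale tree_program =
  fixes c m n :: nat and V :: "nat set" and ord par :: "nat \<Rightarrow> nat" and E :: "(nat \<times> nat) set"
    and P :: "nat \<Rightarrow> nat set" and wt r bw :: "nat \<Rightarrow> nat" and pen :: "nat \<Rightarrow> nat \<Rightarrow> nat"
  assumes ord: "bij_betw ord {..<n} V"
    and zero: "0 \<notin> V"
    and par_root: "0 < n \<Longrightarrow> par (ord 0) = 0"
    and par_less: "\<And>i. 0 < i \<Longrightarrow> i < n \<Longrightarrow> par (ord i) \<in> ord ` {..<i}"
    and arcs: "\<And>a b. (a, b) \<in> E \<Longrightarrow> a \<in> V \<and> b \<in> V \<and> (a = par b \<or> b = par a)"
    and P_ne: "\<And>p. p \<in> {1..m} \<Longrightarrow> P p \<noteq> {}"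
    and P_sub: "\<And>p. p \<in> {1..m} \<Longrightarrow> P p \<subseteq> V"
    and P_conn: "\<And>p X. p \<in> {1..m} \<Longrightarrow> P p \<inter> X \<noteq> {} \<Longrightarrow>
      (\<And>a b. (a, b) \<in> E \<Longrightarrow> a \<in> P p \<Longrightarrow> b \<in> P p \<Longrightarrow> a \<in> X \<Longrightarrow> b \<in> X) \<Longrightarrow> P p \<subseteq> X"
    and wt_0: "wt 0 = 0"
    and pen_0: "\<And>j. pen j 0 = 0"
    and pen_mem: "\<And>j v. v \<in> V \<Longrightarrow> j < c \<Longrightarrow> pen j v \<noteq> 0 \<Longrightarrow> pen j v \<in> {1..m} \<and> v \<in> P (pen j v)"
    and pen_ex: "\<And>p v. v \<in> V \<Longrightarrow> p \<in> {1..m} \<Longrightarrow> v \<in> P p \<Longrightarrow> \<exists>j < c. pen j v = p"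
    and pen_inj: "\<And>i j v. v \<in> V \<Longrightarrow> i < c \<Longrightarrow> j < c \<Longrightarrow> pen i v = pen j v \<Longrightarrow> pen i v \<noteq> 0 \<Longrightarrow> i = j"
begin

text \<open>Vertices not yet merged into their parents, when the first \<open>i\<close> vertices remain.\<close>

definition live :: "nat \<Rightarrow> nat set" where
  "live i = insert 0 (ord ` {..<i})"

text \<open>
  Cost of a selection \<open>S\<close> within the set \<open>C\<close> of vertices merged into \<open>u\<close>; the penalties containing
  \<open>u\<close> are still to be paid.
\<close>

definition part_cost :: "nat \<Rightarrow> nat set \<Rightarrow> nat set \<Rightarrow> nat" where
  "part_cost u C S = (\<Sum>w\<in>C. if w \<in> S then bw w else r w)
     + (\<Sum>p | p \<in> {1..m} \<and> P p \<subseteq> S \<and> u \<notin> P p. wt p)"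

definition alive :: "nat \<Rightarrow> nat set \<Rightarrow> nat set \<Rightarrow> nat \<Rightarrow> bool" where
  "alive u C S j \<longleftrightarrow> j < c \<and> pen j u \<noteq> 0 \<and> P (pen j u) \<inter> C \<subseteq> S"

text \<open>\<open>f A\<close> is the least cost of a selection whose alive slots belong to the bit set \<open>A\<close>.\<close>

definition table :: "nat \<Rightarrow> nat set \<Rightarrow> (nat \<Rightarrow> nat) \<Rightarrow> bool" where
  "table u C f \<longleftrightarrow> (\<forall>A < 2 ^ c.
     (\<exists>S \<subseteq> C. (\<forall>j. alive u C S j \<longrightarrow> bit A j) \<and> part_cost u C S \<le> f A) \<and>
     (\<forall>S \<subseteq> C. (\<forall>j. alive u C S j \<longrightarrow> bit A j) \<longrightarrow> f A \<le> part_cost u C S))"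

text \<open>\<open>C x\<close> holds the vertices merged into \<open>x\<close> so far. The last
  clause says that this class touches the rest of the tree only at \<open>x\<close>; a connected
  penalty avoiding \<open>x\<close> is therefore inside the class or disjoint from it.
  Self-membership exempts 0, which is not a vertex.\<close>

definition parts :: "nat \<Rightarrow> (nat \<Rightarrow> nat set) \<Rightarrow> bool" where
  "parts i C \<longleftrightarrow> (\<forall>x \<in> live i. \<forall>y \<in> live i. x \<noteq> y \<longrightarrow> C x \<inter> C y = {})
     \<and> (\<Union>x \<in> live i. C x) = V \<and> (\<forall>x \<in> live i. x \<noteq> 0 \<longrightarrow> x \<in> C x)
     \<and> (\<forall>a b. \<forall>x \<in> live i. (a, b) \<in> E \<longrightarrow> a \<in> C x \<longrightarrow> b \<notin> C x \<longrightarrow> a = x \<and> b \<in> live i)"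

definition tables :: "nat \<Rightarrow> (nat \<Rightarrow> nat \<Rightarrow> nat) \<Rightarrow> bool" where
  "tables i F \<longleftrightarrow> (\<exists>C. parts i C \<and> (\<forall>u \<in> live i. table u (C u) (\<lambda>A. F A u)))"

definition dropped :: "nat \<Rightarrow> nat \<Rightarrow> nat \<Rightarrow> nat" where
  "dropped u v D = (\<Sum>j<c. if bit D j \<and> (\<forall>i<c. pen i u \<noteq> pen j v) then wt (pen j v) else 0)"

text \<open>A slot of \<open>u\<close> may only lose its alive mark if a child slot of the same penalty is dead.\<close>

definition slot_compatible :: "nat \<Rightarrow> nat \<Rightarrow> nat \<Rightarrow> nat \<Rightarrow> nat \<Rightarrow> bool" where
  "slot_compatible u v A B D \<longleftrightarrow>
     (\<forall>i<c. bit B i \<longrightarrow> \<not> bit A i \<longrightarrow> (\<exists>j<c. \<not> bit D j \<and> pen i u = pen j v))"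

definition is_merge :: "nat \<Rightarrow> nat \<Rightarrow> (nat \<Rightarrow> nat) \<Rightarrow> (nat \<Rightarrow> nat) \<Rightarrow> (nat \<Rightarrow> nat) \<Rightarrow> bool" where
  "is_merge u v f g h \<longleftrightarrow> (\<forall>A < 2 ^ c.
     (\<exists>B < 2 ^ c. \<exists>D < 2 ^ c. slot_compatible u v A B D \<and> h A = f B + g D + dropped u v D) \<and>
     (\<forall>B < 2 ^ c. \<forall>D < 2 ^ c. slot_compatible u v A B D \<longrightarrow> h A \<le> f B + g D + dropped u v D))"

section \<open>The order of merging and the classes of merged vertices\<close>

lemma ord_in: "i < n \<Longrightarrow> ord i \<in> V"
  using ord by (auto simp: bij_betw_def)

lemma V_pos: "v \<in> V \<Longrightarrow> 0 < v"
  using zero by (cases v) auto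

lemma ord_eq_iff: "i < n \<Longrightarrow> j < n \<Longrightarrow> ord i = ord j \<longleftrightarrow> i = j"
  using ord by (auto simp: bij_betw_def inj_on_def)

lemma finite_V: "finite V"
  using ord bij_betw_finite by blast

lemma par_live:
  assumes "i < n" shows "par (ord i) \<in> live i"
  using assms par_root par_less[of i] by (cases "i = 0") (auto simp: live_def)

lemma ord_notin_live: "i < n \<Longrightarrow> ord i \<notin> live i"
  using ord_in ord_eq_iff V_pos[of "ord i"] by (auto simp: live_def)

lemma live_Suc: "live (Suc i) = insert (ord i) (live i)"
  by (auto simp: live_def lessThan_Suc)

text \<open>Children follow their parents in the order and are merged from its end, so the children
  of \<open>ord i\<close> are gone when its own turn comes.\<close>

lemma par_live_ord:
  assumes "i < n" "b \<in> V" "par b = ord i" shows "b \<notin> live (Suc i)"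
proof
  assume "b \<in> live (Suc i)"
  then obtain k where "k \<le> i" "b = ord k"
    using V_pos[OF assms(2)] by (auto simp: live_def less_Suc_eq_le)
  then have "ord i \<in> live k" using par_live[of k] assms by simp
  then have "ord i \<in> live i" using \<open>k \<le> i\<close> by (auto simp: live_def)
  with ord_notin_live assms(1) show False by blast
qed

text \<open>Turns the set of alive slots of a selection into a table index.\<close>

lemma bits_exist: "\<exists>A < 2 ^ c. \<forall>i < c. bit (A :: nat) i \<longleftrightarrow> i \<in> X"
proof (induction c)
  case 0
  then show ?case by auto
next
  case (Suc k)
  then obtain A :: nat where A: "A < 2 ^ k" "\<forall>i < k. bit A i \<longleftrightarrow> i \<in> X" by auto
  then have Ak: "take_bit k A = A" by (simp add: take_bit_nat_eq_self)
  have not: "\<not> bit A i" if "k \<le> i" for i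
    using Ak that by (metis bit_take_bit_iff linorder_not_less)
  show ?case
  proof (cases "k \<in> X")
    case True
    have "set_bit k A < 2 ^ Suc k"
      using A(1) not[of k] by (simp add: set_bit_eq not_le)
    moreover have "\<forall>i < Suc k. bit (set_bit k A) i \<longleftrightarrow> i \<in> X"
      using A(2) True by (auto simp: bit_set_bit_iff less_Suc_eq)
    ultimately show ?thesis by blast
  next
    case False
    have "A < 2 ^ Suc k" using A(1) by simp
    moreover have "\<forall>i < Suc k. bit A i \<longleftrightarrow> i \<in> X"
      using A(2) False not[of k] by (auto simp: less_Suc_eq)
    ultimately show ?thesis by blast
  qed
qed

lemma parts_initial: "parts n (\<lambda>x. if x = 0 then {} else {x})"
proof -
  have "live n = insert 0 V" using ord by (auto simp: live_def bij_betw_def)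
  then show ?thesis using V_pos arcs by (auto simp: parts_def)
qed

text \<open>The children of \<open>v\<close> are no longer live, so an arc leaving
  \<open>C v\<close> can only lead to \<open>u\<close>. It becomes internal, and the union is left
  through \<open>u\<close> alone.\<close>

lemma parts_merge:
  assumes C: "parts (Suc i) C" and i: "i < n" and v: "v = ord i" and u: "u = par v"
  shows "parts i (C(u := C u \<union> C v))"
proof -
  have ul: "u \<in> live i" using par_live i u v by simp
  have vl: "v \<notin> live i" using ord_notin_live i v by simp
  have V: "v \<in> V" "v \<noteq> 0" using ord_in[OF i] V_pos v by auto
  have l: "live (Suc i) = insert v (live i)" using live_Suc v by simp
  have disj: "\<And>x y. x \<in> live (Suc i) \<Longrightarrow> y \<in> live (Suc i) \<Longrightarrow> x \<noteq> y \<Longrightarrow> C x \<inter> C y = {}"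
    and un: "(\<Union>x \<in> live (Suc i). C x) = V"
    and self: "\<And>x. x \<in> live (Suc i) \<Longrightarrow> x \<noteq> 0 \<Longrightarrow> x \<in> C x"
    and arc: "\<And>a b x. x \<in> live (Suc i) \<Longrightarrow> (a, b) \<in> E \<Longrightarrow> a \<in> C x \<Longrightarrow> b \<notin> C x
      \<Longrightarrow> a = x \<and> b \<in> live (Suc i)"
    using C by (auto simp: parts_def)
  let ?C = "C(u := C u \<union> C v)"
  have uv: "u \<noteq> v" using ul vl by auto
  show ?thesis
    unfolding parts_def
  proof (intro conjI ballI allI impI)
    fix x y assume xy: "x \<in> live i" "y \<in> live i" "x \<noteq> y"
    then have "x \<noteq> v" "y \<noteq> v" using vl by auto
    then show "?C x \<inter> ?C y = {}"
      using xy disj[of x y] disj[of x v] disj[of v y] l by auto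
  next
    show "(\<Union>x \<in> live i. ?C x) = V" using un ul l by auto
  next
    fix x assume "x \<in> live i" "x \<noteq> 0"
    then show "x \<in> ?C x" using self l by auto
  next
    fix a b x assume x: "x \<in> live i" and E: "(a, b) \<in> E" and a: "a \<in> ?C x" and b: "b \<notin> ?C x"
    have par: "a = par b \<or> b = par a" "b \<in> V" "a \<in> V" using arcs E by auto
    have "a = x \<and> b \<in> live i"
    proof (cases "a \<in> C v \<and> x = u")
      case True
      then have "a = v" "b \<in> live (Suc i)" using arc[of v a b] E b l by auto
      moreover have "b \<noteq> u"
      proof
        assume "b = u"
        then have "u \<in> C u" using self[of u] ul l par(2) zero by auto
        with b True \<open>b = u\<close> show False by simp
      qed
      ultimately have "par b = v" using par u by auto
      then show ?thesis using par_live_ord[OF i par(2)] v \<open>b \<in> live (Suc i)\<close> by simp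
    next
      case False
      then have "a = x" "b \<in> live (Suc i)" using arc[of x a b] E a b x l by (auto split: if_splits)
      moreover have "b \<noteq> v"
      proof
        assume "b = v"
        then have "a = u \<or> v = par a" using par u by auto
        then have "a = u" using par_live_ord[OF i par(3)] v x l \<open>a = x\<close> by auto
        then show False using \<open>b = v\<close> \<open>a = x\<close> b self[of v] l V by auto
      qed
      ultimately show ?thesis using l by auto
    qed
    then show "a = x" "b \<in> live i" by auto
  qed
qed

text \<open>A connected penalty could leave \<open>C x\<close> only through
  \<open>x\<close>.\<close>

lemma part_penalty:
  assumes C: "parts i C" and x: "x \<in> live i" and p: "p \<in> {1..m}" and ne: "P p \<inter> C x \<noteq> {}"
    and notin: "x \<notin> P p"
  shows "P p \<subseteq> C x"
proof (rule P_conn[OF p ne])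
  fix a b assume "(a, b) \<in> E" "a \<in> P p" "b \<in> P p" "a \<in> C x"
  then show "b \<in> C x" using C x notin unfolding parts_def by metis
qed

text \<open>An arc leaving \<open>C v\<close> could only reach the parent, since the children of
  \<open>v\<close> are no longer live; the penalty avoids the parent and stays inside.\<close>

lemma child_penalty:
  assumes C: "parts (Suc i) C" and i: "i < n" and v: "v = ord i" and u: "u = par v"
    and p: "p \<in> {1..m}" and in_p: "v \<in> P p" and notin: "u \<notin> P p"
  shows "P p \<subseteq> C v"
proof (rule P_conn[OF p])
  have vl: "v \<in> live (Suc i)" "v \<noteq> 0" using live_Suc v V_pos[OF ord_in[OF i]] by auto
  then have "v \<in> C v" using C unfolding parts_def by blast
  then show "P p \<inter> C v \<noteq> {}" using in_p by auto
  fix a b assume *: "(a, b) \<in> E" "a \<in> P p" "b \<in> P p" "a \<in> C v"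
  show "b \<in> C v"
  proof (rule ccontr)
    assume "b \<notin> C v"
    then have "a = v" "b \<in> live (Suc i)" using C * vl unfolding parts_def by blast+
    moreover have "b \<noteq> u" using notin * by auto
    ultimately have "par b = v" "b \<in> V" using arcs[OF *(1)] u by auto
    then show False using par_live_ord[OF i] v \<open>b \<in> live (Suc i)\<close> by simp
  qed
qed

text \<open>Selecting \<open>u\<close> makes all its used slots alive, which is permitted only if
  \<open>A\<close> contains them. Nothing is paid for penalties yet: a nonempty penalty inside
  \<open>{u}\<close> contains \<open>u\<close>.\<close>

lemma table_leaf:
  assumes u: "u \<in> V"
    and f: "\<And>A. A < 2 ^ c \<Longrightarrow> f A = (if \<forall>j<c. bit A j \<or> pen j u = 0 then min (r u) (bw u) else r u)"
  shows "table u {u} f"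
proof -
  have sub: "S \<subseteq> {u} \<longleftrightarrow> S = {} \<or> S = {u}" for S by auto
  have none: "{p. p \<in> {1..m} \<and> P p \<subseteq> {u} \<and> u \<notin> P p} = {}" "{p. p \<in> {1..m} \<and> P p \<subseteq> {} \<and> u \<notin> P p} = {}"
    using P_ne by fastforce+
  have cost: "part_cost u {u} {} = r u" "part_cost u {u} {u} = bw u"
    unfolding part_cost_def none by simp_all
  have alive: "\<not> alive u {u} {} j" "alive u {u} {u} j \<longleftrightarrow> j < c \<and> pen j u \<noteq> 0" for j
    using pen_mem[OF u, of j] by (auto simp: alive_def)
  show ?thesis
    unfolding table_def
  proof (intro allI impI conjI)
    fix A :: nat assume A: "A < 2 ^ c"
    show "\<exists>S\<subseteq>{u}. (\<forall>j. alive u {u} S j \<longrightarrow> bit A j) \<and> part_cost u {u} S \<le> f A"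
    proof (cases "(\<forall>j<c. bit A j \<or> pen j u = 0) \<and> bw u \<le> r u")
      case True
      then show ?thesis by (intro exI[of _ "{u}"]) (auto simp: f[OF A] cost alive)
    next
      case False
      then show ?thesis by (intro exI[of _ "{}"]) (auto simp: f[OF A] cost alive)
    qed
    show "f A \<le> part_cost u {u} S" if "S \<subseteq> {u}" "\<forall>j. alive u {u} S j \<longrightarrow> bit A j" for S
      using that by (auto simp: f[OF A] sub cost alive)
  qed
qed

lemma table_root: "(\<And>A. A < 2 ^ c \<Longrightarrow> f A = 0) \<Longrightarrow> table 0 {} f"
proof -
  have none: "{p. p \<in> {1..m} \<and> P p \<subseteq> {} \<and> 0 \<notin> P p} = {}" using P_ne by fastforce
  have "part_cost 0 {} {} = 0" unfolding part_cost_def none by simp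
  then show "(\<And>A. A < 2 ^ c \<Longrightarrow> f A = 0) \<Longrightarrow> table 0 {} f"
    by (auto simp: table_def alive_def pen_0)
qed

lemma tables_initial:
  assumes "\<And>A. A < 2 ^ c \<Longrightarrow> F A 0 = 0"
    and "\<And>A v. A < 2 ^ c \<Longrightarrow> v \<in> V \<Longrightarrow>
      F A v = (if \<forall>j<c. bit A j \<or> pen j v = 0 then min (r v) (bw v) else r v)"
  shows "tables n F"
proof -
  have "live n = insert 0 V" using ord by (auto simp: live_def bij_betw_def)
  then have "table u (if u = 0 then {} else {u}) (\<lambda>A. F A u)" if "u \<in> live n" for u
    using table_leaf[of u] table_root assms that by auto
  then show ?thesis unfolding tables_def using parts_initial by blast
qed

text \<open>A selection splits into its two sides, and its cost into their costs and the weights of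
  the penalties that end at \<open>v\<close>. Joining optimal sides for the best pair gives a
  selection of cost at most \<open>h A\<close>. Conversely, the exact alive sets of the sides of any
  selection form a compatible pair, which keeps \<open>h A\<close> below its cost.\<close>

lemma table_merge:
  assumes C: "parts (Suc i) C" and i: "i < n" and v: "v = ord i" and u: "u = par v"
    and f: "table u (C u) f" and g: "table v (C v) g" and h: "is_merge u v f g h"
  shows "table u (C u \<union> C v) h"
proof -
  have ul: "u \<in> live (Suc i)" using par_live i u v live_Suc by simp
  have vl: "v \<in> live (Suc i)" using live_Suc v by simp
  have V: "v \<in> V" "v \<noteq> 0" using ord_in[OF i] V_pos v by auto
  have uv: "u \<noteq> v" using par_live[OF i] ord_notin_live[OF i] u v by auto
  have disj: "C u \<inter> C v = {}" and vC: "v \<in> C v" and uC: "u \<noteq> 0 \<Longrightarrow> u \<in> C u"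
    and CV: "C u \<subseteq> V" "C v \<subseteq> V"
    using C ul vl uv V unfolding parts_def by blast+
  have fin: "finite (C u)" "finite (C v)" using CV finite_V finite_subset by auto
  have uV: "u \<in> V \<or> u = 0" using uC CV by auto
  have Pu: "P p \<subseteq> C u" if "p \<in> {1..m}" "P p \<inter> C u \<noteq> {}" "u \<notin> P p" for p
    using part_penalty[OF C ul] that by blast
  have Pv: "P p \<subseteq> C v" if "p \<in> {1..m}" "P p \<inter> C v \<noteq> {}" "v \<notin> P p" for p
    using part_penalty[OF C vl] that by blast
  have Pc: "P p \<subseteq> C v" if "p \<in> {1..m}" "v \<in> P p" "u \<notin> P p" for p
    using child_penalty[OF C i v u] that by blast
  have u_Cv: "u \<notin> C v" using uC disj CV zero by auto
  \<comment> \<open>A penalty of \<open>u\<close> that reaches into \<open>C v\<close> must contain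
    \<open>v\<close>, as it would otherwise lie inside \<open>C v\<close>, which misses
    \<open>u\<close>. So it has a slot at both vertices, where the two tables can be
    compared.\<close>
  have Puv: "v \<in> P p" if "p \<in> {1..m}" "u \<in> P p" "P p \<inter> C v \<noteq> {}" for p
    using Pv that u_Cv by blast
  let ?C = "C u \<union> C v"
  \<comment> \<open>The penalties whose payment was held back at \<open>v\<close> and falls due now,
    because they do not reach \<open>u\<close>.\<close>
  define extra where "extra S = {p. p \<in> {1..m} \<and> P p \<subseteq> S \<and> v \<in> P p \<and> u \<notin> P p}" for S
  have cost: "part_cost u ?C (S \<union> T) = part_cost u (C u) S + part_cost v (C v) T + sum wt (extra T)"
    if S: "S \<subseteq> C u" and T: "T \<subseteq> C v" for S T
  proof -
    have "(\<Sum>w\<in>?C. if w \<in> S \<union> T then bw w else r w) =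
        (\<Sum>w\<in>C u. if w \<in> S then bw w else r w) + (\<Sum>w\<in>C v. if w \<in> T then bw w else r w)"
      using disj S T
      by (subst sum.union_disjoint[OF fin disj])
         (auto intro!: arg_cong2[where f = "(+)"] sum.cong)
    moreover have "{p. p \<in> {1..m} \<and> P p \<subseteq> S \<union> T \<and> u \<notin> P p} =
        {p. p \<in> {1..m} \<and> P p \<subseteq> S \<and> u \<notin> P p} \<union>
        ({p. p \<in> {1..m} \<and> P p \<subseteq> T \<and> v \<notin> P p} \<union> extra T)" (is "?X = ?Y \<union> (?Z \<union> _)")
    proof (intro equalityI subsetI)
      fix p assume p: "p \<in> ?X"
      then have p': "p \<in> {1..m}" "P p \<subseteq> S \<union> T" "u \<notin> P p" by auto
      show "p \<in> ?Y \<union> (?Z \<union> extra T)"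
      proof (cases "P p \<inter> C u = {}")
        case True
        then have "P p \<subseteq> T" using p' S by auto
        then show ?thesis using p' by (auto simp: extra_def)
      next
        case False
        then have "P p \<subseteq> C u" using Pu p' by auto
        then have "P p \<subseteq> S" using p' T disj by auto
        then show ?thesis using p' by auto
      qed
    next
      fix p assume "p \<in> ?Y \<union> (?Z \<union> extra T)"
      then show "p \<in> ?X" using T u_Cv by (auto simp: extra_def)
    qed
    moreover have "?Y \<inter> (?Z \<union> extra T) = {}" "?Z \<inter> extra T = {}"
    proof -
      have "False" if "p \<in> {1..m}" "P p \<subseteq> S" "P p \<subseteq> T" for p
        using that S T disj P_ne[OF that(1)] by blast
      then show "?Y \<inter> (?Z \<union> extra T) = {}" by (auto simp: extra_def)
      show "?Z \<inter> extra T = {}" by (auto simp: extra_def)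
    qed
    moreover have "finite ?Y" "finite ?Z" "finite (extra T)" by (auto simp: extra_def)
    ultimately show ?thesis
      by (simp add: part_cost_def sum.union_disjoint)
  qed
  \<comment> \<open>On used slots the map from slots to penalties is injective, so the sum over
    slots turns into a sum over penalties.\<close>
  have dropped_eq: "dropped u v D =
      sum (wt \<circ> (\<lambda>j. pen j v)) {j. j < c \<and> bit D j \<and> (\<forall>i<c. pen i u \<noteq> pen j v) \<and> pen j v \<noteq> 0}"
    (is "_ = sum _ (?J D)") for D
    unfolding dropped_def
    by (rule sum.mono_neutral_cong_right) (auto simp: wt_0 intro!: gr0I)
  have inj: "inj_on (\<lambda>j. pen j v) (?J D)" for D
    using pen_inj[OF V(1)] by (auto simp: inj_on_def)
  have dropped_image: "sum wt ((\<lambda>j. pen j v) ` ?J D) = dropped u v D" for D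
    by (rule trans[OF sum.reindex[OF inj] dropped_eq[symmetric]])
  have image: "extra T \<subseteq> (\<lambda>j. pen j v) ` ?J D"
    if T: "T \<subseteq> C v" and D: "\<forall>j. alive v (C v) T j \<longrightarrow> bit D j" for T D
  proof
    fix p assume "p \<in> extra T"
    then have p: "p \<in> {1..m}" "P p \<subseteq> T" "v \<in> P p" "u \<notin> P p" by (auto simp: extra_def)
    then obtain j where j: "j < c" "pen j v = p" using pen_ex[OF V(1)] by blast
    then have "alive v (C v) T j" using p by (auto simp: alive_def)
    moreover have "pen i u \<noteq> p" if "i < c" for i
      using uV pen_mem[of u i] that p pen_0 by auto
    ultimately show "p \<in> (\<lambda>j. pen j v) ` ?J D" using j p D by (auto intro!: image_eqI[of _ _ j])
  qed
  have image': "(\<lambda>j. pen j v) ` ?J D \<subseteq> extra T"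
    if T: "T \<subseteq> C v" and D: "\<forall>j<c. bit D j \<longrightarrow> alive v (C v) T j" for T D
  proof
    fix p assume "p \<in> (\<lambda>j. pen j v) ` ?J D"
    then obtain j where j: "j < c" "bit D j" "\<forall>i<c. pen i u \<noteq> pen j v" "pen j v \<noteq> 0" "p = pen j v"
      by auto
    then have p: "p \<in> {1..m}" "v \<in> P p" "P p \<inter> C v \<subseteq> T"
      using pen_mem[OF V(1), of j] D by (auto simp: alive_def)
    moreover have "u \<notin> P p" using pen_ex[of u p] j p P_sub by blast
    ultimately show "p \<in> extra T" using Pc[of p] by (auto simp: extra_def)
  qed
  \<comment> \<open>Two one-sided estimates: a table entry for \<open>D\<close> may come from a
    selection with fewer alive slots, and \<open>dropped\<close> then overestimates; for the exact
    alive set it is tight.\<close>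
  have drop_ge: "sum wt (extra T) \<le> dropped u v D"
    if "T \<subseteq> C v" "\<forall>j. alive v (C v) T j \<longrightarrow> bit D j" for T D
  proof -
    have "sum wt (extra T) \<le> sum wt ((\<lambda>j. pen j v) ` ?J D)"
      by (rule sum_mono2) (use image[OF that] in auto)
    then show ?thesis unfolding dropped_image .
  qed
  have drop_le: "dropped u v D \<le> sum wt (extra T)"
    if "T \<subseteq> C v" "\<forall>j<c. bit D j \<longrightarrow> alive v (C v) T j" for T D
  proof -
    have "sum wt ((\<lambda>j. pen j v) ` ?J D) \<le> sum wt (extra T)"
      by (rule sum_mono2) (use image'[OF that] in \<open>auto simp: extra_def\<close>)
    then show ?thesis unfolding dropped_image .
  qed
  show ?thesis
    unfolding table_def
  proof (intro allI impI conjI)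
    fix A :: nat assume A: "A < 2 ^ c"
    obtain B D where BD: "B < 2 ^ c" "D < 2 ^ c" "slot_compatible u v A B D"
      "h A = f B + g D + dropped u v D"
      using h[unfolded is_merge_def, rule_format, OF A, THEN conjunct1] by blast
    obtain S where S: "S \<subseteq> C u" "\<forall>j. alive u (C u) S j \<longrightarrow> bit B j" "part_cost u (C u) S \<le> f B"
      using f[unfolded table_def, rule_format, OF BD(1), THEN conjunct1] by blast
    obtain T where T: "T \<subseteq> C v" "\<forall>j. alive v (C v) T j \<longrightarrow> bit D j" "part_cost v (C v) T \<le> g D"
      using g[unfolded table_def, rule_format, OF BD(2), THEN conjunct1] by blast
    \<comment> \<open>A slot alive on the merged class is alive on both sides. Were it missing from
      \<open>A\<close>, compatibility would name a dead slot of \<open>v\<close> for the same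
      penalty.\<close>
    have "bit A j" if "alive u ?C (S \<union> T) j" for j
    proof (rule ccontr)
      assume "\<not> bit A j"
      have j: "j < c" "pen j u \<noteq> 0" "P (pen j u) \<inter> ?C \<subseteq> S \<union> T" using that by (auto simp: alive_def)
      then have "alive u (C u) S j" using T(1) disj by (auto simp: alive_def)
      then obtain k where k: "k < c" "\<not> bit D k" "pen j u = pen k v"
        using S(2) BD(3) j(1) \<open>\<not> bit A j\<close> unfolding slot_compatible_def by blast
      then have "alive v (C v) T k" using j S(1) disj by (auto simp: alive_def)
      then show False using T(2) k by blast
    qed
    moreover have "part_cost u ?C (S \<union> T) \<le> h A"
      using cost[OF S(1) T(1)] S(3) T(3) BD(4) drop_ge[OF T(1,2)] by simp
    ultimately show "\<exists>S\<subseteq>?C. (\<forall>j. alive u ?C S j \<longrightarrow> bit A j) \<and> part_cost u ?C S \<le> h A"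
      using S(1) T(1) by (intro exI[of _ "S \<union> T"]) auto
  next
    fix A :: nat and R
    assume A: "A < 2 ^ c" and R: "R \<subseteq> ?C" and al: "\<forall>j. alive u ?C R j \<longrightarrow> bit A j"
    let ?S = "R \<inter> C u" and ?T = "R \<inter> C v"
    \<comment> \<open>\<open>B\<close> and \<open>D\<close> are the exact alive sets of the two
      restrictions of \<open>R\<close>.\<close>
    obtain B :: nat where B: "B < 2 ^ c" "\<forall>j<c. bit B j \<longleftrightarrow> j \<in> {j. alive u (C u) ?S j}"
      using bits_exist by blast
    obtain D :: nat where D: "D < 2 ^ c" "\<forall>j<c. bit D j \<longleftrightarrow> j \<in> {j. alive v (C v) ?T j}"
      using bits_exist by blast
    have "f B \<le> part_cost u (C u) ?S"
      using f B unfolding table_def by (auto simp: alive_def)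
    moreover have "g D \<le> part_cost v (C v) ?T"
      using g D unfolding table_def by (auto simp: alive_def)
    moreover have "dropped u v D \<le> sum wt (extra ?T)" using drop_le[of ?T D] D by auto
    moreover have "slot_compatible u v A B D"
      unfolding slot_compatible_def
    proof (intro allI impI)
      fix j assume j: "j < c" "bit B j" "\<not> bit A j"
      then have 1: "alive u (C u) ?S j" "\<not> alive u ?C R j" using B al by auto
      then have "\<not> P (pen j u) \<inter> C v \<subseteq> ?T" by (auto simp: alive_def)
      moreover have p: "pen j u \<in> {1..m}" "u \<in> P (pen j u)" "pen j u \<noteq> 0"
        using 1 uV pen_mem[of u j] pen_0[of j] by (auto simp: alive_def)
      ultimately have "v \<in> P (pen j u)" using Puv[of "pen j u"] by blast
      then obtain k where k: "k < c" "pen k v = pen j u" using pen_ex[OF V(1) p(1)] by blast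
      then have "\<not> bit D k" using D \<open>\<not> P (pen j u) \<inter> C v \<subseteq> ?T\<close> by (auto simp: alive_def)
      then show "\<exists>k<c. \<not> bit D k \<and> pen j u = pen k v" using k by auto
    qed
    then have "h A \<le> f B + g D + dropped u v D" using h[unfolded is_merge_def, rule_format, OF A, THEN conjunct2] B(1) D(1) by blast
    moreover have "part_cost u ?C R = part_cost u ?C (?S \<union> ?T)"
      using R by (intro arg_cong[where f = "part_cost u ?C"]) auto
    ultimately show "h A \<le> part_cost u ?C R" using cost[of ?S ?T] by simp
  qed
qed

lemma tables_merge:
  assumes F: "tables (Suc i) F" and i: "i < n" and v: "v = ord i" and u: "u = par v"
    and h: "is_merge u v (\<lambda>A. F A u) (\<lambda>A. F A v) (\<lambda>A. F' A u)"
    and other: "\<And>A x. x \<noteq> u \<Longrightarrow> F' A x = F A x"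
  shows "tables i F'"
proof -
  obtain C where C: "parts (Suc i) C" "\<forall>x \<in> live (Suc i). table x (C x) (\<lambda>A. F A x)"
    using F by (auto simp: tables_def)
  have l: "u \<in> live (Suc i)" "v \<in> live (Suc i)" using par_live i u v live_Suc by auto
  have "table u (C u \<union> C v) (\<lambda>A. F' A u)"
    using table_merge[OF C(1) i v u _ _ h] C(2) l by blast
  then have "\<forall>x \<in> live i. table x ((C(u := C u \<union> C v)) x) (\<lambda>A. F' A x)"
    using C(2) other live_Suc by auto
  then show ?thesis using parts_merge[OF C(1) i v u] unfolding tables_def by blast
qed

definition total_cost :: "nat set \<Rightarrow> nat" where
  "total_cost S = (\<Sum>w\<in>V. if w \<in> S then bw w else r w) + (\<Sum>p | p \<in> {1..m} \<and> P p \<subseteq> S. wt p)"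

text \<open>No penalty contains 0, so nothing is held back and no slot is alive there. Every entry
  of its table is the unrestricted minimum; entry 0 exists whatever \<open>c\<close> is.\<close>

lemma tables_final:
  assumes "tables 0 F"
  shows "\<exists>S \<subseteq> V. F 0 0 = total_cost S \<and> (\<forall>T \<subseteq> V. total_cost S \<le> total_cost T)"
proof -
  obtain C where C: "parts 0 C" "table 0 (C 0) (\<lambda>A. F A 0)"
    using assms by (auto simp: tables_def live_def)
  have V: "C 0 = V" using C(1) by (auto simp: parts_def live_def)
  have "0 \<notin> P p" if "p \<in> {1..m}" for p using P_sub[OF that] zero by auto
  then have "part_cost 0 V S = total_cost S" for S
    unfolding part_cost_def total_cost_def
    by (intro arg_cong2[where f = "(+)"] refl sum.cong) auto
  moreover have "\<not> alive 0 V S j" for S j by (simp add: alive_def pen_0)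
  ultimately have "(\<exists>S\<subseteq>V. total_cost S \<le> F 0 0) \<and> (\<forall>S\<subseteq>V. F 0 0 \<le> total_cost S)"
    using C(2) unfolding table_def V by auto
  then show ?thesis by (meson le_antisym le_trans)
qed

end


section \<open>The program\<close>

definition wp :: "nat \<Rightarrow> ('v, 'a) com \<Rightarrow> (('v, 'a) state \<Rightarrow> bool) \<Rightarrow> ('v, 'a) state \<Rightarrow> bool" where
  "wp B c Q s \<longleftrightarrow> safe B c s \<and> Q (run c s)"

lemma wp_simps [simp]:
  "wp B Skip Q s = Q s"
  "wp B (Assign x e) Q s = Q (s\<lparr>vars := (vars s)(x := val e s)\<rparr>)"
  "wp B (Put a i e) Q s = Q (s\<lparr>arrs := (arrs s)(a := (arrs s a)(val i s := val e s))\<rparr>)"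
  "wp B (Scan x) Q s = Q (s\<lparr>vars := (vars s)(x := (case inp s of [] \<Rightarrow> 0 | y # _ \<Rightarrow> y)),
     inp := tl (inp s)\<rparr>)"
  "wp B (Emit e) Q s = Q (s\<lparr>outp := outp s @ [val e s]\<rparr>)"
  "wp B (c ;; d) Q s = wp B c (wp B d Q) s"
  by (auto simp: wp_def)

lemma wp_mono: "wp B c Q s \<Longrightarrow> (\<And>t. Q t \<Longrightarrow> R t) \<Longrightarrow> wp B c R s"
  by (auto simp: wp_def)

lemma wp_Loop:
  assumes bound: "val e s \<le> B" and start: "I 0 s"
    and body: "\<And>k t. k < val e s \<Longrightarrow> I k t \<Longrightarrow> wp B c (I (Suc k)) t"
    and finish: "\<And>t. I (val e s) t \<Longrightarrow> Q t"
  shows "wp B (Loop e c) Q s"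
proof -
  have I: "I k ((run c ^^ k) s)" if "k \<le> val e s" for k
    using that by (induction k) (use start body in \<open>auto simp: wp_def Suc_le_eq\<close>)
  then have "safe B c ((run c ^^ k) s)" if "k < val e s" for k
    using body[of k] that by (auto simp: wp_def)
  then show ?thesis using bound finish[OF I] by (auto simp: wp_def)
qed

text \<open>Commands have no conditional; a loop whose count is 0 or 1 takes its place.\<close>

lemma wp_If:
  assumes "val e s \<le> 1" "1 \<le> B" "val e s = 1 \<Longrightarrow> wp B c Q s" "val e s = 0 \<Longrightarrow> Q s"
  shows "wp B (Loop e c) Q s"
  using assms by (cases "val e s") (auto simp: wp_def)

primrec seqs :: "('v, 'a) com list \<Rightarrow> ('v, 'a) com" where
  "seqs [] = Skip"
| "seqs (c # cs) = c ;; seqs cs"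

primrec wvars :: "('v, 'a) com \<Rightarrow> 'v set" where
  "wvars Skip = {}"
| "wvars (Assign x e) = {x}"
| "wvars (Put a i e) = {}"
| "wvars (Scan x) = {x}"
| "wvars (Emit e) = {}"
| "wvars (c ;; d) = wvars c \<union> wvars d"
| "wvars (Loop e c) = wvars c"

primrec warrs :: "('v, 'a) com \<Rightarrow> 'a set" where
  "warrs Skip = {}"
| "warrs (Assign x e) = {}"
| "warrs (Put a i e) = {a}"
| "warrs (Scan x) = {}"
| "warrs (Emit e) = {}"
| "warrs (c ;; d) = warrs c \<union> warrs d"
| "warrs (Loop e c) = warrs c"

primrec scans :: "('v, 'a) com \<Rightarrow> bool" where
  "scans Skip = False"
| "scans (Assign x e) = False"
| "scans (Put a i e) = False"
| "scans (Scan x) = True"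
| "scans (Emit e) = False"
| "scans (c ;; d) = (scans c \<or> scans d)"
| "scans (Loop e c) = scans c"

primrec emits :: "('v, 'a) com \<Rightarrow> bool" where
  "emits Skip = False"
| "emits (Assign x e) = False"
| "emits (Put a i e) = False"
| "emits (Scan x) = False"
| "emits (Emit e) = True"
| "emits (c ;; d) = (emits c \<or> emits d)"
| "emits (Loop e c) = emits c"

text \<open>Write sets are read off the syntax, so the specification of a phase need only mention
  what it computes; all else is carried over by the frame.\<close>

definition frame :: "('v, 'a) com \<Rightarrow> ('v, 'a) state \<Rightarrow> ('v, 'a) state \<Rightarrow> bool" where
  "frame c s t \<longleftrightarrow> (\<forall>x. x \<notin> wvars c \<longrightarrow> vars t x = vars s x) \<and> (\<forall>a. a \<notin> warrs c \<longrightarrow> arrs t a = arrs s a)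
     \<and> (\<not> scans c \<longrightarrow> inp t = inp s) \<and> (\<not> emits c \<longrightarrow> outp t = outp s)"

lemma frame_run: "frame c s (run c s)"
proof (induction c arbitrary: s)
  case (Seq c d)
  then show ?case using Seq.IH(1)[of s] Seq.IH(2)[of "run c s"] by (auto simp: frame_def)
next
  case (Loop e c)
  have "frame c s ((run c ^^ k) s)" for k
  proof (induction k)
    case (Suc k)
    then show ?case using Loop.IH[of "(run c ^^ k) s"] by (auto simp: frame_def)
  qed (simp add: frame_def)
  then show ?case by (auto simp: frame_def)
qed (auto simp: frame_def)

lemma wp_frame: "wp B c Q s \<Longrightarrow> (\<And>t. Q t \<Longrightarrow> frame c s t \<Longrightarrow> R t) \<Longrightarrow> wp B c R s"
  using frame_run by (auto simp: wp_def)

lemma write_sets_seqs [simp]: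
  "wvars (seqs cs) = (\<Union>c \<in> set cs. wvars c)"
  "warrs (seqs cs) = (\<Union>c \<in> set cs. warrs c)"
  "scans (seqs cs) \<longleftrightarrow> (\<exists>c \<in> set cs. scans c)"
  "emits (seqs cs) \<longleftrightarrow> (\<exists>c \<in> set cs. emits c)"
  by (induction cs) auto


section \<open>The solver as a loop program\<close>

datatype var = vN | vNA | vI | vK | vL | vX | vY | vW | vU | vV | vP | vScale | vTot | vCnt | vF
  | vNew nat

text \<open>\<open>aPen j\<close> belongs to slot \<open>j\<close> and \<open>aTab A\<close> to the
  bit set \<open>A\<close>; both are indexed by vertices at run time. Slots and bit sets can be
  numbered in the program text because \<open>c\<close> is constant.\<close>

datatype arr = aVert | aSrc | aDst | aReward | aWeight | aBit | aSeen | aPar | aOrd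
  | aPen nat | aTab nat

instance var :: countable by countable_datatype
instance arr :: countable by countable_datatype

abbreviation Inc :: "'v \<Rightarrow> ('v, 'a) com" where
  "Inc x \<equiv> Assign x (Plus (Var x) (Lit 1))"

abbreviation next_id :: "'v \<Rightarrow> ('v, 'a) expr" where
  "next_id x \<equiv> Plus (Var x) (Lit 1)"

text \<open>Shifts a weight above the \<open>vN\<close> mask bits; without multiplication this takes
  \<open>vN\<close> doublings.\<close>

definition double :: "(var, arr) com" where
  "double = Loop (Var vN) (Assign vW (Plus (Var vW) (Var vW)))"

text \<open>Identifiers are raised by one, which frees 0 for the artificial parent. Mask bits go by
  position in the list, since vertex numbers may be huge. \<open>vScale\<close> runs through these
  bits and ends at \<open>2 ^ n\<close>, the unit of cost.\<close>

definition read_verts :: "(var, arr) com" where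
  "read_verts = Scan vN ;; Assign vScale (Lit 1) ;;
     Loop (Var vN) (Scan vX ;; Put aVert (Var vI) (next_id vX) ;; Put aBit (next_id vX) (Var vScale) ;;
       Assign vScale (Plus (Var vScale) (Var vScale)) ;; Inc vI)"

definition read_arcs :: "(var, arr) com" where
  "read_arcs = Scan vK ;; Assign vNA (Plus (Var vK) (Var vK)) ;; Assign vI (Lit 0) ;;
     Loop (Var vK) (Scan vX ;; Scan vY ;;
       Put aSrc (Var vI) (next_id vX) ;; Put aDst (Var vI) (next_id vY) ;; Inc vI ;;
       Put aSrc (Var vI) (next_id vY) ;; Put aDst (Var vI) (next_id vX) ;; Inc vI)"

text \<open>The code of a reward is \<open>[w, 1, v, 0]\<close>: the first scan into
  \<open>vX\<close> discards the vertex count, the last one the edge count. \<open>vTot\<close> adds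
  weights before scaling, as it will count subtractions of \<open>vScale\<close>.\<close>

definition read_rewards :: "(var, arr) com" where
  "read_rewards = Scan vK ;;
     Loop (Var vK) (Scan vW ;; Assign vTot (Plus (Var vTot) (Var vW)) ;; double ;; Scan vX ;; Scan vX ;;
       Put aReward (next_id vX) (Plus (Arr aReward (next_id vX)) (Var vW)) ;; Scan vX)"

text \<open>The slots of a vertex form a shift register: a new penalty enters at slot 0.\<close>

primrec shift :: "nat \<Rightarrow> (var, arr) com" where
  "shift 0 = Skip"
| "shift (Suc j) = Put (aPen (Suc j)) (Var vX) (Arr (aPen j) (Var vX)) ;; shift j"

definition read_members :: "nat \<Rightarrow> (var, arr) com" where
  "read_members c = Scan vL ;;
     Loop (Var vL) (Scan vX ;; Inc vX ;; shift c ;; Put (aPen 0) (Var vX) (Var vP))"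

definition skip_edges :: "(var, arr) com" where
  "skip_edges = Scan vL ;; Loop (Var vL) (Scan vX ;; Scan vX)"

definition read_penalties :: "nat \<Rightarrow> (var, arr) com" where
  "read_penalties c = Scan vK ;;
     Loop (Var vK) (Inc vP ;; Scan vW ;; double ;; Put aWeight (Var vP) (Var vW) ;;
       read_members c ;; skip_edges)"

text \<open>The truncated difference is 1 exactly if the tail is seen and the head is not, so the
  inner loop acts as a conditional.\<close>

definition visit_arc :: "(var, arr) com" where
  "visit_arc = Assign vU (Arr aSrc (Var vI)) ;; Assign vV (Arr aDst (Var vI)) ;;
     Loop (Minus (Arr aSeen (Var vU)) (Arr aSeen (Var vV)))
       (Put aSeen (Var vV) (Lit 1) ;; Put aPar (Var vV) (Var vU) ;; Put aOrd (Var vCnt) (Var vV) ;;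
        Inc vCnt) ;;
     Inc vI"

text \<open>A search by passes over all arcs, in the manner of Bellman and Ford: each pass settles
  at least one more level of distance from the root. The number of passes is known on entry, as the
  loops demand, unlike the length of a queue.\<close>

definition find_order :: "(var, arr) com" where
  "find_order = Put aSeen (Arr aVert (Lit 0)) (Lit 1) ;; Put aOrd (Lit 0) (Arr aVert (Lit 0)) ;;
     Assign vCnt (Lit 1) ;;
     Loop (Var vNA) (Assign vI (Lit 0) ;; Loop (Var vNA) visit_arc)"

definition esum :: "('v, 'a) expr list \<Rightarrow> ('v, 'a) expr" where
  "esum es = foldr Plus es (Lit 0)"

definition econj :: "('v, 'a) expr list \<Rightarrow> ('v, 'a) expr" where
  "econj es = foldr (\<lambda>e f. Cond e f (Lit 0)) es (Lit 1)"

definition emin :: "('v, 'a) expr \<Rightarrow> ('v, 'a) expr \<Rightarrow> ('v, 'a) expr" where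
  "emin e f = Minus e (Minus e f)"

text \<open>Used slots hold positive indices, so the sum is nonzero exactly if selecting the vertex
  makes a slot outside \<open>A\<close> alive.\<close>

definition leaf_expr :: "nat \<Rightarrow> nat \<Rightarrow> (var, arr) expr" where
  "leaf_expr c A = Cond (esum (map (\<lambda>j. Arr (aPen j) (Var vV)) (filter (\<lambda>j. \<not> bit A j) [0..<c])))
     (Arr aReward (Var vV)) (emin (Arr aReward (Var vV)) (Arr aBit (Var vV)))"

definition init_tables :: "nat \<Rightarrow> (var, arr) com" where
  "init_tables c = Assign vI (Lit 0) ;;
     Loop (Var vN) (Assign vV (Arr aVert (Var vI)) ;;
       seqs (map (\<lambda>A. Put (aTab A) (Var vV) (leaf_expr c A)) [0..<2 ^ c]) ;; Inc vI)"

definition pen_neq :: "nat \<Rightarrow> nat \<Rightarrow> (var, arr) expr" where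
  "pen_neq i j = (let e = Arr (aPen i) (Var vU); f = Arr (aPen j) (Var vV)
     in Plus (Minus e f) (Minus f e))"

definition dropped_expr :: "nat \<Rightarrow> nat \<Rightarrow> (var, arr) expr" where
  "dropped_expr c D = esum (map (\<lambda>j. Cond (econj (map (\<lambda>i. pen_neq i j) [0..<c]))
     (Arr aWeight (Arr (aPen j) (Var vV))) (Lit 0)) (filter (bit D) [0..<c]))"

definition conflict_expr :: "nat \<Rightarrow> nat \<Rightarrow> nat \<Rightarrow> nat \<Rightarrow> (var, arr) expr" where
  "conflict_expr c A B D =
     esum (map (\<lambda>i. econj (map (\<lambda>j. pen_neq i j) (filter (\<lambda>j. \<not> bit D j) [0..<c])))
       (filter (\<lambda>i. bit B i \<and> \<not> bit A i) [0..<c]))"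

definition pair_expr :: "nat \<Rightarrow> nat \<Rightarrow> nat \<Rightarrow> (var, arr) expr" where
  "pair_expr c B D =
     Plus (Plus (Arr (aTab B) (Var vU)) (Arr (aTab D) (Var vV))) (dropped_expr c D)"

text \<open>The pair of \<open>A\<close> and the full set is always compatible, which spares an infinite value.\<close>

definition merge_expr :: "nat \<Rightarrow> nat \<Rightarrow> (var, arr) expr" where
  "merge_expr c A = (let e = pair_expr c A (2 ^ c - 1) in
     foldr emin (map (\<lambda>(B, D). Cond (conflict_expr c A B D) e (pair_expr c B D))
       (List.product [0..<2 ^ c] [0..<2 ^ c])) e)"

text \<open>Every new entry depends on the whole old table of \<open>u\<close>; hence all are
  computed into scalars before the first one is written.\<close>

definition merge_child :: "nat \<Rightarrow> (var, arr) com" where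
  "merge_child c = Assign vI (Minus (Var vI) (Lit 1)) ;;
     Assign vV (Arr aOrd (Var vI)) ;; Assign vU (Arr aPar (Var vV)) ;;
     seqs (map (\<lambda>A. Assign (vNew A) (merge_expr c A)) [0..<2 ^ c]) ;;
     seqs (map (\<lambda>A. Put (aTab A) (Var vU) (Var (vNew A))) [0..<2 ^ c])"

definition merge_all :: "nat \<Rightarrow> (var, arr) com" where
  "merge_all c = Assign vI (Var vN) ;; Loop (Var vN) (merge_child c)"

text \<open>The conditional lets \<open>vF\<close> rest once it is below \<open>vScale\<close>, so a
  surplus of iterations does no harm. The mask is read from its highest bit down, where comparison
  and subtraction replace bit operations. The emitted number undoes the shift of
  identifiers.\<close>

definition decode :: "(var, arr) com" where
  "decode = Assign vF (Arr (aTab 0) (Lit 0)) ;;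
     Loop (Var vTot)
       (Assign vF (Cond (Minus (Var vScale) (Var vF)) (Var vF) (Minus (Var vF) (Var vScale)))) ;;
     Assign vI (Var vN) ;;
     Loop (Var vN) (Assign vI (Minus (Var vI) (Lit 1)) ;; Assign vX (Arr aVert (Var vI)) ;;
       Loop (Cond (Minus (Arr aBit (Var vX)) (Var vF)) (Lit 0) (Lit 1))
         (Emit (Minus (Var vX) (Lit 1)) ;; Assign vF (Minus (Var vF) (Arr aBit (Var vX)))))"

definition solver :: "nat \<Rightarrow> (var, arr) com" where
  "solver c = read_verts ;; read_arcs ;; read_rewards ;; read_penalties c ;; find_order ;;
     init_tables c ;; merge_all c ;; decode"


section \<open>Values of the compound expressions\<close>

lemma val_esum [simp]: "val (esum es) s = (\<Sum>e\<leftarrow>es. val e s)"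
  by (induction es) (auto simp: esum_def)

lemma val_econj [simp]: "val (econj es) s = (if \<forall>e \<in> set es. val e s \<noteq> 0 then 1 else 0)"
  by (induction es) (auto simp: econj_def)

lemma val_emin [simp]: "val (emin e f) s = min (val e s) (val f s)"
  by (auto simp: emin_def)

lemma val_foldr_emin_le: "e \<in> insert f (set es) \<Longrightarrow> val (foldr emin es f) s \<le> val e s"
  by (induction es) (auto simp: min_le_iff_disj)

lemma val_foldr_emin_in: "\<exists>e \<in> insert f (set es). val (foldr emin es f) s = val e s"
  by (induction es) (auto simp: min_def)

lemma val_pen_neq:
  "val (pen_neq i j) s = 0 \<longleftrightarrow> arrs s (aPen i) (vars s vU) = arrs s (aPen j) (vars s vV)"
  "0 < val (pen_neq i j) s \<longleftrightarrow> arrs s (aPen i) (vars s vU) \<noteq> arrs s (aPen j) (vars s vV)"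
  by (auto simp: pen_neq_def Let_def)

lemma val_leaf_expr:
  "val (leaf_expr c A) s =
    (if \<forall>j<c. bit A j \<or> arrs s (aPen j) (vars s vV) = 0
     then min (arrs s aReward (vars s vV)) (arrs s aBit (vars s vV)) else arrs s aReward (vars s vV))"
  by (auto simp: leaf_expr_def sum_list_eq_0_iff)

lemma sum_list_indicator_eq_0:
  "(\<Sum>x\<leftarrow>xs. if Q x then 1 else 0 :: nat) = 0 \<longleftrightarrow> (\<forall>x \<in> set xs. \<not> Q x)"
  by (induction xs) auto

context tree_program
begin

lemma val_dropped_expr:
  assumes "\<And>j v. j < c \<Longrightarrow> arrs s (aPen j) v = pen j v" "arrs s aWeight = wt"
  shows "val (dropped_expr c D) s = dropped (vars s vU) (vars s vV) D"
proof -
  have "val (dropped_expr c D) s = (\<Sum>j\<leftarrow>[0..<c]. if bit D j \<and>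
      (\<forall>i<c. pen i (vars s vU) \<noteq> pen j (vars s vV)) then wt (pen j (vars s vV)) else 0)"
    by (auto simp: dropped_expr_def sum_list_map_filter' val_pen_neq assms comp_def
        intro!: arg_cong[where f = sum_list])
  then show ?thesis
    by (simp add: dropped_def interv_sum_list_conv_sum_set_nat atLeast0LessThan)
qed

lemma val_conflict_expr:
  assumes "\<And>j v. j < c \<Longrightarrow> arrs s (aPen j) v = pen j v"
  shows "val (conflict_expr c A B D) s = 0 \<longleftrightarrow> slot_compatible (vars s vU) (vars s vV) A B D"
proof -
  have e: "val (conflict_expr c A B D) s = (\<Sum>i\<leftarrow>filter (\<lambda>i. bit B i \<and> \<not> bit A i) [0..<c].
      if \<forall>j<c. \<not> bit D j \<longrightarrow> pen i (vars s vU) \<noteq> pen j (vars s vV) then 1 else 0)"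
    by (auto simp: conflict_expr_def val_pen_neq assms comp_def intro!: arg_cong[where f = sum_list])
  show ?thesis unfolding e sum_list_indicator_eq_0 by (auto simp: slot_compatible_def)
qed

lemma is_merge_expr:
  assumes "\<And>j v. j < c \<Longrightarrow> arrs s (aPen j) v = pen j v" "arrs s aWeight = wt"
  shows "is_merge (vars s vU) (vars s vV) (\<lambda>A. arrs s (aTab A) (vars s vU))
    (\<lambda>A. arrs s (aTab A) (vars s vV)) (\<lambda>A. val (merge_expr c A) s)"
  unfolding is_merge_def
proof (intro allI impI conjI)
  let ?u = "vars s vU" and ?v = "vars s vV"
  fix A :: nat assume A: "A < 2 ^ c"
  define d where "d = (2 ^ c - 1 :: nat)"
  define es where "es = map (\<lambda>(B, D). Cond (conflict_expr c A B D) (pair_expr c A d) (pair_expr c B D))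
    (List.product [0..<2 ^ c] [0..<2 ^ c])"
  have pair: "val (pair_expr c B D) s =
      arrs s (aTab B) ?u + arrs s (aTab D) ?v + dropped ?u ?v D" for B D
    using val_dropped_expr[OF assms] by (simp add: pair_expr_def)
  have conflict: "val (conflict_expr c A B D) s = 0 \<longleftrightarrow> slot_compatible ?u ?v A B D" for B D
    using val_conflict_expr[OF assms(1)] by simp
  have full: "slot_compatible ?u ?v A A d" by (simp add: slot_compatible_def)
  have d: "d < 2 ^ c" by (simp add: d_def)
  have expr: "merge_expr c A = foldr emin es (pair_expr c A d)"
    by (simp only: merge_expr_def Let_def es_def d_def)
  have set_es: "set es = (\<lambda>(B, D). Cond (conflict_expr c A B D) (pair_expr c A d) (pair_expr c B D))
      ` ({..<2 ^ c} \<times> {..<2 ^ c})"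
    by (simp add: es_def atLeast0LessThan)
  obtain e where e: "e = pair_expr c A d \<or> e \<in> set es" "val (merge_expr c A) s = val e s"
    using val_foldr_emin_in[of "pair_expr c A d" es s] unfolding expr by blast
  have "\<exists>B<2 ^ c. \<exists>D<2 ^ c. slot_compatible ?u ?v A B D \<and> val e s = val (pair_expr c B D) s"
    using e(1)
  proof
    assume "e = pair_expr c A d"
    then show ?thesis using A d full by blast
  next
    assume "e \<in> set es"
    then obtain B D where BD: "B < 2 ^ c" "D < 2 ^ c"
      "e = Cond (conflict_expr c A B D) (pair_expr c A d) (pair_expr c B D)"
      unfolding set_es by auto
    show ?thesis
    proof (cases "slot_compatible ?u ?v A B D")
      case True
      then have "val e s = val (pair_expr c B D) s" using conflict[of B D] BD(3) by simp
      then show ?thesis using BD True by blast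
    next
      case False
      then have "val e s = val (pair_expr c A d) s" using conflict[of B D] BD(3) by simp
      then show ?thesis using A d full by blast
    qed
  qed
  then show "\<exists>B<2 ^ c. \<exists>D<2 ^ c. slot_compatible ?u ?v A B D \<and>
      val (merge_expr c A) s = arrs s (aTab B) ?u + arrs s (aTab D) ?v + dropped ?u ?v D"
    unfolding e(2) pair .
  fix B D :: nat assume BD: "B < 2 ^ c" "D < 2 ^ c" "slot_compatible ?u ?v A B D"
  let ?e = "Cond (conflict_expr c A B D) (pair_expr c A d) (pair_expr c B D)"
  have "?e \<in> set es" unfolding set_es using BD by (intro image_eqI[of _ _ "(B, D)"]) auto
  then have "val (merge_expr c A) s \<le> val ?e s"
    unfolding expr by (intro val_foldr_emin_le) simp
  also have "val ?e s = val (pair_expr c B D) s" using conflict[of B D] BD(3) by simp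
  finally show "val (merge_expr c A) s \<le> arrs s (aTab B) ?u + arrs s (aTab D) ?v + dropped ?u ?v D"
    unfolding pair .
qed

end

text \<open>Copying begins at the top slot, so each slot receives the old content of the one below
  it.\<close>

lemma shift_correct:
  "wp B (shift k) (\<lambda>t. vars t = vars s \<and> inp t = inp s \<and> outp t = outp s
     \<and> (\<forall>a. (\<forall>j. a \<noteq> aPen j) \<longrightarrow> arrs t a = arrs s a)
     \<and> (\<forall>j i. arrs t (aPen j) i =
          (if i = vars s vX \<and> 0 < j \<and> j \<le> k then arrs s (aPen (j - 1)) i else arrs s (aPen j) i))) s"
proof (induction k arbitrary: s)
  case 0
  then show ?case by auto
next
  case (Suc k)
  let ?s = "s\<lparr>arrs := (arrs s)(aPen (Suc k) := (arrs s (aPen (Suc k)))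
    (vars s vX := arrs s (aPen k) (vars s vX)))\<rparr>"
  have "wp B (shift (Suc k)) Q s = wp B (shift k) Q ?s" for Q by simp
  moreover have "wp B (shift k) (\<lambda>t. vars t = vars s \<and> inp t = inp s \<and> outp t = outp s
     \<and> (\<forall>a. (\<forall>j. a \<noteq> aPen j) \<longrightarrow> arrs t a = arrs s a)
     \<and> (\<forall>j i. arrs t (aPen j) i =
          (if i = vars s vX \<and> 0 < j \<and> j \<le> Suc k then arrs s (aPen (j - 1)) i
           else arrs s (aPen j) i))) ?s"
  proof (rule wp_mono[OF Suc.IH[of ?s]], elim conjE, intro conjI allI impI)
    fix t j i
    assume "\<forall>j i. arrs t (aPen j) i =
        (if i = vars ?s vX \<and> 0 < j \<and> j \<le> k then arrs ?s (aPen (j - 1)) i else arrs ?s (aPen j) i)"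
    then have t: "arrs t (aPen j) i =
        (if i = vars ?s vX \<and> 0 < j \<and> j \<le> k then arrs ?s (aPen (j - 1)) i else arrs ?s (aPen j) i)"
      by blast
    consider "j \<le> k" | "j = Suc k" | "j > Suc k" by linarith
    then show "arrs t (aPen j) i = (if i = vars s vX \<and> 0 < j \<and> j \<le> Suc k
        then arrs s (aPen (j - 1)) i else arrs s (aPen j) i)"
    proof cases
      case 1
      then show ?thesis unfolding t by auto
    next
      case 2
      then show ?thesis unfolding t by simp
    next
      case 3
      then show ?thesis unfolding t by simp
    qed
  qed simp_all
  ultimately show ?case by simp
qed

lemma wp_seqs_snoc: "wp B (seqs (cs @ [c])) Q s = wp B (seqs cs) (wp B c Q) s"
  by (induction cs arbitrary: s) (simp_all add: wp_def)

text \<open>For expressions that do not read the tables, the unrolled writes act as one simultaneous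
  assignment.\<close>

lemma wp_put_tables:
  assumes "\<And>A t. A < m \<Longrightarrow> vars t = vars s \<Longrightarrow> (\<And>a. (\<And>j. a \<noteq> aTab j) \<Longrightarrow> arrs t a = arrs s a) \<Longrightarrow> val (e A) t = f A"
    and "\<And>t. vars t = vars s \<Longrightarrow> inp t = inp s \<Longrightarrow> outp t = outp s \<Longrightarrow>
      (\<And>a. (\<And>j. a \<noteq> aTab j) \<Longrightarrow> arrs t a = arrs s a) \<Longrightarrow>
      (\<And>A. arrs t (aTab A) = (if A < m then (arrs s (aTab A))(vars s x := f A) else arrs s (aTab A))) \<Longrightarrow> Q t"
  shows "wp B (seqs (map (\<lambda>A. Put (aTab A) (Var x) (e A)) [0..<m])) Q s"
  using assms
proof (induction m arbitrary: Q)
  case 0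
  then show ?case by simp
next
  case (Suc m)
  have "wp B (seqs (map (\<lambda>A. Put (aTab A) (Var x) (e A)) [0..<m])) (wp B (Put (aTab m) (Var x) (e m)) Q) s"
  proof (rule Suc.IH)
    show "val (e A) t = f A" if "A < m" "vars t = vars s" "\<And>a. (\<And>j. a \<noteq> aTab j) \<Longrightarrow> arrs t a = arrs s a"
      for A t using Suc.prems(1)[of A t] that by simp
    fix t :: "(_, _) state"
    assume t: "vars t = vars s" "inp t = inp s" "outp t = outp s"
      "\<And>a. (\<And>j. a \<noteq> aTab j) \<Longrightarrow> arrs t a = arrs s a"
      "\<And>A. arrs t (aTab A) = (if A < m then (arrs s (aTab A))(vars s x := f A) else arrs s (aTab A))"
    have v: "val (e m) t = f m" using Suc.prems(1)[of m t] t by simp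
    show "wp B (Put (aTab m) (Var x) (e m)) Q t"
      unfolding wp_simps
      by (rule Suc.prems(2)) (use t v in \<open>auto simp: less_Suc_eq\<close>)
  qed
  then show ?case by (simp add: wp_seqs_snoc del: wp_simps)
qed

lemma wp_assign_new:
  assumes "\<And>A t. A < m \<Longrightarrow> arrs t = arrs s \<Longrightarrow> (\<And>x. (\<And>j. x \<noteq> vNew j) \<Longrightarrow> vars t x = vars s x) \<Longrightarrow> val (e A) t = f A"
    and "\<And>t. arrs t = arrs s \<Longrightarrow> inp t = inp s \<Longrightarrow> outp t = outp s \<Longrightarrow>
      (\<And>x. (\<And>j. x \<noteq> vNew j) \<Longrightarrow> vars t x = vars s x) \<Longrightarrow>
      (\<And>A. A < m \<Longrightarrow> vars t (vNew A) = f A) \<Longrightarrow> Q t"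
  shows "wp B (seqs (map (\<lambda>A. Assign (vNew A) (e A)) [0..<m])) Q s"
  using assms
proof (induction m arbitrary: Q)
  case 0
  then show ?case by simp
next
  case (Suc m)
  have "wp B (seqs (map (\<lambda>A. Assign (vNew A) (e A)) [0..<m])) (wp B (Assign (vNew m) (e m)) Q) s"
  proof (rule Suc.IH)
    show "val (e A) t = f A" if "A < m" "arrs t = arrs s" "\<And>x. (\<And>j. x \<noteq> vNew j) \<Longrightarrow> vars t x = vars s x"
      for A t using Suc.prems(1)[of A t] that by simp
    fix t :: "(_, _) state"
    assume t: "arrs t = arrs s" "inp t = inp s" "outp t = outp s"
      "\<And>x. (\<And>j. x \<noteq> vNew j) \<Longrightarrow> vars t x = vars s x" "\<And>A. A < m \<Longrightarrow> vars t (vNew A) = f A"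
    have v: "val (e m) t = f m" using Suc.prems(1)[of m t] t by simp
    show "wp B (Assign (vNew m) (e m)) Q t"
      unfolding wp_simps
      by (rule Suc.prems(2)) (use t v in \<open>auto simp: less_Suc_eq\<close>)
  qed
  then show ?case by (simp add: wp_seqs_snoc del: wp_simps)
qed


subsection \<open>Reading the instance\<close>

lemma read_verts_correct:
  assumes "inp s = length vs # vs @ rest" "vars s vI = 0" "distinct vs" "length vs \<le> B"
  shows "wp B read_verts (\<lambda>t. inp t = rest \<and> vars t vN = length vs \<and> vars t vScale = 2 ^ length vs \<and>
    (\<forall>i < length vs. arrs t aVert i = Suc (vs ! i) \<and> arrs t aBit (Suc (vs ! i)) = 2 ^ i)) s"
proof -
  let ?I = "\<lambda>k t. inp t = drop k vs @ rest \<and> vars t vN = length vs \<and> vars t vScale = 2 ^ k \<and>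
    vars t vI = k \<and> (\<forall>i < k. arrs t aVert i = Suc (vs ! i) \<and> arrs t aBit (Suc (vs ! i)) = 2 ^ i)"
  show ?thesis
    unfolding read_verts_def wp_simps
  proof (rule wp_Loop[where I = ?I], goal_cases)
    case (3 k t)
    then have k: "k < length vs" using assms by simp
    then have "drop k vs = vs ! k # drop (Suc k) vs" by (simp add: Cons_nth_drop_Suc)
    then show ?case using 3 k assms(3) by (auto simp: less_Suc_eq nth_eq_iff_index_eq)
  qed (use assms in auto)
qed

definition darcs :: "('v \<times> 'v) list \<Rightarrow> ('v \<times> 'v) list" where
  "darcs es = concat (map (\<lambda>(u, v). [(u, v), (v, u)]) es)"

lemma length_darcs [simp]: "length (darcs es) = length es + length es"
  by (induction es) (auto simp: darcs_def)

lemma darcs_Nil [simp]: "darcs [] = []"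
  by (simp add: darcs_def)

lemma set_darcs: "set (darcs es) = set es \<union> (set es)\<inverse>"
  by (auto simp: darcs_def)

lemma read_arcs_correct:
  assumes "inp s = length es # concat (map (\<lambda>(u, v). [u, v]) es) @ rest" "length es \<le> B"
  shows "wp B read_arcs (\<lambda>t. inp t = rest \<and> vars t vNA = length (darcs es) \<and>
    (\<forall>i < length (darcs es). arrs t aSrc i = Suc (fst (darcs es ! i)) \<and>
      arrs t aDst i = Suc (snd (darcs es ! i)))) s"
proof -
  let ?I = "\<lambda>k t. inp t = concat (map (\<lambda>(u, v). [u, v]) (drop k es)) @ rest \<and>
    vars t vNA = length (darcs es) \<and> vars t vI = length (darcs (take k es)) \<and>
    (\<forall>i < length (darcs (take k es)). arrs t aSrc i = Suc (fst (darcs (take k es) ! i)) \<and>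
      arrs t aDst i = Suc (snd (darcs (take k es) ! i)))"
  show ?thesis
    unfolding read_arcs_def wp_simps
  proof (rule wp_Loop[where I = ?I], goal_cases)
    case (3 k t)
    then have k: "k < length es" using assms by simp
    obtain u v where uv: "es ! k = (u, v)" by fastforce
    have "drop k es = (u, v) # drop (Suc k) es" using k uv by (metis Cons_nth_drop_Suc)
    moreover have "darcs (take (Suc k) es) = darcs (take k es) @ [(u, v), (v, u)]"
      using k uv by (simp add: take_Suc_conv_app_nth darcs_def)
    ultimately show ?case using 3 k by (auto simp: less_Suc_eq nth_append)
  qed (use assms in auto)
qed

lemma double_correct:
  assumes "vars s vN \<le> B"
  shows "wp B double (\<lambda>t. t = s\<lparr>vars := (vars s)(vW := 2 ^ vars s vN * vars s vW)\<rparr>) s"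
  unfolding double_def
proof (rule wp_Loop[where I = "\<lambda>k t. t = s\<lparr>vars := (vars s)(vW := 2 ^ k * vars s vW)\<rparr>"], goal_cases)
  case (3 k t)
  then show ?case by (simp add: mult_2 distrib_right)
qed (use assms in auto)

lemma read_rewards_correct:
  assumes "inp s = length rs # concat (map (\<lambda>(w, v). [w, 1, v, 0]) rs) @ rest" "length rs \<le> B"
    and "vars s vN = n" "n \<le> B" "vars s vTot = 0" "\<And>v. arrs s aReward v = 0"
  shows "wp B read_rewards (\<lambda>t. inp t = rest \<and> vars t vTot = (\<Sum>(w, v)\<leftarrow>rs. w) \<and>
    (\<forall>v. arrs t aReward (Suc v) = 2 ^ n * (\<Sum>(w, x)\<leftarrow>rs. if x = v then w else 0))) s"
proof -
  let ?I = "\<lambda>k t. inp t = concat (map (\<lambda>(w, v). [w, 1, v, 0]) (drop k rs)) @ rest \<and> vars t vN = n \<and>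
    vars t vTot = (\<Sum>(w, v)\<leftarrow>take k rs. w) \<and>
    (\<forall>v. arrs t aReward (Suc v) = 2 ^ n * (\<Sum>(w, x)\<leftarrow>take k rs. if x = v then w else 0))"
  show ?thesis
    unfolding read_rewards_def wp_simps
  proof (rule wp_Loop[where I = ?I], goal_cases)
    case (3 k t)
    then have k: "k < length rs" using assms by simp
    obtain w v where wv: "rs ! k = (w, v)" by fastforce
    have "drop k rs = (w, v) # drop (Suc k) rs" using k wv by (metis Cons_nth_drop_Suc)
    moreover have "take (Suc k) rs = take k rs @ [(w, v)]" using k wv by (simp add: take_Suc_conv_app_nth)
    ultimately show ?case
      unfolding wp_simps using 3 assms(4)
      by (intro wp_mono[OF double_correct]) (auto simp: algebra_simps)
  qed (use assms in auto)
qed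

text \<open>The newest penalty comes first, as it enters at slot 0. Penalties are numbered from 1,
  so that 0 can mark a free slot.\<close>

definition occurrences :: "nat list list \<Rightarrow> nat \<Rightarrow> nat list" where
  "occurrences Ms v = rev (filter (\<lambda>p. v \<in> set (Ms ! (p - 1))) [1..<Suc (length Ms)])"

definition nth0 :: "nat list \<Rightarrow> nat \<Rightarrow> nat" where
  "nth0 xs j = (if j < length xs then xs ! j else 0)"

lemma occurrences_Nil [simp]: "occurrences [] v = []"
  by (simp add: occurrences_def)

lemma occurrences_snoc:
  "occurrences (Ms @ [M]) v = (if v \<in> set M then Suc (length Ms) # occurrences Ms v else occurrences Ms v)"
proof -
  have "filter (\<lambda>p. v \<in> set ((Ms @ [M]) ! (p - 1))) [1..<Suc (length Ms)] =
      filter (\<lambda>p. v \<in> set (Ms ! (p - 1))) [1..<Suc (length Ms)]"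
    by (rule filter_cong) (auto simp: nth_append)
  then show ?thesis by (simp add: occurrences_def)
qed

lemma nth0_Cons [simp]: "nth0 (x # xs) j = (if j = 0 then x else nth0 xs (j - 1))"
  by (cases j) (auto simp: nth0_def)

lemma nth0_Nil [simp]: "nth0 [] j = 0"
  by (simp add: nth0_def)

text \<open>The range includes \<open>c\<close> because \<open>shift c\<close> moves contents up to
  that slot.\<close>

definition slots :: "nat \<Rightarrow> (var, arr) state \<Rightarrow> (nat \<Rightarrow> nat list) \<Rightarrow> bool" where
  "slots c s L \<longleftrightarrow> (\<forall>j \<le> c. arrs s (aPen j) 0 = 0 \<and> (\<forall>v. arrs s (aPen j) (Suc v) = nth0 (L v) j))"

lemma read_members_correct:
  assumes "inp s = length M # M @ rest" "length M \<le> B" "distinct M" "slots c s L"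
  shows "wp B (read_members c) (\<lambda>t. inp t = rest \<and>
    slots c t (\<lambda>v. if v \<in> set M then vars s vP # L v else L v)) s"
proof -
  let ?I = "\<lambda>k t. inp t = drop k M @ rest \<and> vars t vP = vars s vP \<and>
    slots c t (\<lambda>v. if v \<in> set (take k M) then vars s vP # L v else L v)"
  show ?thesis
    unfolding read_members_def wp_simps
  proof (rule wp_Loop[where I = ?I], goal_cases)
    case (3 k t)
    then have k: "k < length M" using assms by simp
    then have "drop k M = M ! k # drop (Suc k) M" by (simp add: Cons_nth_drop_Suc)
    moreover have t: "set (take (Suc k) M) = insert (M ! k) (set (take k M))"
      using k by (simp add: take_Suc_conv_app_nth)
    moreover have "M ! k \<notin> set (take k M)"
      using k assms(3) by (auto simp: in_set_conv_nth nth_eq_iff_index_eq)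
    ultimately show ?case
      unfolding wp_simps using 3
      by (intro wp_mono[OF shift_correct]) (auto simp: slots_def)
  qed (use assms in \<open>auto simp: slots_def\<close>)
qed

lemma skip_edges_correct:
  assumes "inp s = length es # concat (map (\<lambda>(u, v). [u, v]) es) @ rest" "length es \<le> B"
  shows "wp B skip_edges (\<lambda>t. inp t = rest) s"
proof -
  show ?thesis
    unfolding skip_edges_def wp_simps
  proof (rule wp_Loop[where I = "\<lambda>k t. inp t = concat (map (\<lambda>(u, v). [u, v]) (drop k es)) @ rest"],
      goal_cases)
    case (3 k t)
    then have k: "k < length es" using assms by simp
    obtain u v where "es ! k = (u, v)" by fastforce
    then have "drop k es = (u, v) # drop (Suc k) es" using k by (metis Cons_nth_drop_Suc)
    then show ?case using 3 by simp
  qed (use assms in auto)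
qed

lemma wvars_shift [simp]: "wvars (shift k) = {}"
  by (induction k) auto

lemma warrs_shift: "warrs (shift k) \<subseteq> range aPen"
  by (induction k) auto

lemma frame_penalty_body:
  "frame (read_members c) s t \<Longrightarrow> x \<notin> {vL, vX} \<Longrightarrow> vars t x = vars s x"
  "frame (read_members c) s t \<Longrightarrow> a \<notin> range aPen \<Longrightarrow> arrs t a = arrs s a"
  "frame skip_edges s t \<Longrightarrow> x \<notin> {vL, vX} \<Longrightarrow> vars t x = vars s x"
  "frame skip_edges s t \<Longrightarrow> arrs t a = arrs s a"
  using warrs_shift[of c] by (auto simp: frame_def read_members_def skip_edges_def)

definition penalty_code :: "nat \<times> nat list \<times> (nat \<times> nat) list \<Rightarrow> nat list" where
  "penalty_code = (\<lambda>(w, M, es). w # length M # M @ length es # concat (map (\<lambda>(u, v). [u, v]) es))"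

lemma read_penalties_correct:
  assumes "inp s = length ps # concat (map penalty_code ps) @ rest" "length ps \<le> B"
    and "\<And>w M es. (w, M, es) \<in> set ps \<Longrightarrow> distinct M \<and> length M \<le> B \<and> length es \<le> B"
    and "vars s vN = n" "n \<le> B" "vars s vP = 0" "arrs s aWeight 0 = 0" "slots c s (\<lambda>_. [])"
  shows "wp B (read_penalties c) (\<lambda>t. inp t = rest \<and> arrs t aWeight 0 = 0 \<and>
    (\<forall>i < length ps. arrs t aWeight (Suc i) = 2 ^ n * fst (ps ! i)) \<and>
    slots c t (occurrences (map (\<lambda>p. fst (snd p)) ps))) s"
proof -
  let ?I = "\<lambda>k t. inp t = concat (map penalty_code (drop k ps)) @ rest \<and> vars t vN = n \<and> vars t vP = k \<and>
    arrs t aWeight 0 = 0 \<and> (\<forall>i < k. arrs t aWeight (Suc i) = 2 ^ n * fst (ps ! i)) \<and>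
    slots c t (occurrences (map (\<lambda>p. fst (snd p)) (take k ps)))"
  show ?thesis
    unfolding read_penalties_def wp_simps
  proof (rule wp_Loop[where I = ?I], goal_cases)
    case (3 k t)
    then have k: "k < length ps" using assms by simp
    obtain w M es where p: "ps ! k = (w, M, es)" by (metis prod_cases3)
    have d: "drop k ps = (w, M, es) # drop (Suc k) ps" using k p by (metis Cons_nth_drop_Suc)
    have tk: "take (Suc k) ps = take k ps @ [(w, M, es)]" using k p by (simp add: take_Suc_conv_app_nth)
    have bounds: "distinct M" "length M \<le> B" "length es \<le> B"
      using assms(3)[of w M es] k p by (metis nth_mem)+
    let ?r = "concat (map penalty_code (drop (Suc k) ps)) @ rest"
    let ?e = "concat (map (\<lambda>(u, v). [u, v]) es)"
    have inp: "inp t = w # length M # M @ length es # ?e @ ?r"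
      using 3 d by (simp add: penalty_code_def)
    have v: "vars t vN = n" "vars t vP = k" using 3 by simp_all
    show ?case
      unfolding wp_simps
    proof (rule wp_mono[OF double_correct], goal_cases)
      case 1
      show ?case using 3 assms(5) by simp
    next
      case (2 t1)
      have t1: "inp t1 = length M # M @ length es # ?e @ ?r" "vars t1 vW = 2 ^ n * w"
        "vars t1 vP = Suc k" "vars t1 vN = n" "arrs t1 = arrs t"
        using 2 v inp by simp_all
      let ?t2 = "t1\<lparr>arrs := (arrs t1)(aWeight := (arrs t1 aWeight)(Suc k := 2 ^ n * w))\<rparr>"
      have "wp B (read_members c) (wp B skip_edges (?I (Suc k))) ?t2"
      proof (rule wp_frame[OF read_members_correct[where M = M and rest = "length es # ?e @ ?r"
            and L = "occurrences (map (\<lambda>p. fst (snd p)) (take k ps))"]], goal_cases)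
        case 4
        show ?case using 3 t1 by (auto simp: slots_def)
      next
        case (5 t3)
        show ?case
        proof (rule wp_frame[OF skip_edges_correct[where es = es and rest = ?r]], goal_cases)
          case (3 t4)
          have "slots c t3 (occurrences (map (\<lambda>p. fst (snd p)) (take (Suc k) ps)))"
            using 5(1) k t1(3) by (simp add: tk occurrences_snoc slots_def)
          moreover have "arrs t4 = arrs t3" using frame_penalty_body(4)[OF 3(2)] by blast
          moreover have "arrs t3 aWeight = (arrs t aWeight)(Suc k := 2 ^ n * w)"
            using frame_penalty_body(2)[OF 5(2), of aWeight] t1(5) by auto
          moreover have "vars t4 vN = n" "vars t4 vP = Suc k"
            using frame_penalty_body(1)[OF 5(2)] frame_penalty_body(3)[OF 3(2)] t1 by auto
          moreover have "arrs t aWeight 0 = 0"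
            "\<forall>i < k. arrs t aWeight (Suc i) = 2 ^ n * fst (ps ! i)"
            using \<open>?I k t\<close> by auto
          ultimately show ?case
            using 3(1) p by (auto simp: slots_def less_Suc_eq)
        qed (use 5 bounds in auto)
      qed (use t1 bounds in auto)
      then show ?case using t1 by simp
    qed
  next
    case 1
    then show ?case using assms by simp
  next
    case 2
    have "slots c (s\<lparr>vars := (vars s)(vK := length ps), inp := concat (map penalty_code ps) @ rest\<rparr>)
        (occurrences [])"
      using assms(8) by (simp add: slots_def)
    then show ?case using assms by simp
  next
    case (4 t)
    then show ?case using assms by simp
  qed
qed

section \<open>Search for a parents-first order\<close>

definition seen :: "(var, arr) state \<Rightarrow> nat set" where
  "seen t = arrs t aOrd ` {..<vars t vCnt}"

text \<open>The order found so far, not an order relation: a tree rooted at \<open>r0\<close> on the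
  seen vertices, in which every parent is listed before its children.\<close>

definition partial_order :: "nat set \<Rightarrow> nat \<Rightarrow> (nat \<times> nat) set \<Rightarrow> (var, arr) state \<Rightarrow> bool" where
  "partial_order V r0 E t \<longleftrightarrow> 0 < vars t vCnt \<and> arrs t aOrd 0 = r0 \<and> arrs t aPar r0 = 0 \<and>
     inj_on (arrs t aOrd) {..<vars t vCnt} \<and> seen t \<subseteq> V \<and>
     (\<forall>v. arrs t aSeen v = (if v \<in> seen t then 1 else 0)) \<and>
     (\<forall>i. 0 < i \<longrightarrow> i < vars t vCnt \<longrightarrow> (arrs t aPar (arrs t aOrd i), arrs t aOrd i) \<in> E \<and>
       arrs t aPar (arrs t aOrd i) \<in> arrs t aOrd ` {..<i})"

lemma partial_order_extend:
  assumes t: "partial_order V r0 E t" and u: "u \<in> seen t" and v: "v \<notin> seen t" "v \<in> V" and uv: "(u, v) \<in> E"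
    and t': "arrs t' aSeen = (arrs t aSeen)(v := 1)" "arrs t' aPar = (arrs t aPar)(v := u)"
      "arrs t' aOrd = (arrs t aOrd)(vars t vCnt := v)" "vars t' vCnt = Suc (vars t vCnt)"
  shows "partial_order V r0 E t' \<and> seen t' = insert v (seen t)"
proof -
  let ?n = "vars t vCnt"
  have old: "arrs t' aOrd i = arrs t aOrd i" "arrs t' aPar (arrs t aOrd i) = arrs t aPar (arrs t aOrd i)"
    if "i < ?n" for i
    using that t' v(1) by (auto simp: seen_def)
  have img: "arrs t' aOrd ` {..<i} = arrs t aOrd ` {..<i}" if "i \<le> ?n" for i
    using old that by (auto intro!: image_cong)
  have seen: "seen t' = insert v (seen t)"
    using img[of ?n] t' by (auto simp: seen_def lessThan_Suc)
  have r0: "r0 \<in> seen t" "r0 \<noteq> v" using t v(1) by (auto simp: partial_order_def seen_def)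
  have inj: "inj_on (arrs t' aOrd) {..<Suc ?n}"
    using t v(1) img[of ?n] t' old
    by (auto simp: lessThan_Suc partial_order_def seen_def inj_on_def)
  have "(arrs t' aPar (arrs t' aOrd i), arrs t' aOrd i) \<in> E \<and>
      arrs t' aPar (arrs t' aOrd i) \<in> arrs t' aOrd ` {..<i}" if "0 < i" "i < Suc ?n" for i
  proof (cases "i = ?n")
    case True
    then show ?thesis using img[of i] t' u uv by (simp add: seen_def)
  next
    case False
    then have "i < ?n" using that by simp
    then show ?thesis using t old[of i] img[of i] that(1) by (simp add: partial_order_def)
  qed
  then show ?thesis
    using t seen r0 inj t' v(2) old[of 0] by (auto simp: partial_order_def)
qed

definition arc_arrays :: "(nat \<times> nat) list \<Rightarrow> (var, arr) state \<Rightarrow> bool" where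
  "arc_arrays as s \<longleftrightarrow> vars s vNA = length as \<and>
     (\<forall>i < length as. arrs s aSrc i = fst (as ! i) \<and> arrs s aDst i = snd (as ! i))"

lemma visit_arc_correct:
  assumes t: "partial_order V r0 (set as) t" and a: "arc_arrays as t" and i: "vars t vI < length as"
    and as: "set as \<subseteq> V \<times> V" and B: "1 \<le> B"
  shows "wp B visit_arc (\<lambda>t'. partial_order V r0 (set as) t' \<and> arc_arrays as t' \<and>
    vars t' vI = Suc (vars t vI) \<and> seen t \<subseteq> seen t' \<and>
    (fst (as ! vars t vI) \<in> seen t \<longrightarrow> snd (as ! vars t vI) \<in> seen t')) t"
proof -
  obtain u v where uv: "as ! vars t vI = (u, v)" by fastforce
  then have mem: "(u, v) \<in> set as" using i by (metis nth_mem)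
  have src: "arrs t aSrc (vars t vI) = u" "arrs t aDst (vars t vI) = v"
    using a i uv by (auto simp: arc_arrays_def)
  let ?t1 = "t\<lparr>vars := (vars t)(vU := u, vV := v)\<rparr>"
  have t1: "partial_order V r0 (set as) ?t1" "seen ?t1 = seen t" "arc_arrays as ?t1"
    using t a by (auto simp: partial_order_def seen_def arc_arrays_def)
  have seen: "arrs t aSeen x = (if x \<in> seen t then 1 else 0)" for x
    using t by (simp add: partial_order_def)
  have step: "partial_order V r0 E (t'\<lparr>vars := (vars t')(vI := y)\<rparr>) = partial_order V r0 E t'"
    "seen (t'\<lparr>vars := (vars t')(vI := y)\<rparr>) = seen t'"
    "arc_arrays as (t'\<lparr>vars := (vars t')(vI := y)\<rparr>) = arc_arrays as t'" for E t' y
    by (auto simp: partial_order_def seen_def arc_arrays_def)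
  let ?P = "\<lambda>t'. partial_order V r0 (set as) t' \<and> arc_arrays as t' \<and>
    vars t' vI = vars t vI \<and> seen t \<subseteq> seen t' \<and> (u \<in> seen t \<longrightarrow> v \<in> seen t')"
  let ?c = "Put aSeen (Var vV) (Lit 1) ;; Put aPar (Var vV) (Var vU) ;; Put aOrd (Var vCnt) (Var vV) ;;
        Inc vCnt"
  have "wp B (Loop (Minus (Arr aSeen (Var vU)) (Arr aSeen (Var vV))) ?c) ?P ?t1"
  proof (rule wp_If[OF _ B], goal_cases)
    case 2
    then have *: "u \<in> seen t" "v \<notin> seen t" by (auto simp: seen split: if_splits)
    let ?t2 = "run ?c ?t1"
    have "partial_order V r0 (set as) ?t2 \<and> seen ?t2 = insert v (seen ?t1)"
      by (rule partial_order_extend[OF t1(1) _ _ _ mem]) (use * mem as t1 in auto)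
    then have "?P ?t2" using a t1 by (auto simp: arc_arrays_def)
    then show ?case by (simp add: wp_def)
  next
    case 3
    then have "u \<in> seen t \<longrightarrow> v \<in> seen t" by (auto simp: seen split: if_splits)
    then show ?case using t1 by simp
  qed (simp add: seen)
  then show ?thesis
    unfolding visit_arc_def wp_simps uv
    by (elim wp_mono[of _ _ ?P, THEN back_subst[of "\<lambda>x. x"]]) (auto simp: step src)
qed

lemma find_order_correct:
  assumes a: "arc_arrays as s" "length as \<le> B" "1 \<le> B" and as: "set as \<subseteq> V \<times> V"
    and zero: "\<And>v. arrs s aSeen v = 0" "\<And>v. arrs s aPar v = 0"
    and r0: "arrs s aVert 0 = r0" "r0 \<in> V"
    and reach: "\<And>v. v \<in> V \<Longrightarrow> \<exists>l \<le> length as. (r0, v) \<in> set as ^^ l"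
  shows "wp B find_order (\<lambda>t. partial_order V r0 (set as) t \<and> seen t = V) s"
proof -
  \<comment> \<open>Progress is measured by walk length: a pass examines every arc, so it extends
    the reach of the root by at least one step.\<close>
  let ?J = "\<lambda>k t. partial_order V r0 (set as) t \<and> arc_arrays as t \<and>
    (\<forall>v. \<forall>l \<le> k. (r0, v) \<in> set as ^^ l \<longrightarrow> v \<in> seen t)"
  show ?thesis
    unfolding find_order_def wp_simps
  proof (rule wp_Loop[where I = ?J], goal_cases)
    case 1
    then show ?case using a by (simp add: arc_arrays_def)
  next
    case 2
    then show ?case
      using a zero r0 by (auto simp: arc_arrays_def partial_order_def seen_def lessThan_Suc)
  next
    case (3 k t)
    \<comment> \<open>Tails refer to the set seen at the start of the pass. Vertices found during
      the pass may have had their arcs examined already, so nothing is claimed for them.\<close>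
    let ?I = "\<lambda>i t'. partial_order V r0 (set as) t' \<and> arc_arrays as t' \<and> vars t' vI = i \<and>
      seen t \<subseteq> seen t' \<and> (\<forall>j < i. fst (as ! j) \<in> seen t \<longrightarrow> snd (as ! j) \<in> seen t')"
    show ?case
      unfolding wp_simps
    proof (rule wp_Loop[where I = ?I], goal_cases)
      case 1
      then show ?case using 3 a by (simp add: arc_arrays_def)
    next
      case 2
      then show ?case using 3 by (auto simp: arc_arrays_def partial_order_def seen_def)
    next
      case (3 i t')
      then have "vars t' vI < length as" using \<open>?J k t\<close> by (simp add: arc_arrays_def)
      with 3 show ?case
        by (intro wp_mono[OF visit_arc_correct[OF _ _ _ as a(3)]]) (auto simp: less_Suc_eq)
    next
      case (4 t')
      have J: "?J k t" using 3 by simp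
      have "v \<in> seen t'" if l: "(r0, v) \<in> set as ^^ l" "l \<le> Suc k" for v l
      proof (cases "l = Suc k")
        case True
        then obtain u where "(r0, u) \<in> set as ^^ k" "(u, v) \<in> set as"
          using relpow_Suc_E[OF l(1)[unfolded True]] by metis
        then have "u \<in> seen t" "(u, v) \<in> set as" using J by auto
        then obtain j where j: "j < length as" "as ! j = (u, v)" by (auto simp: in_set_conv_nth)
        then have "j < val (Var vNA) (t\<lparr>vars := (vars t)(vI := val (Lit 0) t)\<rparr>)"
          using J by (simp add: arc_arrays_def)
        then have "fst (as ! j) \<in> seen t \<longrightarrow> snd (as ! j) \<in> seen t'" using 4 by blast
        then show ?thesis using j \<open>u \<in> seen t\<close> by simp
      next
        case False
        then have "l \<le> k" using l(2) by simp
        then have "v \<in> seen t" using J l(1) by blast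
        then show ?thesis using 4 by auto
      qed
      then show ?case using 4 by simp
    qed
  next
    case (4 t)
    then have "v \<in> seen t" if "v \<in> V" for v
      using reach[OF that] a by (auto simp: arc_arrays_def)
    then show ?case using 4 by (auto simp: partial_order_def)
  qed
qed


subsection \<open>Tables and decoding\<close>

lemma val_cong:
  "(\<And>x. x \<in> set1_expr e \<Longrightarrow> vars s x = vars t x) \<Longrightarrow> arrs s = arrs t \<Longrightarrow> val e s = val e t"
  by (induction e) auto

lemma set1_expr_combinations:
  "set1_expr (esum es) = (\<Union>e \<in> set es. set1_expr e)"
  "set1_expr (econj es) = (\<Union>e \<in> set es. set1_expr e)"
  "set1_expr (foldr emin es e) = (\<Union>e \<in> insert e (set es). set1_expr e)"
  by (induction es) (auto simp: esum_def econj_def emin_def)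

text \<open>Hence assigning the variables \<open>vNew\<close> does not disturb the merge expressions
  evaluated after them.\<close>

lemma vars_merge_expr: "set1_expr (merge_expr c A) \<subseteq> {vU, vV}"
proof -
  have neq: "set1_expr (pen_neq i j) \<subseteq> {vU, vV}" for i j by (auto simp: pen_neq_def Let_def)
  have "x = vU \<or> x = vV" if "x \<in> set1_expr (conflict_expr c A B D)" for x B D
    using that by (auto simp: conflict_expr_def set1_expr_combinations dest!: subsetD[OF neq])
  moreover have "x = vU \<or> x = vV" if "x \<in> set1_expr (dropped_expr c D)" for x D
    using that
    by (auto simp: dropped_expr_def set1_expr_combinations dest!: subsetD[OF neq] split: if_splits)
  ultimately show ?thesis
    by (fastforce simp: merge_expr_def Let_def set1_expr_combinations pair_expr_def)
qed

context tree_program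
begin

text \<open>The loop never writes at index 0. The artificial parent needs a table of zeros, which
  the initial memory already provides.\<close>

lemma init_tables_correct:
  assumes "vars s vN = n" "n \<le> B" and verts: "arrs s aVert ` {..<n} = V"
    and pens: "\<And>j v. j < c \<Longrightarrow> arrs s (aPen j) v = pen j v"
    and r: "\<And>v. v \<in> V \<Longrightarrow> arrs s aReward v = r v" and bw: "\<And>v. v \<in> V \<Longrightarrow> arrs s aBit v = bw v"
    and tab: "\<And>A. arrs s (aTab A) 0 = 0"
  shows "wp B (init_tables c) (\<lambda>t. tables n (\<lambda>A. arrs t (aTab A))) s"
proof -
  define T :: "nat \<Rightarrow> nat \<Rightarrow> nat" where "T A v = (if \<forall>j<c. bit A j \<or> pen j v = 0 then min (r v) (bw v) else r v)" for A v
  let ?I = "\<lambda>k t. vars t vI = k \<and> (\<forall>a. (\<forall>j. a \<noteq> aTab j) \<longrightarrow> arrs t a = arrs s a) \<and>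
    (\<forall>A. arrs t (aTab A) 0 = 0) \<and> (\<forall>A < 2 ^ c. \<forall>i < k. arrs t (aTab A) (arrs s aVert i) = T A (arrs s aVert i))"
  show ?thesis
    unfolding init_tables_def wp_simps
  proof (rule wp_Loop[where I = ?I], goal_cases)
    case (3 k t)
    then have k: "k < n" using assms by simp
    define v where "v = arrs s aVert k"
    have v: "v \<in> V" "v \<noteq> 0" using k verts zero unfolding v_def by (auto intro!: gr0I)
    have arr: "arrs t a = arrs s a" if "\<And>j. a \<noteq> aTab j" for a using 3 that by blast
    show ?case
      unfolding wp_simps
    proof (rule wp_put_tables[where f = "\<lambda>A. T A v"], goal_cases)
      case (1 A t')
      have "arrs t' a = arrs s a" if "\<And>j. a \<noteq> aTab j" for a using 1(3)[of a] arr[of a] that by simp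
      moreover have "vars t' vV = v" using 1(2) 3 arr[of aVert] by (simp add: v_def)
      ultimately show ?case using pens r v bw by (auto simp: val_leaf_expr T_def)
    next
      case (2 t')
      have "arrs t' a = arrs s a" if "\<And>j. a \<noteq> aTab j" for a using 2(4)[of a] arr[of a] that by simp
      moreover have "arrs t' (aTab A) = (if A < 2 ^ c then (arrs t (aTab A))(v := T A v) else arrs t (aTab A))" for A
        using 2(5)[of A] 3 arr[of aVert] by (simp add: v_def)
      moreover have "vars t' vI = k" using 2(1) 3 by simp
      ultimately show ?case using 3 v by (auto simp: less_Suc_eq v_def)
    qed
  next
    case (4 t)
    show ?case
    proof (rule tables_initial)
      fix A :: nat assume A: "A < 2 ^ c"
      show "arrs t (aTab A) 0 = 0" using 4 by blast
      fix v assume "v \<in> V"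
      then obtain i where "i < n" "v = arrs s aVert i" using verts by auto
      then show "arrs t (aTab A) v = (if \<forall>j<c. bit A j \<or> pen j v = 0 then min (r v) (bw v) else r v)"
        using 4 A assms(1) by (auto simp: T_def)
    qed
  qed (use assms in auto)
qed

lemma merge_all_correct:
  assumes "vars s vN = n" "n \<le> B"
    and pens: "\<And>j v. j < c \<Longrightarrow> arrs s (aPen j) v = pen j v" and wt: "arrs s aWeight = wt"
    and ords: "\<And>i. i < n \<Longrightarrow> arrs s aOrd i = ord i \<and> arrs s aPar (ord i) = par (ord i)"
    and tab: "tables n (\<lambda>A. arrs s (aTab A))"
  shows "wp B (merge_all c) (\<lambda>t. tables 0 (\<lambda>A. arrs t (aTab A))) s"
proof -
  let ?I = "\<lambda>k t. vars t vI = n - k \<and> (\<forall>a. (\<forall>j. a \<noteq> aTab j) \<longrightarrow> arrs t a = arrs s a) \<and>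
    tables (n - k) (\<lambda>A. arrs t (aTab A))"
  show ?thesis
    unfolding merge_all_def wp_simps
  proof (rule wp_Loop[where I = ?I], goal_cases)
    case (3 k t)
    then have k: "k < n" using assms by simp
    define i where "i = n - Suc k"
    have i: "i < n" "n - k = Suc i" "vars t vI - 1 = i" using k 3 by (auto simp: i_def)
    define v where "v = ord i"
    define u where "u = par v"
    have arr: "arrs t a = arrs s a" if "\<And>j. a \<noteq> aTab j" for a using 3 that by blast
    define t1 where "t1 = t\<lparr>vars := (vars t)(vI := i, vV := v, vU := u)\<rparr>"
    have pens1: "arrs t1 (aPen j) v = pen j v" if "j < c" for j v
      using pens[OF that] arr[of "aPen j"] by (simp add: t1_def)
    have wt1: "arrs t1 aWeight = wt" using wt arr[of aWeight] by (simp add: t1_def)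
    define h where "h A = val (merge_expr c A) t1" for A
    have h: "is_merge u v (\<lambda>A. arrs t (aTab A) u) (\<lambda>A. arrs t (aTab A) v) h"
    proof -
      have "h = (\<lambda>A. val (merge_expr c A) t1)" by (simp add: fun_eq_iff h_def)
      then show ?thesis using is_merge_expr[of t1, OF pens1 wt1] by (simp add: t1_def)
    qed
    have val_h: "val (merge_expr c A) t' = h A"
      if "arrs t' = arrs t1" "\<And>x. (\<And>j. x \<noteq> vNew j) \<Longrightarrow> vars t' x = vars t1 x" for A t'
    proof -
      have "vars t' x = vars t1 x" if "x \<in> {vU, vV}" for x using that \<open>\<And>x. (\<And>j. x \<noteq> vNew j) \<Longrightarrow> _ x\<close> by auto
      then show ?thesis
        unfolding h_def using vars_merge_expr[of c A] that(1) by (intro val_cong) auto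
    qed
    have "wp B (seqs (map (\<lambda>A. Assign (vNew A) (merge_expr c A)) [0..<2 ^ c]))
      (wp B (seqs (map (\<lambda>A. Put (aTab A) (Var vU) (Var (vNew A))) [0..<2 ^ c])) (?I (Suc k))) t1"
    proof (rule wp_assign_new[where f = h], goal_cases)
      case (1 A t')
      show ?case by (rule val_h[OF 1(2,3)])
    next
      case (2 t')
      note t' = 2
      show ?case
      proof (rule wp_put_tables[where f = h], goal_cases)
        case (1 A t'')
        then show ?case using t' by simp
      next
        case (2 t'')
        have "arrs t'' a = arrs s a" if "\<And>j. a \<noteq> aTab j" for a
          using 2(4)[of a] t'(1) arr[of a] that by (simp add: t1_def)
        moreover have "vars t'' vI = i" using 2(1) t'(4)[of vI] by (simp add: t1_def)
        moreover have tabs: "arrs t'' (aTab A) = (if A < 2 ^ c then (arrs t (aTab A))(u := h A) else arrs t (aTab A))" for A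
          using 2(5)[of A] t'(1) t'(4)[of vU] by (simp add: t1_def)
        moreover have "tables i (\<lambda>A. arrs t'' (aTab A))"
        proof (rule tables_merge[OF _ i(1) v_def u_def])
          show "tables (Suc i) (\<lambda>A. arrs t (aTab A))" using 3 i(2) by simp
          show "is_merge u v (\<lambda>A. arrs t (aTab A) u) (\<lambda>A. arrs t (aTab A) v) (\<lambda>A. arrs t'' (aTab A) u)"
            using h by (simp add: is_merge_def tabs)
          show "arrs t'' (aTab A) x = arrs t (aTab A) x" if "x \<noteq> u" for A x
            using that by (simp add: tabs)
        qed
        ultimately show ?case by (simp add: i_def)
      qed
    qed
    moreover have "arrs t aOrd i = v" "arrs t aPar v = u"
      using ords[OF i(1)] arr[of aOrd] arr[of aPar] by (auto simp: v_def u_def)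
    ultimately show ?case using i(3) by (simp add: merge_child_def t1_def)
  qed (use assms in auto)
qed

end

section \<open>Reading the selection off the minimum\<close>

definition chosen_bits :: "(nat \<Rightarrow> bool) \<Rightarrow> nat \<Rightarrow> nat" where
  "chosen_bits f n = (\<Sum>i<n. if f i then 2 ^ i else 0)"

lemma chosen_bits_0 [simp]: "chosen_bits f 0 = 0"
  by (simp add: chosen_bits_def)

lemma chosen_bits_Suc [simp]: "chosen_bits f (Suc n) = chosen_bits f n + (if f n then 2 ^ n else 0)"
  by (simp add: chosen_bits_def)

lemma chosen_bits_less: "chosen_bits f n < 2 ^ n"
  by (induction n) auto

lemma decode_correct:
  assumes n: "vars s vN = n" "n \<le> B" "vars s vScale = 2 ^ n" and tot: "k \<le> vars s vTot" "vars s vTot \<le> B"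
    and B: "1 \<le> B"
    and verts: "\<And>i. i < n \<Longrightarrow> arrs s aVert i = Suc (vs ! i) \<and> arrs s aBit (Suc (vs ! i)) = 2 ^ i"
    and vs: "distinct vs" "length vs = n" and out: "outp s = []"
    and F: "arrs s (aTab 0) 0 = 2 ^ n * k + chosen_bits f n"
  shows "wp B decode (\<lambda>t. distinct (outp t) \<and> set (outp t) = {vs ! i | i. i < n \<and> f i}) s"
proof -
  let ?fix = "\<lambda>t. vars t vN = n \<and> vars t vScale = 2 ^ n \<and> arrs t = arrs s"
  \<comment> \<open>The cost part \<open>k - j\<close> is truncated: it stays 0 once
    \<open>j\<close> passes \<open>k\<close>, up to the full count \<open>vTot\<close>.\<close>
  let ?I = "\<lambda>j t. ?fix t \<and> outp t = [] \<and> vars t vF = 2 ^ n * (k - j) + chosen_bits f n"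
  let ?J = "\<lambda>j t. ?fix t \<and> vars t vI = n - j \<and> vars t vF = chosen_bits f (n - j) \<and> distinct (outp t)
    \<and> set (outp t) = {vs ! i | i. n - j \<le> i \<and> i < n \<and> f i}"
  show ?thesis
    unfolding decode_def wp_simps
  proof (rule wp_Loop[where I = ?I], goal_cases)
    case (3 j t)
    show ?case
    proof (cases "j < k")
      case True
      then have "2 ^ n * (k - j) = 2 ^ n * (k - Suc j) + 2 ^ n"
        by (metis Suc_diff_Suc mult_Suc_right add.commute)
      then show ?thesis using 3 by simp
    next
      case False
      then show ?thesis using 3 chosen_bits_less[of f n] by simp
    qed
  next
    case (4 t)
    then have F: "vars t vF = chosen_bits f n" using tot by simp
    show ?case
    proof (rule wp_Loop[where I = ?J], goal_cases)
      case (3 j t)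
      then have j: "j < n" using \<open>?I _ _\<close> by simp
      define i where "i = n - Suc j"
      have i: "i < n" "n - j = Suc i" "vars t vI - 1 = i" using j 3 by (auto simp: i_def)
      let ?t = "t\<lparr>vars := (vars t)(vI := i, vX := Suc (vs ! i))\<rparr>"
      have vert: "arrs t aVert i = Suc (vs ! i)" "arrs t aBit (Suc (vs ! i)) = 2 ^ i"
        using 3 verts[OF i(1)] by auto
      have F: "vars t vF = chosen_bits f i + (if f i then 2 ^ i else 0)" using 3 i(2) by simp
      have range: "{vs ! l | l. i \<le> l \<and> l < n \<and> f l} =
          (if f i then insert (vs ! i) else id) {vs ! l | l. Suc i \<le> l \<and> l < n \<and> f l}"
        using i(1) by (auto simp: Suc_le_eq le_eq_less_or_eq)
      have new: "vs ! i \<notin> set (outp t)"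
        using 3 i vs by (auto simp: nth_eq_iff_index_eq)
      have "wp B (Loop (Cond (Minus (Arr aBit (Var vX)) (Var vF)) (Lit 0) (Lit 1))
         (Emit (Minus (Var vX) (Lit 1)) ;; Assign vF (Minus (Var vF) (Arr aBit (Var vX))))) (?J (Suc j)) ?t"
      proof (rule wp_If[OF _ B], goal_cases)
        case 2
        \<comment> \<open>The bits below \<open>i\<close> sum to less than \<open>2 ^ i\<close>, so
          \<open>vF\<close> reaches \<open>2 ^ i\<close> only if bit \<open>i\<close> is
          set.\<close>
        then have "f i" using vert F chosen_bits_less[of f i] by (auto split: if_splits)
        then show ?case using 3 F vert new range i by (auto simp: i_def[symmetric])
      next
        case 3
        then have "\<not> f i" using vert F chosen_bits_less[of f i] by (auto split: if_splits)
        then show ?case using \<open>?J j t\<close> F vert range i by (auto simp: i_def[symmetric])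
      qed simp
      then show ?case using i(3) vert by simp
    qed (use 4 F n in auto)
  qed (use assms in auto)
qed


section \<open>Correctness\<close>

lemma list_all2_decode:
  assumes "list_all2 R Hs cs" "\<And>H c. H \<in> set Hs \<Longrightarrow> R H c \<Longrightarrow> \<exists>d. Q H d \<and> c = f d"
  shows "\<exists>ds. list_all2 Q Hs ds \<and> cs = map f ds"
  using assms
proof (induction rule: list_all2_induct)
  case (Cons H Hs c cs)
  then obtain ds d where "list_all2 Q Hs ds" "cs = map f ds" "Q H d" "c = f d" by force
  then show ?case by (intro exI[of _ "d # ds"]) simp
qed simp

lemma bit_size_ge_length: "length xs \<le> bit_size xs"
  unfolding bit_size_def by (induction xs) auto

lemma relpow_map_prod_Suc:
  "(x, y) \<in> R ^^ k \<Longrightarrow> (Suc x, Suc y) \<in> (map_prod Suc Suc ` R) ^^ k"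
proof (induction k arbitrary: y)
  case (Suc k)
  then obtain z where "(x, z) \<in> R ^^ k" "(z, y) \<in> R" by (metis relpow_Suc_E)
  then show ?case using Suc.IH by (intro relpow_Suc_I) (auto intro: rev_image_eqI)
qed simp

lemma sum_sum_list_if_eq:
  assumes "finite A"
  shows "(\<Sum>v\<in>A. \<Sum>(w, x)\<leftarrow>rs. if x = v then w else (0::nat)) = (\<Sum>(w, x)\<leftarrow>rs. if x \<in> A then w else 0)"
  using assms by (induction rs) (auto simp: sum.distrib)

definition reward_match :: "nat sgsp \<Rightarrow> nat pair_pre_digraph \<Rightarrow> nat \<times> nat \<Rightarrow> bool" where
  "reward_match I H d \<longleftrightarrow> weight I H = real (fst d) \<and> pverts H = {snd d}"

definition penalty_match ::
    "nat sgsp \<Rightarrow> nat pair_pre_digraph \<Rightarrow> nat \<times> nat list \<times> (nat \<times> nat) list \<Rightarrow> bool" where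
  "penalty_match I H d \<longleftrightarrow> weight I H = real (fst d) \<and> pverts H = set (fst (snd d)) \<and> distinct (fst (snd d))"

definition selection_cost ::
    "(nat \<times> nat) list \<Rightarrow> (nat \<times> nat list \<times> (nat \<times> nat) list) list \<Rightarrow> nat set \<Rightarrow> nat" where
  "selection_cost rs ps S = (\<Sum>(w, v)\<leftarrow>rs. if v \<in> S then 0 else w)
     + (\<Sum>(w, M, es)\<leftarrow>ps. if set M \<subseteq> S then w else 0)"

lemma sum_list_matched:
  assumes "list_all2 R Hs ds" "\<And>H d. R H d \<Longrightarrow> f H = real (g d)"
  shows "(\<Sum>H\<leftarrow>Hs. f H) = real (\<Sum>d\<leftarrow>ds. g d)"
  using assms by (induction rule: list_all2_induct) auto

text \<open>Each reward is either collected or missed, so value and cost add up to a constant that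
  does not depend on \<open>S\<close>; minimal cost is maximal value.\<close>

lemma sgsp_value_selection_cost:
  assumes R: "list_all2 (reward_match I) Rs rs" "distinct Rs" "set Rs = rewards I"
    and P: "list_all2 (penalty_match I) Ps ps" "distinct Ps" "set Ps = penalties I"
  shows "sgsp_value I S + real (selection_cost rs ps S) = real (\<Sum>(w, v)\<leftarrow>rs. w)"
proof -
  have "(\<Sum>R \<in> {R \<in> rewards I. pverts R \<inter> S \<noteq> {}}. weight I R) =
      (\<Sum>R\<leftarrow>Rs. if pverts R \<inter> S \<noteq> {} then weight I R else 0)"
    unfolding R(3)[symmetric]
    by (subst sum.inter_filter) (simp_all add: sum.distinct_set_conv_list[OF R(2)])
  also have "\<dots> = real (\<Sum>d\<leftarrow>rs. case d of (w, v) \<Rightarrow> if v \<in> S then w else 0)"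
    by (rule sum_list_matched[OF R(1)]) (auto simp: reward_match_def)
  finally have r: "(\<Sum>R \<in> {R \<in> rewards I. pverts R \<inter> S \<noteq> {}}. weight I R) =
      real (\<Sum>(w, v)\<leftarrow>rs. if v \<in> S then w else 0)" .
  have "(\<Sum>P \<in> {P \<in> penalties I. pverts P \<subseteq> S}. weight I P) =
      (\<Sum>P\<leftarrow>Ps. if pverts P \<subseteq> S then weight I P else 0)"
    unfolding P(3)[symmetric]
    by (subst sum.inter_filter) (simp_all add: sum.distinct_set_conv_list[OF P(2)])
  also have "\<dots> = real (\<Sum>d\<leftarrow>ps. case d of (w, M, es) \<Rightarrow> if set M \<subseteq> S then w else 0)"
    by (rule sum_list_matched[OF P(1)]) (auto simp: penalty_match_def split: if_splits)
  finally have p: "(\<Sum>P \<in> {P \<in> penalties I. pverts P \<subseteq> S}. weight I P) =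
      real (\<Sum>(w, M, es)\<leftarrow>ps. if set M \<subseteq> S then w else 0)" .
  have "(\<Sum>(w, v)\<leftarrow>rs. if v \<in> S then w else 0) + (\<Sum>(w, v)\<leftarrow>rs. if v \<in> S then 0 else w) =
      (\<Sum>(w, v)\<leftarrow>rs. w)"
    by (induction rs) auto
  then show ?thesis
    unfolding sgsp_value_def r p selection_cost_def by (simp flip: of_nat_add)
qed

lemma set_occurrences: "set (occurrences Ms v) = {p \<in> {1..length Ms}. v \<in> set (Ms ! (p - 1))}"
  by (auto simp: occurrences_def)

lemma distinct_occurrences: "distinct (occurrences Ms v)"
  by (simp add: occurrences_def)

text \<open>Penalties are listed without repetition, so different indices name different subgraphs.
  Together with the frequency bound, this leaves enough slots for all penalties of a vertex.\<close>

lemma length_occurrences_le_frequency: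
  assumes P: "list_all2 (penalty_match I) Ps ps" "distinct Ps" "set Ps = penalties I"
  shows "length (occurrences (map (\<lambda>p. fst (snd p)) ps) v) \<le> frequency I v"
proof -
  let ?L = "occurrences (map (\<lambda>p. fst (snd p)) ps) v"
  have len: "length Ps = length ps" using P(1) by (simp add: list_all2_lengthD)
  have "length ?L = card (set ?L)" by (simp add: distinct_card distinct_occurrences)
  also have "\<dots> = card ((\<lambda>p. Ps ! (p - 1)) ` set ?L)"
    using P(2) len by (intro card_image[symmetric] inj_onI)
      (auto simp: set_occurrences nth_eq_iff_index_eq)
  also have "\<dots> \<le> card {P \<in> penalties I. v \<in> pverts P}"
  proof (rule card_mono)
    show "finite {P \<in> penalties I. v \<in> pverts P}" unfolding P(3)[symmetric] by simp
    show "(\<lambda>p. Ps ! (p - 1)) ` set ?L \<subseteq> {P \<in> penalties I. v \<in> pverts P}"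
    proof (intro image_subsetI CollectI conjI)
      fix p assume "p \<in> set ?L"
      then have p: "p - 1 < length ps" "v \<in> set (fst (snd (ps ! (p - 1))))"
        by (auto simp: set_occurrences)
      then show "Ps ! (p - 1) \<in> penalties I" using len P(3) by (metis nth_mem)
      show "v \<in> pverts (Ps ! (p - 1))"
        using p list_all2_nthD2[OF P(1), of "p - 1"] by (simp add: penalty_match_def)
    qed
  qed
  finally show ?thesis by (simp add: frequency_def)
qed

section \<open>Effects of the phases of the solver\<close>

lemma write_sets [simp]:
  "wvars double = {vW}" "warrs double = {}"
  "wvars read_verts = {vN, vScale, vX, vI}" "warrs read_verts = {aVert, aBit}"
  "wvars read_arcs = {vK, vNA, vI, vX, vY}" "warrs read_arcs = {aSrc, aDst}"
  "wvars read_rewards = {vK, vW, vTot, vX}" "warrs read_rewards = {aReward}"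
  "wvars (read_penalties c) = {vK, vP, vW, vL, vX}"
  "wvars find_order = {vCnt, vI, vU, vV}" "warrs find_order = {aSeen, aOrd, aPar}"
  "wvars (init_tables c) = {vI, vV}"
  by (auto simp: double_def read_verts_def read_arcs_def read_rewards_def read_penalties_def
      read_members_def skip_edges_def find_order_def visit_arc_def init_tables_def)

lemma write_sets_subset:
  "warrs (read_penalties c) \<subseteq> insert aWeight (range aPen)"
  "warrs (init_tables c) \<subseteq> range aTab"
  "wvars (merge_all c) \<subseteq> {vI, vV, vU} \<union> range vNew" "warrs (merge_all c) \<subseteq> range aTab"
  using warrs_shift[of c]
  by (auto simp: read_penalties_def read_members_def skip_edges_def init_tables_def merge_all_def merge_child_def)

lemma no_output [simp]:
  "\<not> emits (shift k)" "\<not> emits read_verts" "\<not> emits read_arcs" "\<not> emits read_rewards"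
  "\<not> emits (read_penalties c)" "\<not> emits find_order" "\<not> emits (init_tables c)" "\<not> emits (merge_all c)"
proof -
  show s: "\<not> emits (shift k)" for k by (induction k) auto
  show "\<not> emits read_verts" "\<not> emits read_arcs" "\<not> emits read_rewards"
    "\<not> emits (read_penalties c)" "\<not> emits find_order" "\<not> emits (init_tables c)" "\<not> emits (merge_all c)"
    using s[of c]
    by (auto simp: double_def read_verts_def read_arcs_def read_rewards_def read_penalties_def
        read_members_def skip_edges_def find_order_def visit_arc_def init_tables_def merge_all_def merge_child_def)
qed

text \<open>A loopless graph on one vertex has no arcs, so its edge list is empty and the code has
  the fixed shape on which the reading of rewards relies.\<close>

lemma reward_code_decode:
  assumes "pair_graph H" "pverts H = {v}" "weighted_graph_code w H xs"
  shows "\<exists>d. (w H = real (fst d) \<and> pverts H = {snd d}) \<and> xs = (\<lambda>(w, v). [w, 1, v, 0]) d"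
proof -
  obtain k vs es where *: "w H = real k" "distinct vs" "set vs = pverts H" "set es \<union> (set es)\<inverse> = parcs H"
    "xs = k # length vs # vs @ length es # concat (map (\<lambda>(u, v). [u, v]) es)"
    using assms(3) by (auto simp: weighted_graph_code_def graph_code_def)
  have "vs = [v]"
  proof -
    have "length vs = 1" using *(2,3) assms(2) distinct_card[of vs] by simp
    then show ?thesis using *(3) assms(2) by (cases vs) auto
  qed
  moreover have "parcs H = {}" using pair_graph_vertsD[OF assms(1)] assms(2) by fastforce
  then have "es = []" using *(4) by auto
  ultimately show ?thesis using * by (intro exI[of _ "(k, v)"]) simp
qed

lemma penalty_code_decode:
  assumes "weighted_graph_code w H xs"
  shows "\<exists>d. (w H = real (fst d) \<and> pverts H = set (fst (snd d)) \<and> distinct (fst (snd d))) \<and> xs = penalty_code d"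
proof -
  obtain k vs es where "w H = real k" "distinct vs" "set vs = pverts H"
    "xs = k # length vs # vs @ length es # concat (map (\<lambda>(u, v). [u, v]) es)"
    using assms by (auto simp: weighted_graph_code_def graph_code_def)
  then show ?thesis by (intro exI[of _ "(k, vs, es)"]) (simp add: penalty_code_def)
qed

lemma length_concat_pairs [simp]: "length (concat (map (\<lambda>(u, v). [u, v]) es)) = length es + length es"
  by (induction es) auto

text \<open>Rewards and penalty weights are multiples of \<open>2 ^ n\<close>, while the bits of the
  selected vertices are distinct powers below it; cost and mask share one number without
  interfering.\<close>

lemma total_cost_selection:
  fixes vs :: "nat list"
  assumes vs: "distinct vs" "length vs = n" and rs: "snd ` set rs \<subseteq> set vs" and S: "S \<subseteq> set vs"
    and wt: "\<And>i. i < length ps \<Longrightarrow> wt (Suc i) = 2 ^ n * fst (ps ! i)"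
    and r: "\<And>v. r (Suc v) = 2 ^ n * (\<Sum>(w, x)\<leftarrow>rs. if x = v then w else 0)"
    and bw: "\<And>i. i < n \<Longrightarrow> bw (Suc (vs ! i)) = 2 ^ i"
  shows "(\<Sum>w\<in>Suc ` set vs. if w \<in> Suc ` S then bw w else r w)
     + (\<Sum>p | p \<in> {1..length ps} \<and> Suc ` set (fst (snd (ps ! (p - 1)))) \<subseteq> Suc ` S. wt p)
     = 2 ^ n * selection_cost rs ps S + chosen_bits (\<lambda>i. vs ! i \<in> S) n"
proof -
  have "(\<Sum>w\<in>Suc ` set vs. if w \<in> Suc ` S then bw w else r w) =
      (\<Sum>v\<in>set vs. if v \<in> S then bw (Suc v) else r (Suc v))"
    by (subst sum.reindex) (auto intro!: sum.cong)
  also have "\<dots> = (\<Sum>v\<in>set vs. if v \<in> S then bw (Suc v) else 0) + (\<Sum>v\<in>set vs. if v \<in> S then 0 else r (Suc v))"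
    by (subst sum.distrib[symmetric]) (auto intro!: sum.cong)
  also have "(\<Sum>v\<in>set vs. if v \<in> S then bw (Suc v) else 0) = chosen_bits (\<lambda>i. vs ! i \<in> S) n"
  proof -
    have "bij_betw ((!) vs) {..<n} (set vs)" using vs by (intro bij_betw_nth) auto
    then show ?thesis
      unfolding chosen_bits_def using bw
      by (subst sum.reindex_bij_betw[symmetric]) (auto intro!: sum.cong)
  qed
  also have "(\<Sum>v\<in>set vs. if v \<in> S then 0 else r (Suc v)) = (\<Sum>v\<in>set vs - S. r (Suc v))"
    by (rule sum.mono_neutral_cong_right) auto
  also have "\<dots> = 2 ^ n * (\<Sum>(w, x)\<leftarrow>rs. if x \<in> set vs - S then w else 0)"
    by (simp add: r sum_distrib_left[symmetric] sum_sum_list_if_eq)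
  also have "(\<Sum>(w, x)\<leftarrow>rs. if x \<in> set vs - S then w else 0) = (\<Sum>(w, v)\<leftarrow>rs. if v \<in> S then 0 else w)"
    using rs by (intro arg_cong[where f = sum_list] map_cong) auto
  finally have 1: "(\<Sum>w\<in>Suc ` set vs. if w \<in> Suc ` S then bw w else r w) =
      chosen_bits (\<lambda>i. vs ! i \<in> S) n + 2 ^ n * (\<Sum>(w, v)\<leftarrow>rs. if v \<in> S then 0 else w)" .
  have img: "Suc ` X \<subseteq> Suc ` S \<longleftrightarrow> X \<subseteq> S" for X by auto
  have "(\<Sum>p | p \<in> {1..length ps} \<and> Suc ` set (fst (snd (ps ! (p - 1)))) \<subseteq> Suc ` S. wt p) =
      (\<Sum>p = 1..length ps. if set (fst (snd (ps ! (p - 1)))) \<subseteq> S then wt p else 0)"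
    unfolding img by (subst sum.inter_filter[symmetric]) simp_all
  also have "\<dots> = (\<Sum>i<length ps. if set (fst (snd (ps ! i))) \<subseteq> S then wt (Suc i) else 0)"
    unfolding One_nat_def sum.atLeast1_atMost_eq by simp
  also have "\<dots> = (\<Sum>i<length ps. 2 ^ n * (if set (fst (snd (ps ! i))) \<subseteq> S then fst (ps ! i) else 0))"
    by (rule sum.cong) (auto simp: wt)
  also have "\<dots> = 2 ^ n * (\<Sum>(w, M, es)\<leftarrow>ps. if set M \<subseteq> S then w else 0)"
    unfolding sum_distrib_left[symmetric] sum_list_sum_nth
    by (auto simp: atLeast0LessThan split_beta intro!: sum.cong)
  finally show ?thesis unfolding 1 selection_cost_def by (simp add: algebra_simps)
qed

text \<open>The slot function is cut to 0 from \<open>c\<close> on because \<open>pen_0\<close>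
  ranges over all \<open>j\<close>, whereas \<open>slots\<close> controls only those up to
  \<open>c\<close>.\<close>

lemma tree_program_instance:
  assumes inst: "sgsp_instance I" and tree: "undirected_tree (host I)" and freq: "max_frequency I \<le> c"
    and conn: "\<forall>P \<in> penalties I. Digraph_Component.connected (with_proj P)"
    and vs: "distinct vs" "set vs = pverts (host I)"
    and P: "list_all2 (penalty_match I) Ps ps" "distinct Ps" "set Ps = penalties I"
    and ord: "partial_order (Suc ` set vs) r0 (map_prod Suc Suc ` parcs (host I)) t" "seen t = Suc ` set vs"
    and slots: "slots c t (occurrences (map (\<lambda>p. fst (snd p)) ps))" and wt: "arrs t aWeight 0 = 0"
  shows "tree_program c (length ps) (length vs) (Suc ` set vs) (arrs t aOrd) (arrs t aPar)
    (map_prod Suc Suc ` parcs (host I)) (\<lambda>p. Suc ` set (fst (snd (ps ! (p - 1))))) (arrs t aWeight)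
    (\<lambda>j v. if j < c then arrs t (aPen j) v else 0)"
proof -
  let ?G = "host I" and ?V = "Suc ` set vs" and ?n = "length vs"
  let ?E = "map_prod Suc Suc ` parcs ?G"
  let ?ord = "arrs t aOrd" and ?par = "arrs t aPar"
  let ?L = "occurrences (map (\<lambda>p. fst (snd p)) ps)"
  have G: "pair_graph ?G" using tree by (simp add: undirected_tree_def)
  have cnt: "vars t vCnt = ?n"
  proof -
    have "card (seen t) = vars t vCnt"
      using ord(1) by (auto simp: partial_order_def seen_def card_image)
    then show ?thesis using ord(2) distinct_card[OF vs(1)] by (simp add: card_image)
  qed
  have inj: "inj_on ?ord {..<?n}" and img: "?ord ` {..<?n} = ?V"
    and root: "0 < ?n" "?ord 0 = r0" "?par r0 = 0"
    and par: "\<And>i. 0 < i \<Longrightarrow> i < ?n \<Longrightarrow> (?par (?ord i), ?ord i) \<in> ?E \<and> ?par (?ord i) \<in> ?ord ` {..<i}"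
    using ord cnt by (auto simp: partial_order_def seen_def)
  have len: "length Ps = length ps" using P(1) by (simp add: list_all2_lengthD)
  have match: "pverts (Ps ! (p - 1)) = set (fst (snd (ps ! (p - 1))))" "Ps ! (p - 1) \<in> penalties I"
    if "p \<in> {1..length ps}" for p
  proof -
    have "p - 1 < length ps" using that by auto
    then show "pverts (Ps ! (p - 1)) = set (fst (snd (ps ! (p - 1))))" "Ps ! (p - 1) \<in> penalties I"
      using list_all2_nthD2[OF P(1), of "p - 1"] P(3) len
      by (simp_all add: penalty_match_def flip: P(3))
  qed
  have sub: "pverts H \<subseteq> pverts ?G" "parcs H \<subseteq> parcs ?G" "pair_graph H" if "H \<in> penalties I" for H
    using inst that by (auto simp: sgsp_instance_def subgraph_def)
  have pen: "(if j < c then arrs t (aPen j) (Suc v) else 0) = (if j < c then nth0 (?L v) j else 0)"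
    "(if j < c then arrs t (aPen j) 0 else 0) = 0" for j v
    using slots by (auto simp: slots_def)
  \<comment> \<open>The frequency bound enters here: every penalty of a vertex sits in one of its
    first \<open>c\<close> slots, as \<open>pen_ex\<close> demands.\<close>
  have short: "length (?L v) \<le> c" if "v \<in> set vs" for v
  proof -
    have "frequency I v \<le> max_frequency I"
      unfolding max_frequency_def using that vs pair_graph_finite[OF G] by (intro Max_ge) auto
    then show ?thesis using length_occurrences_le_frequency[OF P, of v] freq by linarith
  qed
  have L: "set (?L v) = {p \<in> {1..length ps}. v \<in> set (fst (snd (ps ! (p - 1))))}" for v
    by (auto simp: set_occurrences)
  show ?thesis
  proof (unfold_locales, goal_cases)
    case 1
    show ?case using inj img by (simp add: bij_betw_def)
  next
    case 2
    show ?case by auto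
  next
    case 3
    show ?case using root by simp
  next
    case (4 i)
    then show ?case using par by blast
  next
    case (5 a b)
    then obtain x y where xy: "a = Suc x" "b = Suc y" "(x, y) \<in> parcs ?G" by auto
    \<comment> \<open>The absence of cycles concerns the original graph, so the shift of identifiers
      by one is undone.\<close>
    let ?o = "\<lambda>i. ?ord i - 1" and ?p = "\<lambda>i. ?par (?ord i) - 1"
    have "(\<lambda>i. ?ord i - 1) ` {..<?n} = (\<lambda>x. x - 1) ` ?V" unfolding img[symmetric] image_image ..
    then have o_img: "?o ` {..<?n} = pverts ?G" using vs by (simp add: image_image)
    have pos: "0 < ?ord i" if "i < ?n" for i
    proof -
      have "?ord i \<in> ?V" using that img by blast
      then show ?thesis by auto
    qed
    have "inj_on ?o {..<?n}"
    proof (rule inj_onI)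
      fix i j assume ij: "i \<in> {..<?n}" "j \<in> {..<?n}" "?o i = ?o j"
      then have "?ord i = ?ord j" using pos[of i] pos[of j] by simp
      then show "i = j" using inj_onD[OF inj] ij by blast
    qed
    moreover have "(?p i, ?o i) \<in> parcs ?G \<and> ?p i \<in> ?o ` {..<i}" if i: "0 < i" "i < ?n" for i
    proof
      obtain x y where "?par (?ord i) = Suc x" "?ord i = Suc y" "(x, y) \<in> parcs ?G"
        using par[OF i] by auto
      then show "(?p i, ?o i) \<in> parcs ?G" by simp
      obtain k where "k < i" "?par (?ord i) = ?ord k" using par[OF i] by auto
      then show "?p i \<in> ?o ` {..<i}" by (intro image_eqI[of _ _ k]) auto
    qed
    ultimately obtain i where i: "0 < i" "i < ?n" "y = ?o i \<and> x = ?p i \<or> x = ?o i \<and> y = ?p i"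
      using tree_arc_parental[OF tree _ o_img _ xy(3), of ?p] by blast
    have "?ord ` {..<i} \<subseteq> ?V" unfolding img[symmetric] using i(2) by (intro image_mono) auto
    then have "?par (?ord i) \<in> ?V" using par[OF i(1,2)] by blast
    then have "Suc (?p i) = ?par (?ord i)" "Suc (?o i) = ?ord i" using pos[OF i(2)] by auto
    then have "a = ?par b \<or> b = ?par a" using i(3) xy(1,2) by metis
    then show ?case using xy vs pair_graph_vertsD[OF G xy(3)] by auto
  next
    case (6 p)
    have "Digraph_Component.connected (with_proj (Ps ! (p - 1)))" using match(2)[OF 6] conn by blast
    then have "pverts (Ps ! (p - 1)) \<noteq> {}"
      by (auto simp: Digraph_Component.connected_def strongly_connected_def)
    then show ?case using match(1)[OF 6] by auto
  next
    case (7 p)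
    then show ?case using match[OF 7] sub(1)[OF match(2)[OF 7]] vs by auto
  next
    case (8 p X)
    let ?H = "Ps ! (p - 1)"
    note H = match[OF 8(1)]
    have "pverts ?H \<subseteq> {v. Suc v \<in> X}"
    proof (rule connected_closed[OF sub(3)[OF H(2)]])
      show "Digraph_Component.connected (with_proj ?H)" using conn H(2) by blast
      show "pverts ?H \<inter> {v. Suc v \<in> X} \<noteq> {}" using 8(2) H(1) by auto
      fix a b assume ab: "(a, b) \<in> parcs ?H" "a \<in> {v. Suc v \<in> X}"
      then have "(Suc a, Suc b) \<in> ?E" using sub(2)[OF H(2)] by force
      moreover have "a \<in> pverts ?H" "b \<in> pverts ?H"
        using pair_graph_vertsD[OF sub(3)[OF H(2)] ab(1)] by auto
      ultimately show "b \<in> {v. Suc v \<in> X}" using 8(3)[of "Suc a" "Suc b"] ab(2) H(1) by auto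
    qed
    then show ?case using H(1) by auto
  next
    case 9
    show ?case by (rule wt)
  next
    case (10 j)
    show ?case using pen(2) .
  next
    case (11 j v)
    then obtain x where x: "v = Suc x" by auto
    then have "nth0 (?L x) j \<noteq> 0" using 11 pen(1)[of j x] by simp
    then have "nth0 (?L x) j \<in> set (?L x)" by (auto simp: nth0_def split: if_splits)
    then show ?case using 11 x pen(1)[of j x] L[of x] by auto
  next
    case (12 p v)
    then obtain x where x: "v = Suc x" "x \<in> set vs" by auto
    then have "p \<in> set (?L x)" using 12 L by auto
    then obtain j where "j < length (?L x)" "?L x ! j = p" by (auto simp: in_set_conv_nth)
    then show ?case using short[OF x(2)] pen(1)[of j x] x(1) by (intro exI[of _ j]) (auto simp: nth0_def)
  next
    case (13 i j v)
    then obtain x where x: "v = Suc x" "x \<in> set vs" by auto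
    then have "nth0 (?L x) i = nth0 (?L x) j" "nth0 (?L x) i \<noteq> 0"
      using 13 pen(1)[of i x] pen(1)[of j x] by auto
    then show ?case
      using distinct_occurrences[of "map (\<lambda>p. fst (snd p)) ps" x]
      by (auto simp: nth0_def nth_eq_iff_index_eq split: if_splits)
  qed
qed


section \<open>The phases of the solver put together\<close>

lemma solver_correct:
  assumes inst: "sgsp_instance I" and tree: "undirected_tree (host I)" and freq: "max_frequency I \<le> c"
    and conn: "\<forall>P \<in> penalties I. Digraph_Component.connected (with_proj P)"
    and vs: "distinct vs" "set vs = pverts (host I)"
    and es: "set (darcs es) = parcs (host I)"
    and R: "list_all2 (reward_match I) Rs rs" "distinct Rs" "set Rs = rewards I"
    and P: "list_all2 (penalty_match I) Ps ps" "distinct Ps" "set Ps = penalties I"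
    and xs: "xs = (length vs # vs @ length es # concat (map (\<lambda>(u, v). [u, v]) es))
      @ (length rs # concat (map (\<lambda>(w, v). [w, 1, v, 0]) rs))
      @ (length ps # concat (map penalty_code ps))"
    and B: "1 \<le> B" "length xs \<le> B" "(\<Sum>(w, v)\<leftarrow>rs. w) \<le> B"
  shows "wp B (solver c) (\<lambda>t. sgsp_solution_code I (outp t)) (start xs)"
proof -
  let ?G = "host I" and ?n = "length vs" and ?V = "Suc ` set vs"
  let ?E = "map_prod Suc Suc ` parcs ?G"
  have G: "pair_graph ?G" using tree by (simp add: undirected_tree_def)
  have "set vs \<noteq> {}"
    using tree vs by (auto simp: undirected_tree_def Digraph_Component.connected_def strongly_connected_def)
  then have n: "0 < ?n" by simp
  let ?e = "concat (map (\<lambda>(u, v). [u, v]) es)" and ?r = "concat (map (\<lambda>(w, v). [w, 1, v, 0]) rs)"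
    and ?p = "concat (map penalty_code ps)"
  have lens: "?n \<le> B" "length (darcs es) \<le> B" "length es \<le> B" "length ps \<le> B"
  proof -
    have "length ps \<le> length ?p" by (induction ps) (auto simp: penalty_code_def)
    then show "?n \<le> B" "length (darcs es) \<le> B" "length es \<le> B" "length ps \<le> B"
      using B(2) unfolding xs by simp_all
  qed
  have len_rs: "length rs \<le> B"
  proof -
    have "length rs \<le> length ?r" by (induction rs) auto
    then show ?thesis using B(2) unfolding xs by simp
  qed
  have pens: "distinct M \<and> length M \<le> B \<and> length fs \<le> B" if mem: "(w, M, fs) \<in> set ps" for w M fs
  proof -
    have "penalty_code (w, M, fs) \<in> set (map penalty_code ps)" using mem by force
    then have "length (penalty_code (w, M, fs)) \<le> length ?p"
      unfolding length_concat by (intro member_le_sum_list) auto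
    then have "length M \<le> B" "length fs \<le> B" using B(2) unfolding xs by (simp_all add: penalty_code_def)
    moreover have "distinct M"
    proof -
      obtain i where i: "i < length ps" "ps ! i = (w, M, fs)" using mem by (auto simp: in_set_conv_nth)
      then show ?thesis using list_all2_nthD2[OF P(1) i(1)] by (simp add: penalty_match_def)
    qed
    ultimately show ?thesis by simp
  qed
  have rs_sub: "snd ` set rs \<subseteq> set vs"
  proof
    fix v assume "v \<in> snd ` set rs"
    then obtain i where i: "i < length rs" "v = snd (rs ! i)" by (auto simp: in_set_conv_nth)
    then have "pverts (Rs ! i) = {v}" "Rs ! i \<in> rewards I"
      using R by (auto simp: list_all2_conv_all_nth reward_match_def)
    moreover from this have "subgraph (with_proj (Rs ! i)) (with_proj ?G)"
      using inst by (auto simp: sgsp_instance_def)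
    ultimately show "v \<in> set vs" by (auto simp: subgraph_def vs(2))
  qed

  let ?s0 = "start xs :: (var, arr) state"
  define s1 where "s1 = run read_verts ?s0"
  have f1: "frame read_verts ?s0 s1" by (simp add: s1_def frame_run)
  have "wp B read_verts (\<lambda>t. inp t = length es # ?e @ length rs # ?r @ length ps # ?p \<and>
    vars t vN = ?n \<and> vars t vScale = 2 ^ ?n \<and>
    (\<forall>i < ?n. arrs t aVert i = Suc (vs ! i) \<and> arrs t aBit (Suc (vs ! i)) = 2 ^ i)) ?s0"
    by (rule read_verts_correct) (use vs lens in \<open>simp_all add: xs start_def\<close>)
  then have s1: "safe B read_verts ?s0" "inp s1 = length es # ?e @ length rs # ?r @ length ps # ?p"
    "vars s1 vN = ?n" "vars s1 vScale = 2 ^ ?n"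
    "\<And>i. i < ?n \<Longrightarrow> arrs s1 aVert i = Suc (vs ! i) \<and> arrs s1 aBit (Suc (vs ! i)) = 2 ^ i"
    by (simp_all add: wp_def s1_def)

  define s2 where "s2 = run read_arcs s1"
  have f2: "frame read_arcs s1 s2" by (simp add: s2_def frame_run)
  have "wp B read_arcs (\<lambda>t. inp t = length rs # ?r @ length ps # ?p \<and> vars t vNA = length (darcs es) \<and>
    (\<forall>i < length (darcs es). arrs t aSrc i = Suc (fst (darcs es ! i)) \<and>
      arrs t aDst i = Suc (snd (darcs es ! i)))) s1"
    by (rule read_arcs_correct) (use s1 lens in simp_all)
  then have s2: "safe B read_arcs s1" "inp s2 = length rs # ?r @ length ps # ?p"
    "vars s2 vNA = length (darcs es)"
    "\<And>i. i < length (darcs es) \<Longrightarrow> arrs s2 aSrc i = Suc (fst (darcs es ! i)) \<and>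
      arrs s2 aDst i = Suc (snd (darcs es ! i))"
    by (simp_all add: wp_def s2_def)

  define s3 where "s3 = run read_rewards s2"
  have f3: "frame read_rewards s2 s3" by (simp add: s3_def frame_run)
  have "wp B read_rewards (\<lambda>t. inp t = length ps # ?p \<and> vars t vTot = (\<Sum>(w, v)\<leftarrow>rs. w) \<and>
    (\<forall>v. arrs t aReward (Suc v) = 2 ^ ?n * (\<Sum>(w, x)\<leftarrow>rs. if x = v then w else 0))) s2"
    by (rule read_rewards_correct)
       (use s1 s2 f1 f2 lens len_rs in \<open>simp_all add: frame_def start_def\<close>)
  then have s3: "safe B read_rewards s2" "inp s3 = length ps # ?p" "vars s3 vTot = (\<Sum>(w, v)\<leftarrow>rs. w)"
    "\<And>v. arrs s3 aReward (Suc v) = 2 ^ ?n * (\<Sum>(w, x)\<leftarrow>rs. if x = v then w else 0)"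
    by (simp_all add: wp_def s3_def)

  define s4 where "s4 = run (read_penalties c) s3"
  have f4: "frame (read_penalties c) s3 s4" by (simp add: s4_def frame_run)
  have "wp B (read_penalties c) (\<lambda>t. inp t = [] \<and> arrs t aWeight 0 = 0 \<and>
    (\<forall>i < length ps. arrs t aWeight (Suc i) = 2 ^ ?n * fst (ps ! i)) \<and>
    slots c t (occurrences (map (\<lambda>p. fst (snd p)) ps))) s3"
    by (rule read_penalties_correct)
       (use s1 s2 s3 f1 f2 f3 lens pens in \<open>simp_all add: frame_def start_def slots_def\<close>)
  then have s4: "safe B (read_penalties c) s3" "arrs s4 aWeight 0 = 0"
    "\<And>i. i < length ps \<Longrightarrow> arrs s4 aWeight (Suc i) = 2 ^ ?n * fst (ps ! i)"
    "slots c s4 (occurrences (map (\<lambda>p. fst (snd p)) ps))"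
    by (simp_all add: wp_def s4_def)
  have k4: "arrs s4 a = arrs s3 a" if "a \<noteq> aWeight" "\<And>j. a \<noteq> aPen j" for a
    using f4 write_sets_subset(1)[of c] that unfolding frame_def by blast

  define as where "as = map (map_prod Suc Suc) (darcs es)"
  have set_as: "set as = ?E" using es by (simp add: as_def)
  define s5 where "s5 = run find_order s4"
  have f5: "frame find_order s4 s5" by (simp add: s5_def frame_run)
  have "wp B find_order (\<lambda>t. partial_order ?V (Suc (vs ! 0)) (set as) t \<and> seen t = ?V) s4"
  proof (rule find_order_correct)
    show "arc_arrays as s4"
      using s2 f3 f4 k4 by (simp add: arc_arrays_def as_def frame_def)
    show "length as \<le> B" using lens by (simp add: as_def)
    show "1 \<le> B" by (rule B(1))
    show "set as \<subseteq> ?V \<times> ?V" using pair_graph_vertsD[OF G] vs unfolding set_as by auto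
    show "arrs s4 aSeen v = 0" "arrs s4 aPar v = 0" for v
      using k4 f1 f2 f3 by (simp_all add: frame_def start_def)
    show "arrs s4 aVert 0 = Suc (vs ! 0)" using k4 f2 f3 s1(5)[OF n] by (simp add: frame_def)
    show "Suc (vs ! 0) \<in> ?V" using n by simp
    fix v assume "v \<in> ?V"
    then obtain y where y: "v = Suc y" "y \<in> pverts ?G" using vs by auto
    have "card (parcs ?G) \<le> length as" unfolding as_def length_map es[symmetric] by (rule card_length)
    moreover have "vs ! 0 \<in> pverts ?G" unfolding vs(2)[symmetric] using n by simp
    ultimately obtain k where "k \<le> length as" "(vs ! 0, y) \<in> parcs ?G ^^ k"
      using connected_relpow[OF G _ _ y(2), of "vs ! 0" "length as"] tree
      unfolding undirected_tree_def by blast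
    then show "\<exists>k \<le> length as. (Suc (vs ! 0), v) \<in> set as ^^ k"
      using relpow_map_prod_Suc unfolding set_as y(1) by blast
  qed
  then have s5: "safe B find_order s4" "partial_order ?V (Suc (vs ! 0)) ?E s5" "seen s5 = ?V"
    by (simp_all add: wp_def s5_def set_as)
  have slots5: "slots c s5 (occurrences (map (\<lambda>p. fst (snd p)) ps))"
    using s4(4) f5 by (simp add: slots_def frame_def)

  define pen where "pen = (\<lambda>j v. if j < c then arrs s5 (aPen j) v else 0)"
  define Q where "Q = (\<lambda>p. Suc ` set (fst (snd (ps ! (p - 1)))))"
  interpret tree_program c "length ps" ?n ?V "arrs s5 aOrd" "arrs s5 aPar" ?E Q "arrs s5 aWeight"
    "arrs s5 aReward" "arrs s5 aBit" pen
    unfolding pen_def Q_def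
    by (rule tree_program_instance[OF inst tree freq conn vs P s5(2,3) slots5])
       (use s4(2) f5 in \<open>simp add: frame_def\<close>)

  have verts5: "arrs s5 aVert i = Suc (vs ! i) \<and> arrs s5 aBit (Suc (vs ! i)) = 2 ^ i" if "i < ?n" for i
    using s1(5)[OF that] f2 f3 k4 f5 by (simp add: frame_def)
  have vars5: "vars s5 vN = ?n" "vars s5 vScale = 2 ^ ?n" "vars s5 vTot = (\<Sum>(w, v)\<leftarrow>rs. w)"
    using s1 s3 f2 f3 f4 f5 by (simp_all add: frame_def)

  define s6 where "s6 = run (init_tables c) s5"
  have f6: "frame (init_tables c) s5 s6" by (simp add: s6_def frame_run)
  have k6: "arrs s6 a = arrs s5 a" if "\<And>j. a \<noteq> aTab j" for a
    using f6 write_sets_subset(2)[of c] that unfolding frame_def by blast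
  have "wp B (init_tables c) (\<lambda>t. tables ?n (\<lambda>A. arrs t (aTab A))) s5"
  proof (rule init_tables_correct)
    show "arrs s5 aVert ` {..<?n} = ?V"
      using verts5 by (auto simp: set_conv_nth image_def)
    show "arrs s5 (aTab A) 0 = 0" for A
      using f1 f2 f3 k4 f5 by (simp add: frame_def start_def)
  qed (use vars5 lens in \<open>simp_all add: pen_def\<close>)
  then have s6: "safe B (init_tables c) s5" "tables ?n (\<lambda>A. arrs s6 (aTab A))"
    by (simp_all add: wp_def s6_def)

  define s7 where "s7 = run (merge_all c) s6"
  have f7: "frame (merge_all c) s6 s7" by (simp add: s7_def frame_run)
  have k7: "arrs s7 a = arrs s5 a" if "\<And>j. a \<noteq> aTab j" for a
  proof -
    have "a \<notin> warrs (merge_all c)" using write_sets_subset(4)[of c] that by blast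
    then have "arrs s7 a = arrs s6 a" using f7 unfolding frame_def by blast
    then show ?thesis using k6[OF that] by simp
  qed
  have v7: "vars s7 vN = ?n" "vars s7 vScale = 2 ^ ?n" "vars s7 vTot = (\<Sum>(w, v)\<leftarrow>rs. w)"
  proof -
    have "vN \<notin> wvars (merge_all c)" "vScale \<notin> wvars (merge_all c)" "vTot \<notin> wvars (merge_all c)"
      using write_sets_subset(3)[of c] by blast+
    then have "vars s7 vN = vars s6 vN" "vars s7 vScale = vars s6 vScale" "vars s7 vTot = vars s6 vTot"
      using f7 unfolding frame_def by blast+
    then show "vars s7 vN = ?n" "vars s7 vScale = 2 ^ ?n" "vars s7 vTot = (\<Sum>(w, v)\<leftarrow>rs. w)"
      using f6 vars5 by (simp_all add: frame_def)
  qed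
  have "wp B (merge_all c) (\<lambda>t. tables 0 (\<lambda>A. arrs t (aTab A))) s6"
    by (rule merge_all_correct) (use vars5 lens s6 f6 k6 in \<open>simp_all add: pen_def frame_def\<close>)
  then have s7: "safe B (merge_all c) s6" "tables 0 (\<lambda>A. arrs s7 (aTab A))"
    by (simp_all add: wp_def s7_def)

  obtain S' where S': "S' \<subseteq> ?V" "arrs s7 (aTab 0) 0 = total_cost S'"
    "\<And>T. T \<subseteq> ?V \<Longrightarrow> total_cost S' \<le> total_cost T"
    using tables_final[OF s7(2)] by blast
  define S where "S = {v. Suc v \<in> S'}"
  have S: "S' = Suc ` S" "S \<subseteq> set vs" using S'(1) by (auto simp: S_def)
  have total: "total_cost (Suc ` T) = 2 ^ ?n * selection_cost rs ps T + chosen_bits (\<lambda>i. vs ! i \<in> T) ?n"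
    if "T \<subseteq> set vs" for T
    unfolding total_cost_def unfolding Q_def
    by (rule total_cost_selection[OF vs(1) refl rs_sub that])
       (use s3(4) s4(3) k4 f5 verts5 in \<open>simp_all add: frame_def\<close>)
  have opt: "selection_cost rs ps S \<le> selection_cost rs ps T" if "T \<subseteq> set vs" for T
  proof -
    have "total_cost (Suc ` S) \<le> total_cost (Suc ` T)" using S'(3)[of "Suc ` T"] S(1) that by auto
    \<comment> \<open>Masks stay below \<open>2 ^ n\<close>, so they only break ties: one more unit
      of cost outweighs any mask.\<close>
    then have "2 ^ ?n * selection_cost rs ps S < 2 ^ ?n * Suc (selection_cost rs ps T)"
      using total[OF S(2)] total[OF that] chosen_bits_less[of "\<lambda>i. vs ! i \<in> T" ?n] by simp
    then show ?thesis unfolding nat_mult_less_cancel_disj less_Suc_eq_le by blast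
  qed
  \<comment> \<open>The empty selection misses all rewards and completes no penalty, because
    penalties are nonempty. This bounds the optimum by \<open>vTot\<close>, the number of
    subtractions in \<open>decode\<close>.\<close>
  have "selection_cost rs ps {} = (\<Sum>(w, v)\<leftarrow>rs. w)"
  proof -
    have "M \<noteq> []" if mem: "(w, M, fs) \<in> set ps" for w M fs
    proof -
      obtain i where i: "i < length ps" "ps ! i = (w, M, fs)" using mem by (auto simp: in_set_conv_nth)
      then have "Q (Suc i) \<noteq> {}" by (intro P_ne) simp
      then show ?thesis using i by (auto simp: Q_def)
    qed
    then have "(\<Sum>(w, M, es)\<leftarrow>ps. if set M \<subseteq> {} then w else 0) = 0"
      by (auto simp: sum_list_eq_0_iff)
    then show ?thesis by (simp add: selection_cost_def)
  qed
  then have cost_le: "selection_cost rs ps S \<le> vars s7 vTot" using opt[of "{}"] v7 by simp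
  have out: "outp s7 = []"
    using f1 f2 f3 f4 f5 f6 f7 by (simp add: frame_def start_def)
  have "wp B decode (\<lambda>t. distinct (outp t) \<and> set (outp t) = {vs ! i | i. i < ?n \<and> vs ! i \<in> S}) s7"
    by (rule decode_correct[OF v7(1) lens(1) v7(2) cost_le _ B(1)])
       (use v7 B k7 verts5 vs out S'(2) total[OF S(2)] S(1) in simp_all)
  moreover have "{vs ! i | i. i < ?n \<and> vs ! i \<in> S} = S"
  proof -
    have "\<exists>i < ?n. vs ! i = x" if "x \<in> S" for x using that S(2) by (meson in_set_conv_nth subsetD)
    then show ?thesis by fastforce
  qed
  ultimately have s8: "safe B decode s7" "distinct (outp (run decode s7))" "set (outp (run decode s7)) = S"
    by (simp_all add: wp_def)
  have "sgsp_value I T \<le> sgsp_value I S" if "T \<subseteq> pverts ?G" for T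
    using sgsp_value_selection_cost[OF R P, of T] sgsp_value_selection_cost[OF R P, of S]
      opt[of T] that vs by simp
  then have "sgsp_solution_code I (outp (run decode s7))"
    using s8 S(2) vs by (simp add: sgsp_solution_code_def sgsp_optimal_def)
  then show ?thesis
    using s1(1) s2(1) s3(1) s4(1) s5(1) s6(1) s7(1) s8(1)
    by (simp add: wp_def solver_def s1_def s2_def s3_def s4_def s5_def s6_def s7_def)
qed

theorem mainTheorem7:
  fixes c :: nat and q :: "nat poly"
  shows "poly_time_solvable
    (\<lambda>I xs. sgsp_code I xs \<and> sgsp_instance I
        \<and> undirected_tree (host I)
        \<and> max_frequency I \<le> c
        \<and> (\<forall>R \<in> rewards I. \<exists>v. pverts R = {v})
        \<and> (\<forall>P \<in> penalties I. Digraph_Component.connected (with_proj P))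
        \<and> weights_bounded q (bit_size xs) I)
    sgsp_solution_code"
proof (rule poly_time_solvable_com[where c = "solver c" and b = "[:1, 1:] + [:0, 1:] * q"], elim conjE)
  fix I xs
  assume code: "sgsp_code I xs" and inst: "sgsp_instance I" and tree: "undirected_tree (host I)"
    and freq: "max_frequency I \<le> c" and single: "\<forall>R \<in> rewards I. \<exists>v. pverts R = {v}"
    and conn: "\<forall>P \<in> penalties I. Digraph_Component.connected (with_proj P)"
    and bounded: "weights_bounded q (bit_size xs) I"
  \<comment> \<open>With \<open>x\<close> the input size, \<open>1 + x\<close> covers the
    conditionals and all counts of list items, and \<open>x * q x\<close> the total reward: at most
    \<open>x\<close> rewards of weight at most \<open>q x\<close> each.\<close>
  let ?B = "poly ([:1, 1:] + [:0, 1:] * q) (bit_size xs)"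
  obtain g r p where grp: "graph_code (host I) g" "family_code (weight I) (rewards I) r"
    "family_code (weight I) (penalties I) p" "xs = g @ r @ p"
    using code unfolding sgsp_code_def by metis
  obtain vs es where
    vs: "distinct vs" "set vs = pverts (host I)" and es: "set es \<union> (set es)\<inverse> = parcs (host I)"
    and g: "g = length vs # vs @ length es # concat (map (\<lambda>(u, v). [u, v]) es)"
    using grp(1) unfolding graph_code_def by metis
  obtain Rs rcs where Rs: "distinct Rs" "set Rs = rewards I"
    "list_all2 (weighted_graph_code (weight I)) Rs rcs" and r: "r = length Rs # concat rcs"
    using grp(2) unfolding family_code_def by metis
  obtain Ps pcs where Ps: "distinct Ps" "set Ps = penalties I"
    "list_all2 (weighted_graph_code (weight I)) Ps pcs" and p: "p = length Ps # concat pcs"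
    using grp(3) unfolding family_code_def by metis
  note xs = grp(4)[unfolded g r p]
  have graph: "pair_graph H" if "H \<in> rewards I" for H
    using inst that by (auto simp: sgsp_instance_def)
  have "\<exists>rs. list_all2 (reward_match I) Rs rs \<and> rcs = map (\<lambda>(w, v). [w, 1, v, 0]) rs"
  proof (rule list_all2_decode[OF Rs(3)])
    fix H c assume H: "H \<in> set Rs" and c: "weighted_graph_code (weight I) H c"
    obtain v where "pverts H = {v}" using single H Rs(2) by blast
    then show "\<exists>d. reward_match I H d \<and> c = (\<lambda>(w, v). [w, 1, v, 0]) d"
      unfolding reward_match_def using reward_code_decode[OF graph _ c] H Rs(2) by blast
  qed
  then obtain rs where rs: "list_all2 (reward_match I) Rs rs" "rcs = map (\<lambda>(w, v). [w, 1, v, 0]) rs"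
    by blast
  have "\<exists>ps. list_all2 (penalty_match I) Ps ps \<and> pcs = map penalty_code ps"
    using penalty_code_decode unfolding penalty_match_def by (rule list_all2_decode[OF Ps(3)])
  then obtain ps where ps: "list_all2 (penalty_match I) Ps ps" "pcs = map penalty_code ps"
    by blast
  have len: "length Rs = length rs" "length Ps = length ps"
    using rs ps by (simp_all add: list_all2_lengthD)
  have tot: "(\<Sum>(w, v)\<leftarrow>rs. w) \<le> bit_size xs * poly q (bit_size xs)"
  proof -
    have "w \<le> poly q (bit_size xs)" if "(w, v) \<in> set rs" for w v
    proof -
      obtain i where i: "i < length rs" "rs ! i = (w, v)" using \<open>(w, v) \<in> set rs\<close> by (auto simp: in_set_conv_nth)
      then have "weight I (Rs ! i) = real w" "Rs ! i \<in> rewards I"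
        using rs(1) Rs(2) len by (auto simp: list_all2_conv_all_nth reward_match_def)
      moreover from this have "Rs ! i \<in> rewards I \<union> penalties I" by simp
      from bounded[unfolded weights_bounded_def, rule_format, OF this]
      obtain k where "weight I (Rs ! i) = real k" "k \<le> poly q (bit_size xs)" by blast
      ultimately show ?thesis by simp
    qed
    then have "(\<Sum>(w, v)\<leftarrow>rs. w) \<le> (\<Sum>d\<leftarrow>rs. poly q (bit_size xs))"
      by (intro sum_list_mono) auto
    also have "\<dots> = length rs * poly q (bit_size xs)" by (simp add: sum_list_triv)
    also have "length rs \<le> length xs"
    proof -
      have "length rs \<le> length (concat rcs)" unfolding rs(2) by (induction rs) auto
      then show ?thesis unfolding xs by simp
    qed
    then have "length rs * poly q (bit_size xs) \<le> bit_size xs * poly q (bit_size xs)"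
      using bit_size_ge_length[of xs] by (intro mult_right_mono) auto
    finally show ?thesis .
  qed
  have "wp ?B (solver c) (\<lambda>t. sgsp_solution_code I (outp t)) (start xs)"
  proof (rule solver_correct[OF inst tree freq conn vs _ rs(1) Rs(1,2) ps(1) Ps(1,2)])
    show "set (darcs es) = parcs (host I)" by (simp add: set_darcs es)
    show "xs = (length vs # vs @ length es # concat (map (\<lambda>(u, v). [u, v]) es))
      @ (length rs # concat (map (\<lambda>(w, v). [w, 1, v, 0]) rs))
      @ (length ps # concat (map penalty_code ps))"
      by (simp only: xs rs(2) ps(2) len)
  qed (use tot bit_size_ge_length[of xs] in simp_all)
  then show "safe ?B (solver c) (start xs) \<and> sgsp_solution_code I (outp (run (solver c) (start xs)))"
    unfolding wp_def .
qed

end
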